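(* For every $c\in(1,2)$ and every $p\in(1,\infty)$ there exists a positive constant $C_{c,p}$ such that for every finitely supported $f\colon\mathbb{Z}\to\mathbb{C}$ $$\|\mathcal{C}_c f\|_{\ell^p(\mathbb{Z})}\le C_{c,p}\|f\|_{\ell^p(\mathbb{Z})}\quad\text{and}\quad \|\mathcal{C}^{\mathrm{sgn}}_c f\|_{\ell^p(\mathbb{Z})}\le C_{c,p}\|f\|_{\ell^p(\mathbb{Z})}.$$
   Context: For $c\in(1,2)$ and a finitely supported $f\colon\mathbb{Z}\to\mathbb{C}$, the $c$-modulated Carleson operators are defined for $x\in\mathbb{Z}$ by $$\mathcal{C}_{c}f(x)=\sup_{\lambda\in[-1/2,1/2)}\Big|\sum_{n\neq 0}f(x-n)\frac{e^{2\pi i\lambda\lfloor|n|^c\rfloor}}{n}\Big|,\qquad \mathcal{C}^{\mathrm{sgn}}_{c}f(x)=\sup_{\lambda\in[-1/2,1/2)}\Big|\sum_{n\neq 0}f(x-n)\frac{e^{2\pi i\lambda\,\mathrm{sign}(n)\lfloor|n|^c\rfloor}}{n}\Big|,$$ where the sums run over $n\in\mathbb{Z}\setminus\{0\}$ and $\lfloor\cdot\rfloor$ is the integer part. *)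

theory Defs
  imports "HOL-Analysis.Analysis"
begin

text \<open>
  The sum below has only finitely many nonzero terms when \<open>f\<close> is finitely supported, and the
  real-valued supremum is then taken over a bounded set (lemma \<open>bdd_above_modulated_hilbert\<close>).
\<close>

definition modulated_hilbert :: "(int \<Rightarrow> int) \<Rightarrow> real \<Rightarrow> (int \<Rightarrow> complex) \<Rightarrow> int \<Rightarrow> complex" where
  "modulated_hilbert \<phi> \<theta> f x =
     (\<Sum>\<^sub>\<infinity>n\<in>UNIV - {0}.
        f (x - n) * exp (2 * of_real pi * \<i> * of_real \<theta> * of_int (\<phi> n)) / of_int n)"

definition modulated_carleson :: "(int \<Rightarrow> int) \<Rightarrow> (int \<Rightarrow> complex) \<Rightarrow> int \<Rightarrow> real" where
  "modulated_carleson \<phi> f x = (SUP \<theta>\<in>{-1/2..<1/2}. cmod (modulated_hilbert \<phi> \<theta> f x))"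

definition carleson :: "real \<Rightarrow> (int \<Rightarrow> complex) \<Rightarrow> int \<Rightarrow> real" where
  "carleson c = modulated_carleson (\<lambda>n. \<lfloor>real_of_int \<bar>n\<bar> powr c\<rfloor>)"

definition carleson_sgn :: "real \<Rightarrow> (int \<Rightarrow> complex) \<Rightarrow> int \<Rightarrow> real" where
  "carleson_sgn c = modulated_carleson (\<lambda>n. sgn n * \<lfloor>real_of_int \<bar>n\<bar> powr c\<rfloor>)"

text \<open>The norm takes the value \<open>\<infinity>\<close> off the space, so a finite bound includes membership.\<close>

definition lp_norm :: "real \<Rightarrow> (int \<Rightarrow> 'a::real_normed_vector) \<Rightarrow> ennreal" where
  "lp_norm p g =
     (if (\<lambda>x. norm (g x) powr p) summable_on UNIV
      then ennreal ((\<Sum>\<^sub>\<infinity>x. norm (g x) powr p) powr (1 / p))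
      else \<infinity>)"

lemma modulated_hilbert_finite_support:
  assumes "finite {x. f x \<noteq> 0}"
  shows "finite {n. n \<noteq> 0 \<and> f (x - n) \<noteq> 0}"
    and "modulated_hilbert \<phi> \<theta> f x =
      (\<Sum>n | n \<noteq> 0 \<and> f (x - n) \<noteq> 0.
         f (x - n) * exp (2 * of_real pi * \<i> * of_real \<theta> * of_int (\<phi> n)) / of_int n)"
proof -
  have "{n. n \<noteq> 0 \<and> f (x - n) \<noteq> 0} \<subseteq> (\<lambda>y. x - y) ` {y. f y \<noteq> 0}"
    by (auto intro!: image_eqI[where x = "x - n" for n])
  then show fin: "finite {n. n \<noteq> 0 \<and> f (x - n) \<noteq> 0}"
    using assms finite_surj by blast
  have "modulated_hilbert \<phi> \<theta> f x =
      (\<Sum>\<^sub>\<infinity>n | n \<noteq> 0 \<and> f (x - n) \<noteq> 0.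
         f (x - n) * exp (2 * of_real pi * \<i> * of_real \<theta> * of_int (\<phi> n)) / of_int n)"
    unfolding modulated_hilbert_def by (rule infsum_cong_neutral) auto
  then show "modulated_hilbert \<phi> \<theta> f x =
      (\<Sum>n | n \<noteq> 0 \<and> f (x - n) \<noteq> 0.
         f (x - n) * exp (2 * of_real pi * \<i> * of_real \<theta> * of_int (\<phi> n)) / of_int n)"
    using fin by simp
qed

lemma bdd_above_modulated_hilbert:
  assumes "finite {x. f x \<noteq> 0}"
  shows "bdd_above ((\<lambda>\<theta>. cmod (modulated_hilbert \<phi> \<theta> f x)) ` A)"
proof (rule bdd_aboveI2)
  fix \<theta> :: real
  have unimodular: "cmod (exp (2 * of_real pi * \<i> * of_real \<theta> * of_int (\<phi> n))) = 1" for n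
    by (simp add: norm_exp_eq_Re)
  show "cmod (modulated_hilbert \<phi> \<theta> f x)
      \<le> (\<Sum>n | n \<noteq> 0 \<and> f (x - n) \<noteq> 0. cmod (f (x - n)) / \<bar>of_int n\<bar>)"
    unfolding modulated_hilbert_finite_support(2)[OF assms]
    by (rule sum_norm_le) (simp add: norm_mult norm_divide unimodular)
qed

end

theory Submission
  imports Defs "HOL-Real_Asymp.Real_Asymp"
begin

text \<open>
  Write \<open>e(t) = exp(2\<pi>it)\<close>.  Split the sum dyadically, \<open>|n| ~ 2\<^sup>j\<close>.  The scales with \<open>|\<lambda>| 2\<^sup>j\<^sup>c < 1\<close> add up to a
  truncated Hilbert transform plus a multiple of the Hardy-Littlewood maximal function \<open>M f\<close>.
  The remaining scales are grouped by \<open>|\<lambda>| 2\<^sup>j\<^sup>c ~ 2\<^sup>k\<close>.  Without the integer part, the supremum over all \<open>j\<close>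
  and all such \<open>\<lambda>\<close> has norm \<open>O(2 powr (-\<delta>k))\<close>: on \<open>\<ell>\<^sup>2\<close> by the \<open>TT\<^sup>*\<close> argument of Stein and Wainger, where the kernel of
  the linearised operator is bounded by van der Corput's second derivative test (here \<open>c < 2\<close> enters)
  and the resulting quadratic form by \<open>M\<close>; on \<open>\<ell>\<^sup>p\<close> by interpolation with the trivial bound by \<open>M f\<close>.
  For \<open>|\<lambda>| \<le> 2 powr (-\<epsilon>j)\<close> the integer part costs \<open>O(|\<lambda>|) M f\<close>.  For larger \<open>\<lambda>\<close> write
  \<open>e(\<lambda>\<lfloor>n\<^sup>c\<rfloor>) = e(\<lambda>n\<^sup>c) e(-\<lambda>{n\<^sup>c})\<close> and expand the second factor into few frequencies by a Fejer mean; as \<open>\<lambda> + m\<close> is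
  never small, each frequency gains a power of \<open>2\<^sup>j\<close>, and so does the error term, which is itself a combination
  of the same operators applied to \<open>|f|\<close>.  The discrete Hilbert transform is bounded on \<open>\<ell>\<^sup>p\<close> by Cotlar's identity for
  \<open>p = 2, 4, 8, ...\<close>, interpolation and duality.
\<close>

section \<open>Interpolation and the maximal function\<close>

text \<open>Suprema are linearised from the start: at each point a radius, a scale or a frequency is
  chosen that attains the supremum up to a factor 2, and every bound is uniform in these choices.
  With finite sets X and finite supports, only finite sums occur until the final passage to the
  norm. Two obstacles shape the argument. The one-sided sums of f(x - n) / n left below the cutoff
  are not bounded uniformly on their own. The cutoff depends only on the modulus of the frequency,
  so it is the same for n > 0 and n < 0, and the two remainders form one truncated Hilbert
  transform. Secondly, the Fejer expansion at scale 2^j loses a factor 2^(6 \<epsilon> j), while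
  decay is known only in the level k. The expansion is used solely where |\<lambda>| 2^(jc) is at
  least 2^j, so that k >= j, and \<epsilon> is small against the decay exponent. Room for the
  additional frequencies comes from an exponent e strictly between c and 2: the oscillatory bound
  holds for phases up to 2^(je), not only up to 2^(jc).\<close>

lemma sum_power_le_geometric:
  fixes q :: real
  assumes "finite B" "0 \<le> q" "q < 1"
  shows "(\<Sum>i\<in>B. q ^ i) \<le> 1 / (1 - q)"
proof -
  have "(\<Sum>i\<in>B. q ^ i) \<le> (\<Sum>i. q ^ i)"
    by (rule sum_le_suminf) (use assms in \<open>auto intro: summable_geometric\<close>)
  also have "\<dots> = 1 / (1 - q)"
    using assms by (intro suminf_geometric) auto
  finally show ?thesis .
qed

lemma sum_dyadic_below:
  fixes A :: "int set" and b s :: real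
  assumes "finite A" "0 < s" "0 < b" and le: "\<And>l. l \<in> A \<Longrightarrow> 2 powr l \<le> b"
  shows "(\<Sum>l\<in>A. 2 powr (l * s)) \<le> b powr s / (1 - 2 powr (- s))"
proof -
  define m where "m = \<lfloor>log 2 b\<rfloor>"
  have lm: "l \<le> m" if "l \<in> A" for l
    using le[OF that] assms(3) by (simp add: m_def le_floor_iff le_log_iff)
  have q: "2 powr (- s) < (1::real)"
    using assms(2) by (simp add: powr_less_one)
  have inj: "inj_on (\<lambda>l. nat (m - l)) A"
    using lm by (auto simp: inj_on_def) (smt (verit) int_nat_eq)
  have "(\<Sum>l\<in>A. 2 powr (l * s)) = (\<Sum>l\<in>A. 2 powr (m * s) * (2 powr (- s)) ^ nat (m - l))"
  proof (rule sum.cong)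
    fix l assume "l \<in> A"
    then have "real (nat (m - l)) = m - l" using lm by simp
    then show "2 powr (l * s) = 2 powr (m * s) * (2 powr (- s)) ^ nat (m - l)"
      by (simp add: powr_realpow[symmetric] powr_powr powr_add[symmetric] algebra_simps)
  qed simp
  also have "\<dots> = 2 powr (m * s) * (\<Sum>i\<in>(\<lambda>l. nat (m - l)) ` A. (2 powr (- s)) ^ i)"
    by (simp add: sum_distrib_left sum.reindex[OF inj])
  also have "\<dots> \<le> b powr s * (1 / (1 - 2 powr (- s)))"
  proof (rule mult_mono)
    have "2 powr (real_of_int m) \<le> b"
      using assms(3) unfolding m_def by (simp add: le_log_iff[symmetric])
    then show "2 powr (m * s) \<le> b powr s"
      using assms(2) by (simp add: powr_powr[symmetric] powr_mono2)
  qed (use q assms in \<open>auto intro!: sum_power_le_geometric sum_nonneg\<close>)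
  finally show ?thesis by simp
qed

lemma sum_dyadic_above:
  fixes A :: "int set" and b s :: real
  assumes "finite A" "0 < s" "0 < b" and le: "\<And>l. l \<in> A \<Longrightarrow> b \<le> 2 powr l"
  shows "(\<Sum>l\<in>A. 2 powr (- (l * s))) \<le> b powr (- s) / (1 - 2 powr (- s))"
proof -
  have "(\<Sum>l\<in>uminus ` A. 2 powr (l * s)) \<le> (1 / b) powr s / (1 - 2 powr (- s))"
    using assms by (intro sum_dyadic_below) (auto simp: powr_minus field_simps)
  then show ?thesis
    using assms by (simp add: sum.reindex powr_divide powr_minus_divide)
qed

lemma dyadic_level:
  fixes u :: real
  assumes "0 < u"
  shows "2 powr (\<lceil>log 2 u\<rceil> - 1) < u" "u \<le> 2 powr \<lceil>log 2 u\<rceil>"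
proof -
  show "2 powr (\<lceil>log 2 u\<rceil> - 1) < u"
    using assms by (simp add: less_log_iff[symmetric]) linarith
  show "u \<le> 2 powr \<lceil>log 2 u\<rceil>"
    using assms by (simp add: log_le_iff[symmetric])
qed

text \<open>Layer-cake summation over dyadic heights, then an exchange of sums: for fixed
  \<open>y\<close> the heights below \<open>v y / \<gamma>\<close> and those above it each give a
  geometric sum dominated by the term nearest to \<open>v y / \<gamma>\<close>. The truncation ratio
  \<open>\<gamma>\<close> stays free so that it can be balanced against unequal constants
  \<open>B0\<close> and \<open>B1\<close>; \<open>B1 = 0\<close> encodes an endpoint at infinity,
  where the low part never reaches the threshold.\<close>

lemma marcinkiewicz:
  fixes u :: "'a \<Rightarrow> real" and v :: "'b \<Rightarrow> real"
  assumes fin: "finite X" "finite Y" and u: "\<And>x. 0 \<le> u x" and v: "\<And>y. 0 \<le> v y"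
    and exps: "0 < q0" "q0 < p" "p < q1" and pos: "0 < \<gamma>" "0 \<le> B0" "0 \<le> B1"
    and weak: "\<And>\<alpha>. 0 < \<alpha> \<Longrightarrow> real (card {x\<in>X. \<alpha> < u x})
      \<le> B0 * \<alpha> powr (- q0) * (\<Sum>y\<in>{y\<in>Y. \<gamma> * \<alpha> < v y}. v y powr q0)
        + B1 * \<alpha> powr (- q1) * (\<Sum>y\<in>{y\<in>Y. v y \<le> \<gamma> * \<alpha>}. v y powr q1)"
  shows "(\<Sum>x\<in>X. u x powr p)
    \<le> 2 powr p * (1 / (1 - 2 powr (- (p - q0))) + 1 / (1 - 2 powr (- (q1 - p))))
      * (B0 * \<gamma> powr (q0 - p) + B1 * \<gamma> powr (q1 - p)) * (\<Sum>y\<in>Y. v y powr p)"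
proof -
  define X' where "X' = {x\<in>X. 0 < u x}"
  \<comment> \<open>Subtracting one makes the lower inequality strict, to match the strict level
    sets in \<open>weak\<close>.\<close>
  define lev where "lev x = \<lceil>log 2 (u x)\<rceil> - 1" for x
  have lev: "2 powr (lev x) < u x" "u x \<le> 2 powr (lev x + 1)" if "x \<in> X'" for x
    using dyadic_level[of "u x"] that by (auto simp: X'_def lev_def)
  \<comment> \<open>Only heights that occur are summed over, which keeps the sum finite; each
    \<open>x\<close> needs just its own height, the other terms being nonnegative.\<close>
  define A where "A = lev ` X'"
  have finX': "finite X'" "finite A" using fin by (auto simp: X'_def A_def)
  let ?I = "\<lambda>P. if P then 1 else (0::real)"
  let ?k0 = "1 / (1 - 2 powr (- (p - q0)))" and ?k1 = "1 / (1 - 2 powr (- (q1 - p)))"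
  let ?V = "\<Sum>y\<in>Y. v y powr p"
  have k: "0 \<le> ?k0" "0 \<le> ?k1"
    using exps powr_less_one[of 2 "- (p - q0)"] powr_less_one[of 2 "- (q1 - p)"] by auto
  have low: "(\<Sum>l\<in>A. 2 powr (l * (p - q0)) * (\<Sum>y\<in>{y\<in>Y. \<gamma> * 2 powr l < v y}. v y powr q0))
      \<le> ?k0 * \<gamma> powr (q0 - p) * ?V"
  proof -
    have "(\<Sum>l\<in>A. 2 powr (l * (p - q0)) * (\<Sum>y\<in>{y\<in>Y. \<gamma> * 2 powr l < v y}. v y powr q0))
        = (\<Sum>l\<in>A. \<Sum>y\<in>Y. ?I (\<gamma> * 2 powr l < v y) * (v y powr q0 * 2 powr (l * (p - q0))))"
      using fin by (simp add: sum_distrib_left sum.inter_filter[symmetric] if_distrib if_distribR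
          mult.commute cong: if_cong)
    also have "\<dots> = (\<Sum>y\<in>Y. v y powr q0 * (\<Sum>l\<in>A. ?I (\<gamma> * 2 powr l < v y) * 2 powr (l * (p - q0))))"
      by (subst sum.swap) (simp add: sum_distrib_left mult_ac)
    also have "\<dots> \<le> (\<Sum>y\<in>Y. ?k0 * \<gamma> powr (q0 - p) * v y powr p)"
    proof (rule sum_mono)
      fix y assume "y \<in> Y"
      show "v y powr q0 * (\<Sum>l\<in>A. ?I (\<gamma> * 2 powr l < v y) * 2 powr (l * (p - q0)))
          \<le> ?k0 * \<gamma> powr (q0 - p) * v y powr p"
      proof (cases "v y = 0")
        case False
        then have vy: "0 < v y" using v[of y] by linarith
        have "(\<Sum>l\<in>A. ?I (\<gamma> * 2 powr l < v y) * 2 powr (l * (p - q0)))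
            = (\<Sum>l\<in>{l\<in>A. \<gamma> * 2 powr l < v y}. 2 powr (l * (p - q0)))"
          using finX' by (simp add: sum.inter_filter) (auto intro!: sum.cong)
        also have "\<dots> \<le> (v y / \<gamma>) powr (p - q0) / (1 - 2 powr (- (p - q0)))"
          using finX' vy pos exps by (intro sum_dyadic_below) (auto simp: field_simps)
        finally have "v y powr q0 * (\<Sum>l\<in>A. ?I (\<gamma> * 2 powr l < v y) * 2 powr (l * (p - q0)))
            \<le> v y powr q0 * ((v y / \<gamma>) powr (p - q0) / (1 - 2 powr (- (p - q0))))"
          by (intro mult_left_mono) auto
        also have "\<dots> = ?k0 * \<gamma> powr (q0 - p) * v y powr p"
        proof -
          have "v y powr q0 * (v y / \<gamma>) powr (p - q0) = \<gamma> powr (q0 - p) * v y powr p"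
            using vy pos by (simp add: powr_divide powr_diff)
          then show ?thesis by (simp add: field_simps)
        qed
        finally show ?thesis .
      qed simp
    qed
    finally show ?thesis by (simp add: sum_distrib_left)
  qed
  have high: "(\<Sum>l\<in>A. 2 powr (- (l * (q1 - p))) * (\<Sum>y\<in>{y\<in>Y. v y \<le> \<gamma> * 2 powr l}. v y powr q1))
      \<le> ?k1 * \<gamma> powr (q1 - p) * ?V"
  proof -
    have "(\<Sum>l\<in>A. 2 powr (- (l * (q1 - p))) * (\<Sum>y\<in>{y\<in>Y. v y \<le> \<gamma> * 2 powr l}. v y powr q1))
        = (\<Sum>l\<in>A. \<Sum>y\<in>Y. ?I (v y \<le> \<gamma> * 2 powr l) * (v y powr q1 * 2 powr (- (l * (q1 - p)))))"
      using fin by (simp add: sum_distrib_left sum.inter_filter[symmetric] if_distrib if_distribR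
          mult.commute cong: if_cong)
    also have "\<dots> = (\<Sum>y\<in>Y. v y powr q1 * (\<Sum>l\<in>A. ?I (v y \<le> \<gamma> * 2 powr l) * 2 powr (- (l * (q1 - p)))))"
      by (subst sum.swap) (simp add: sum_distrib_left mult_ac)
    also have "\<dots> \<le> (\<Sum>y\<in>Y. ?k1 * \<gamma> powr (q1 - p) * v y powr p)"
    proof (rule sum_mono)
      fix y assume "y \<in> Y"
      show "v y powr q1 * (\<Sum>l\<in>A. ?I (v y \<le> \<gamma> * 2 powr l) * 2 powr (- (l * (q1 - p))))
          \<le> ?k1 * \<gamma> powr (q1 - p) * v y powr p"
      proof (cases "v y = 0")
        case False
        then have vy: "0 < v y" using v[of y] by linarith
        have "(\<Sum>l\<in>A. ?I (v y \<le> \<gamma> * 2 powr l) * 2 powr (- (l * (q1 - p))))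
            = (\<Sum>l\<in>{l\<in>A. v y \<le> \<gamma> * 2 powr l}. 2 powr (- (l * (q1 - p))))"
          using finX' by (simp add: sum.inter_filter) (auto intro!: sum.cong)
        also have "\<dots> \<le> (v y / \<gamma>) powr (- (q1 - p)) / (1 - 2 powr (- (q1 - p)))"
          using finX' vy pos exps by (intro sum_dyadic_above) (auto simp: field_simps)
        finally have "v y powr q1 * (\<Sum>l\<in>A. ?I (v y \<le> \<gamma> * 2 powr l) * 2 powr (- (l * (q1 - p))))
            \<le> v y powr q1 * ((v y / \<gamma>) powr (- (q1 - p)) / (1 - 2 powr (- (q1 - p))))"
          by (intro mult_left_mono) auto
        also have "\<dots> = ?k1 * \<gamma> powr (q1 - p) * v y powr p"
        proof -
          have "v y powr q1 * (v y / \<gamma>) powr (- (q1 - p)) = \<gamma> powr (q1 - p) * v y powr p"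
            using vy pos by (simp add: powr_divide powr_diff powr_minus field_simps)
          then show ?thesis by (simp add: field_simps)
        qed
        finally show ?thesis .
      qed (use exps in simp)
    qed
    finally show ?thesis by (simp add: sum_distrib_left)
  qed
  have "(\<Sum>x\<in>X. u x powr p) = (\<Sum>x\<in>X'. u x powr p)"
    using fin u by (intro sum.mono_neutral_right) (auto simp: X'_def order_less_le)
  also have "\<dots> \<le> (\<Sum>x\<in>X'. \<Sum>l\<in>A. 2 powr p * (2 powr (l * p) * ?I (2 powr l < u x)))"
  proof (rule sum_mono)
    fix x assume x: "x \<in> X'"
    have "u x powr p \<le> (2 powr (real_of_int (lev x) + 1)) powr p"
      using lev(2)[OF x] u exps by (intro powr_mono2) auto
    also have "\<dots> = 2 powr p * (2 powr (lev x * p) * ?I (2 powr real_of_int (lev x) < u x))"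
      using lev(1)[OF x] by (simp add: powr_powr powr_add[symmetric] algebra_simps)
    also have "\<dots> \<le> (\<Sum>l\<in>A. 2 powr p * (2 powr (l * p) * ?I (2 powr real_of_int l < u x)))"
      using finX' x by (intro member_le_sum) (auto simp: A_def)
    finally show "u x powr p \<le> (\<Sum>l\<in>A. 2 powr p * (2 powr (l * p) * ?I (2 powr l < u x)))" .
  qed
  also have "\<dots> = 2 powr p * (\<Sum>l\<in>A. 2 powr (l * p) * (\<Sum>x\<in>X'. ?I (2 powr l < u x)))"
    by (subst sum.swap) (simp add: sum_distrib_left)
  also have "\<dots> = 2 powr p * (\<Sum>l\<in>A. 2 powr (l * p) * card {x\<in>X. 2 powr l < u x})"
  proof -
    have "(\<Sum>x\<in>X'. ?I (2 powr real_of_int l < u x)) = card {x\<in>X. 2 powr real_of_int l < u x}" for l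
    proof -
      have "{x\<in>X. 2 powr real_of_int l < u x} = {x\<in>X'. 2 powr real_of_int l < u x}"
        unfolding X'_def using less_trans[of 0 "2 powr real_of_int l"] by auto
      then show ?thesis using finX' by (simp add: sum.inter_filter[symmetric])
    qed
    then show ?thesis by simp
  qed
  also have "\<dots> \<le> 2 powr p * (\<Sum>l\<in>A.
      B0 * (2 powr (l * (p - q0)) * (\<Sum>y\<in>{y\<in>Y. \<gamma> * 2 powr l < v y}. v y powr q0))
    + B1 * (2 powr (- (l * (q1 - p))) * (\<Sum>y\<in>{y\<in>Y. v y \<le> \<gamma> * 2 powr l}. v y powr q1)))"
  proof (intro mult_left_mono sum_mono)
    fix l assume "l \<in> A"
    have "2 powr (l * p) * card {x\<in>X. 2 powr real_of_int l < u x} \<le> 2 powr (l * p) *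
       (B0 * (2 powr l) powr (- q0) * (\<Sum>y\<in>{y\<in>Y. \<gamma> * 2 powr l < v y}. v y powr q0)
        + B1 * (2 powr l) powr (- q1) * (\<Sum>y\<in>{y\<in>Y. v y \<le> \<gamma> * 2 powr l}. v y powr q1))"
      by (intro mult_left_mono weak) auto
    moreover have "2 powr (l * p) * (B0 * (2 powr l) powr (- q0) * s) = B0 * (2 powr (l * (p - q0)) * s)"
        "2 powr (l * p) * (B1 * (2 powr l) powr (- q1) * s) = B1 * (2 powr (- (l * (q1 - p))) * s)" for s
    proof -
      have "2 powr (l * p) * (2 powr l) powr (- q0) = 2 powr (l * (p - q0))"
        "2 powr (l * p) * (2 powr l) powr (- q1) = 2 powr (- (l * (q1 - p)))"
        by (simp_all add: powr_powr powr_add[symmetric] algebra_simps)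
      then show "2 powr (l * p) * (B0 * (2 powr l) powr (- q0) * s) = B0 * (2 powr (l * (p - q0)) * s)"
        "2 powr (l * p) * (B1 * (2 powr l) powr (- q1) * s) = B1 * (2 powr (- (l * (q1 - p))) * s)"
        by (metis mult.assoc mult.left_commute)+
    qed
    ultimately show "2 powr (l * p) * card {x\<in>X. 2 powr real_of_int l < u x} \<le>
       B0 * (2 powr (l * (p - q0)) * (\<Sum>y\<in>{y\<in>Y. \<gamma> * 2 powr l < v y}. v y powr q0))
    + B1 * (2 powr (- (l * (q1 - p))) * (\<Sum>y\<in>{y\<in>Y. v y \<le> \<gamma> * 2 powr l}. v y powr q1))"
      by (simp only: distrib_left)
  qed auto
  also have "\<dots> \<le> 2 powr p * (B0 * (?k0 * \<gamma> powr (q0 - p) * ?V) + B1 * (?k1 * \<gamma> powr (q1 - p) * ?V))"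
    unfolding sum.distrib sum_distrib_left[symmetric]
    by (intro mult_left_mono add_mono low high) (use pos in auto)
  also have "\<dots> \<le> 2 powr p * ((?k0 + ?k1) * (B0 * \<gamma> powr (q0 - p) + B1 * \<gamma> powr (q1 - p)) * ?V)"
  proof (intro mult_left_mono)
    let ?a = "B0 * \<gamma> powr (q0 - p) * ?V" and ?b = "B1 * \<gamma> powr (q1 - p) * ?V"
    have "0 \<le> ?V" by (simp add: sum_nonneg)
    then have "0 \<le> ?k1 * ?a" "0 \<le> ?k0 * ?b" using pos k by (auto intro!: mult_nonneg_nonneg)
    then show "B0 * (?k0 * \<gamma> powr (q0 - p) * ?V) + B1 * (?k1 * \<gamma> powr (q1 - p) * ?V)
        \<le> (?k0 + ?k1) * (B0 * \<gamma> powr (q0 - p) + B1 * \<gamma> powr (q1 - p)) * ?V"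
      by (simp add: algebra_simps)
  qed auto
  finally show ?thesis by (simp add: mult_ac)
qed


section \<open>The Hardy-Littlewood maximal function, linearised\<close>

definition avg :: "nat \<Rightarrow> (int \<Rightarrow> 'a::real_normed_vector) \<Rightarrow> int \<Rightarrow> real" where
  "avg N g x = (\<Sum>y\<in>{x - int N..x + int N}. norm (g y)) / N"

lemma avg_nonneg: "0 \<le> avg N g x"
  by (simp add: avg_def sum_nonneg)

text \<open>Vitali's covering argument: the largest interval absorbs, up to a factor 5, all those meeting it.\<close>
lemma vitali_intervals:
  fixes g :: "int \<Rightarrow> real" and N :: "int \<Rightarrow> nat" and \<alpha> :: real
  assumes "finite X" "\<And>y. 0 \<le> g y" "0 \<le> \<alpha>"
    and "\<And>x. x \<in> X \<Longrightarrow> 1 \<le> N x \<and> \<alpha> * N x \<le> (\<Sum>y\<in>{x - int (N x)..x + int (N x)}. g y)"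
  shows "\<alpha> * card X \<le> 5 * (\<Sum>y\<in>(\<Union>x\<in>X. {x - int (N x)..x + int (N x)}). g y)"
  using assms(1,4)
proof (induction "card X" arbitrary: X rule: less_induct)
  case less
  let ?I = "\<lambda>x. {x - int (N x)..x + int (N x)}"
  show ?case
  proof (cases "X = {}")
    case False
    obtain x0 where x0: "x0 \<in> X" "\<And>x. x \<in> X \<Longrightarrow> N x \<le> N x0"
    proof -
      have "Max (N ` X) \<in> N ` X" using False less.prems(1) by simp
      then obtain x0 where "x0 \<in> X" "N x0 = Max (N ` X)" by auto
      then show ?thesis using that[of x0] less.prems(1) by simp
    qed
    define X' where "X' = {x\<in>X. ?I x \<inter> ?I x0 = {}}"
    have "x0 \<in> ?I x0" by simp
    then have "x0 \<notin> X'" unfolding X'_def by blast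
    then have "X' \<subset> X" using x0(1) unfolding X'_def by blast
    then have fin': "finite X'" "card X' < card X"
      using less.prems(1) by (auto intro: psubset_card_mono finite_subset)
    have IH: "\<alpha> * card X' \<le> 5 * (\<Sum>y\<in>(\<Union>x\<in>X'. ?I x). g y)"
      using less.hyps[OF fin'(2) fin'(1)] less.prems(2) by (auto simp: X'_def)
    \<comment> \<open>An interval meeting the largest one is no longer than it, so its centre lies
      within \<open>2 * N x0\<close>; this leaves \<open>4 * N x0 + 1\<close>, hence at most
      \<open>5 * N x0\<close>, centres.\<close>
    have sub: "X - X' \<subseteq> {x0 - 2 * int (N x0)..x0 + 2 * int (N x0)}"
    proof
      fix x assume x: "x \<in> X - X'"
      then have "?I x \<inter> ?I x0 \<noteq> {}" by (auto simp: X'_def)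
      then obtain y where "y \<in> ?I x" "y \<in> ?I x0" by blast
      then show "x \<in> {x0 - 2 * int (N x0)..x0 + 2 * int (N x0)}"
        using x0(2)[of x] x by auto
    qed
    have "card (X - X') \<le> card {x0 - 2 * int (N x0)..x0 + 2 * int (N x0)}"
      by (rule card_mono[OF _ sub]) simp
    also have "\<dots> \<le> 5 * N x0"
      using less.prems(2)[OF x0(1)] by (simp add: nat_le_iff)
    finally have "real (card (X - X')) \<le> 5 * N x0"
      by (metis of_nat_le_iff of_nat_mult of_nat_numeral)
    then have "\<alpha> * card (X - X') \<le> 5 * (\<alpha> * N x0)"
      using mult_left_mono[of "real (card (X - X'))" "5 * N x0" \<alpha>] assms(3) by (simp add: mult_ac)
    also have "\<dots> \<le> 5 * (\<Sum>y\<in>?I x0. g y)"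
      using less.prems(2)[OF x0(1)] by simp
    finally have rem: "\<alpha> * card (X - X') \<le> 5 * (\<Sum>y\<in>?I x0. g y)" .
    have "real (card X) = card X' + card (X - X')"
      using less.prems(1) \<open>X' \<subset> X\<close> fin'
      by (metis card_Diff_subset le_add_diff_inverse of_nat_add order_less_imp_le psubset_imp_subset)
    then have "\<alpha> * card X \<le> 5 * ((\<Sum>y\<in>(\<Union>x\<in>X'. ?I x). g y) + (\<Sum>y\<in>?I x0. g y))"
      using IH rem by (simp add: distrib_left)
    also have "(\<Sum>y\<in>(\<Union>x\<in>X'. ?I x). g y) + (\<Sum>y\<in>?I x0. g y) = (\<Sum>y\<in>(\<Union>x\<in>X'. ?I x) \<union> ?I x0. g y)"
      using fin' by (intro sum.union_disjoint[symmetric]) (auto simp: X'_def)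
    also have "\<dots> \<le> (\<Sum>y\<in>(\<Union>x\<in>X. ?I x). g y)"
      using less.prems(1) x0 assms(2) by (intro sum_mono2) (auto simp: X'_def)
    finally show ?thesis by simp
  qed simp
qed

text \<open>The radius is an arbitrary function of the point, so this is the weak (1,1) bound for
  the maximal function with the supremum already resolved.\<close>

lemma avg_weak_type:
  fixes g :: "int \<Rightarrow> 'a::real_normed_vector" and N :: "int \<Rightarrow> nat"
  assumes "finite X" "finite Y" "0 < \<alpha>" "\<And>x. x \<in> X \<Longrightarrow> 1 \<le> N x \<and> \<alpha> < avg (N x) g x"
    and supp: "\<And>y. y \<notin> Y \<Longrightarrow> g y = 0"
  shows "card X \<le> 5 / \<alpha> * (\<Sum>y\<in>Y. norm (g y))"
proof -
  have "\<alpha> * card X \<le> 5 * (\<Sum>y\<in>(\<Union>x\<in>X. {x - int (N x)..x + int (N x)}). norm (g y))"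
  proof (rule vitali_intervals)
    fix x assume "x \<in> X"
    from assms(4)[OF this]
    show "1 \<le> N x \<and> \<alpha> * N x \<le> (\<Sum>y\<in>{x - int (N x)..x + int (N x)}. norm (g y))"
      by (auto simp: avg_def field_simps)
  qed (use assms in auto)
  also have "(\<Sum>y\<in>(\<Union>x\<in>X. {x - int (N x)..x + int (N x)}). norm (g y))
      = (\<Sum>y\<in>(\<Union>x\<in>X. {x - int (N x)..x + int (N x)}) \<inter> Y. norm (g y))"
    using assms(1) supp by (intro sum.mono_neutral_right) auto
  also have "\<dots> \<le> (\<Sum>y\<in>Y. norm (g y))"
    using assms(2) by (intro sum_mono2) auto
  finally show ?thesis using assms(3) by (simp add: field_simps)
qed

text \<open>\<open>Y\<close> must contain the intervals but need not support \<open>g\<close>: the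
  bound is later applied to a Hilbert transform, whose support is not finite. The endpoint at
  infinity enters as \<open>B1 = 0\<close> with the dummy exponent \<open>p + 1\<close>.\<close>

lemma avg_strong_type:
  fixes p :: real
  assumes "1 < p"
  shows "\<exists>C>0. \<forall>X Y N (g :: int \<Rightarrow> 'a::real_normed_vector). finite X \<longrightarrow> finite Y \<longrightarrow>
      (\<forall>x\<in>X. 1 \<le> N x \<and> {x - int (N x)..x + int (N x)} \<subseteq> Y) \<longrightarrow>
      (\<Sum>x\<in>X. avg (N x) g x powr p) \<le> C * (\<Sum>y\<in>Y. norm (g y) powr p)"
proof (intro exI conjI allI impI)
  let ?C = "2 powr p * (1 / (1 - 2 powr (- (p - 1))) + 1 / (1 - 2 powr (- (p + 1 - p))))
      * (10 * (1/6) powr (1 - p) + 0 * (1/6) powr (p + 1 - p))"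
  show "0 < ?C"
    using assms powr_less_one[of 2 "- (p - 1)"] by (auto intro!: mult_pos_pos add_pos_pos)
  fix X Y :: "int set" and N :: "int \<Rightarrow> nat" and g :: "int \<Rightarrow> 'a"
  assume X: "finite X" "finite Y" and NY: "\<forall>x\<in>X. 1 \<le> N x \<and> {x - int (N x)..x + int (N x)} \<subseteq> Y"
  then have N: "1 \<le> N x" and Y: "{x - int (N x)..x + int (N x)} \<subseteq> Y" if "x \<in> X" for x
    using that by auto
  show "(\<Sum>x\<in>X. avg (N x) g x powr p) \<le> ?C * (\<Sum>y\<in>Y. norm (g y) powr p)"
  proof (rule marcinkiewicz)
    fix \<alpha> :: real assume \<alpha>: "0 < \<alpha>"
    \<comment> \<open>Values up to \<open>\<alpha> / 6\<close> may be dropped: an interval has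
      \<open>2 * N + 1 \<le> 3 * N\<close> points while \<open>avg\<close> divides by
      \<open>N\<close>, so they contribute at most \<open>\<alpha> / 2\<close>.\<close>
    define h where "h y = (if y \<in> Y \<and> 1/6 * \<alpha> < norm (g y) then g y else 0)" for y
    have big: "\<alpha> / 2 < avg (N x) h x" if x: "x \<in> X" and xa: "\<alpha> < avg (N x) g x" for x
    proof -
      let ?I = "{x - int (N x)..x + int (N x)}"
      have "(\<Sum>y\<in>?I. norm (g y)) \<le> (\<Sum>y\<in>?I. norm (h y) + \<alpha> / 6)"
        using Y[OF x] \<alpha> by (intro sum_mono) (auto simp: h_def)
      also have "\<dots> = (\<Sum>y\<in>?I. norm (h y)) + (2 * real (N x) + 1) * (\<alpha> / 6)"
        by (simp add: sum.distrib)
      also have "\<dots> \<le> (\<Sum>y\<in>?I. norm (h y)) + (3 * real (N x)) * (\<alpha> / 6)"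
        using N[OF x] \<alpha> by (intro add_left_mono mult_right_mono) auto
      finally have "avg (N x) g x \<le> avg (N x) h x + \<alpha> / 2"
        using N[OF x] by (simp add: avg_def field_simps)
      then show ?thesis using xa by simp
    qed
    have "real (card {x\<in>X. \<alpha> < avg (N x) g x}) \<le> 5 / (\<alpha> / 2) * (\<Sum>y\<in>Y. norm (h y))"
    proof (rule avg_weak_type[where N = N])
      show "h y = 0" if "y \<notin> Y" for y using that by (simp add: h_def)
    qed (use X \<alpha> N big in auto)
    also have "(\<Sum>y\<in>Y. norm (h y)) = (\<Sum>y\<in>{y\<in>Y. 1/6 * \<alpha> < norm (g y)}. norm (g y) powr 1)"
      using X by (simp add: h_def sum.inter_filter if_distrib cong: if_cong)
    finally show "real (card {x\<in>X. \<alpha> < avg (N x) g x})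
      \<le> 10 * \<alpha> powr (- 1) * (\<Sum>y\<in>{y\<in>Y. 1/6 * \<alpha> < norm (g y)}. norm (g y) powr 1)
        + 0 * \<alpha> powr (- (p + 1)) * (\<Sum>y\<in>{y\<in>Y. norm (g y) \<le> 1/6 * \<alpha>}. norm (g y) powr (p + 1))"
      using \<alpha> by (simp add: powr_minus divide_simps)
  qed (use X assms in \<open>auto intro: avg_nonneg\<close>)
qed

section \<open>Van der Corput estimates\<close>

definition ee :: "real \<Rightarrow> complex" where
  "ee x = cis (2 * pi * x)"

lemma norm_ee [simp]: "norm (ee x) = 1"
  by (simp add: ee_def)

lemma ee_add: "ee (x + y) = ee x * ee y"
  by (simp add: ee_def cis_mult algebra_simps)

lemma ee_diff: "ee (x - y) = ee x * cnj (ee y)"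
  by (simp add: ee_def cis_cnj cis_mult algebra_simps)

lemma ee_of_int [simp]: "ee (of_int k) = 1"
  by (simp add: ee_def complex_eq_iff cos_int_2pin sin_int_2pin)

lemma ee_0 [simp]: "ee 0 = 1"
  by (simp add: ee_def)

lemma ee_minus: "ee (- x) = cnj (ee x)"
  by (simp add: ee_def cis_cnj)

lemma one_minus_ee: "1 - ee x = - (2 * \<i> * sin (pi * x)) * cis (pi * x)"
proof -
  have "ee x = cis (2 * (pi * x))" by (simp add: ee_def mult_ac)
  then show ?thesis
    by (simp only: complex_eq_iff) (simp add: cos_double_sin sin_double power2_eq_square)
qed

lemma norm_one_minus_ee: "norm (1 - ee x) = 2 * \<bar>sin (pi * x)\<bar>"
  by (simp add: one_minus_ee norm_mult)

lemma norm_ee_diff_le: "norm (ee x - ee y) \<le> 2 * pi * \<bar>x - y\<bar>"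
proof -
  have "ee x - ee y = - (ee y * (1 - ee (x - y)))"
    using ee_add[of y "x - y"] by (simp add: algebra_simps)
  then have "norm (ee x - ee y) = 2 * \<bar>sin (pi * (x - y))\<bar>"
    by (simp add: norm_mult norm_one_minus_ee)
  also have "\<dots> \<le> 2 * \<bar>pi * (x - y)\<bar>"
    using abs_sin_x_le_abs_x by (intro mult_left_mono) auto
  finally show ?thesis by (simp add: abs_mult)
qed

lemma sin_pi_ge_half:
  fixes x :: real
  assumes "0 \<le> x" "x \<le> 1/2"
  shows "2 * x \<le> sin (pi * x)"
proof -
  have "convex_on {0..pi/2} (\<lambda>t. - sin t)"
    by (rule f''_ge0_imp_convex[where f' = "\<lambda>t. - cos t" and f'' = sin])
      (auto intro!: derivative_eq_intros sin_ge_zero)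
  from convex_onD[OF this, of "2 * x" 0 "pi / 2"] assms
  show ?thesis by (simp add: mult_ac)
qed

lemma sin_pi_ge:
  assumes "\<theta> \<le> x" "x \<le> 1 - \<theta>" "0 \<le> \<theta>"
  shows "2 * \<theta> \<le> sin (pi * x)"
proof (cases "x \<le> 1/2")
  case True
  then show ?thesis using sin_pi_ge_half[of x] assms by auto
next
  case False
  have "sin (pi * x) = sin (pi * (1 - x))"
    by (simp add: algebra_simps)
  then show ?thesis using sin_pi_ge_half[of "1 - x"] assms False by auto
qed

text \<open>The real part is constant, so the variation of these numbers along a sequence is that of
  the cotangent, which is monotone on each period. This makes the summation by parts below
  lossless.\<close>

lemma inverse_one_minus_ee:
  assumes "sin (pi * x) \<noteq> 0"
  shows "1 / (1 - ee x) = 1/2 + \<i> / 2 * cot (pi * x)"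
proof -
  have "(1/2 + \<i> / 2 * cot (pi * x)) * - (2 * \<i> * sin (pi * x)) = cis (- (pi * x))"
    using assms by (simp add: cot_def complex_eq_iff)
  then have "(1/2 + \<i> / 2 * cot (pi * x)) * (1 - ee x) = cis (- (pi * x)) * cis (pi * x)"
    unfolding one_minus_ee by (simp only: mult.assoc[symmetric])
  then have "(1/2 + \<i> / 2 * cot (pi * x)) * (1 - ee x) = 1"
    by (simp add: cis_mult)
  moreover from this have "1 - ee x \<noteq> 0" by auto
  ultimately show ?thesis by (simp add: divide_eq_eq)
qed

lemma cot_antimono:
  fixes x y :: real
  assumes "0 < x" "x \<le> y" "y < pi"
  shows "cot y \<le> cot x"
proof -
  have s: "0 < sin x" "0 < sin y" using assms by (auto intro: sin_gt_zero)
  have "0 \<le> sin (y - x)" using assms by (intro sin_ge_zero) auto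
  then have "cos y * sin x \<le> cos x * sin y" by (simp add: sin_diff mult.commute)
  then show ?thesis using s by (simp add: cot_def field_simps)
qed

text \<open>Each term equals the difference of two consecutive terms times
  \<open>r n = 1 / (1 - ee (d n))\<close>. Summation by parts moves the differences onto
  \<open>r\<close>, whose variation telescopes because the cotangent decreases along the increasing
  \<open>d\<close>; the number of terms never enters.\<close>

lemma kusmin_landau:
  fixes \<psi> :: "nat \<Rightarrow> real" and k :: int and \<theta> :: real
  assumes \<theta>: "0 < \<theta>"
    and range: "\<And>n. n < m \<Longrightarrow> k + \<theta> \<le> \<psi> (Suc n) - \<psi> n \<and> \<psi> (Suc n) - \<psi> n \<le> k + 1 - \<theta>"
    and mono: "\<And>n. Suc n < m \<Longrightarrow> \<psi> (Suc n) - \<psi> n \<le> \<psi> (Suc (Suc n)) - \<psi> (Suc n)"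
  shows "norm (\<Sum>n<m. ee (\<psi> n)) \<le> 1 / \<theta>"
proof (cases "m = 0")
  case False
  define d where "d n = \<psi> (Suc n) - \<psi> n - k" for n
  define r where "r n = 1 / (1 - ee (d n))" for n
  define E where "E n = ee (\<psi> n)" for n
  define ct where "ct n = cot (pi * d n)" for n
  have d: "\<theta> \<le> d n" "d n \<le> 1 - \<theta>" if "n < m" for n
    using range[OF that] by (auto simp: d_def)
  have dm: "d n \<le> d (Suc n)" if "Suc n < m" for n
    using mono[OF that] by (simp add: d_def)
  have s: "2 * \<theta> \<le> sin (pi * d n)" if "n < m" for n
    using sin_pi_ge[OF d[OF that]] \<theta> by simp
  have rc: "r n = 1/2 + \<i> / 2 * ct n" if "n < m" for n
    unfolding r_def ct_def using s[OF that] \<theta> by (intro inverse_one_minus_ee) auto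
  have nr: "norm (r n) \<le> 1 / (4 * \<theta>)" if "n < m" for n
  proof -
    have "norm (r n) = 1 / (2 * \<bar>sin (pi * d n)\<bar>)"
      unfolding r_def by (simp add: norm_divide norm_one_minus_ee)
    also have "\<dots> \<le> 1 / (4 * \<theta>)"
      using s[OF that] \<theta> by (intro divide_left_mono) auto
    finally show ?thesis .
  qed
  have nct: "\<bar>ct n\<bar> \<le> 1 / (2 * \<theta>)" if "n < m" for n
  proof -
    have "\<bar>ct n\<bar> \<le> 1 / \<bar>sin (pi * d n)\<bar>"
      unfolding ct_def cot_def abs_divide by (intro divide_right_mono) auto
    also have "\<dots> \<le> 1 / (2 * \<theta>)"
      using s[OF that] \<theta> by (intro divide_left_mono) auto
    finally show ?thesis .
  qed
  have step: "E n = (E n - E (Suc n)) * r n" if "n < m" for n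
  proof -
    have "E (Suc n) = E n * ee (d n)"
    proof -
      have "\<psi> (Suc n) = \<psi> n + d n + k" by (simp add: d_def)
      then show ?thesis by (simp add: E_def ee_add)
    qed
    moreover have "1 - ee (d n) \<noteq> 0"
      using s[OF that] \<theta> norm_one_minus_ee[of "d n"] by auto
    ultimately show ?thesis by (simp add: r_def field_simps)
  qed
  define T where "T j = (\<Sum>n<j. (E n - E (Suc n)) * r n)" for j
  \<comment> \<open>The boundary term is added so that passing from \<open>j\<close> to
    \<open>Suc j\<close> changes the expression only by a multiple of
    \<open>r (Suc j) - r j\<close>.\<close>
  have abel: "norm (T (Suc j) + E (Suc j) * r j) \<le> norm (r 0) + (ct 0 - ct j) / 2" if "j < m" for j
    using that
  proof (induction j)
    case 0
    have "T (Suc 0) + E (Suc 0) * r 0 = E 0 * r 0"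
      by (simp add: T_def algebra_simps)
    then show ?case by (simp add: norm_mult E_def)
  next
    case (Suc j)
    have "T (Suc (Suc j)) + E (Suc (Suc j)) * r (Suc j)
        = (T (Suc j) + E (Suc j) * r j) + E (Suc j) * (r (Suc j) - r j)"
      by (simp add: T_def algebra_simps)
    also have "norm \<dots> \<le> norm (T (Suc j) + E (Suc j) * r j) + norm (E (Suc j) * (r (Suc j) - r j))"
      by (rule norm_triangle_ineq)
    also have "norm (E (Suc j) * (r (Suc j) - r j)) = (ct j - ct (Suc j)) / 2"
    proof -
      have "ct (Suc j) \<le> ct j"
        unfolding ct_def using d[of j] d[of "Suc j"] dm[of j] Suc.prems \<theta> by (intro cot_antimono) auto
      moreover have "r (Suc j) - r j = \<i> / 2 * complex_of_real (ct (Suc j) - ct j)"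
        using Suc.prems by (simp add: rc right_diff_distrib)
      then have "norm (r (Suc j) - r j) = \<bar>ct (Suc j) - ct j\<bar> / 2"
        by (simp only: norm_mult norm_divide norm_of_real) simp
      ultimately show ?thesis
        by (simp add: norm_mult E_def)
    qed
    finally show ?case using Suc by (simp add: diff_divide_distrib)
  qed
  have "(\<Sum>n<m. ee (\<psi> n)) = T m"
    unfolding T_def using step by (intro sum.cong) (auto simp: E_def)
  also have "T m = (T m + E m * r (m - 1)) - E m * r (m - 1)" by simp
  also have "norm \<dots> \<le> norm (T m + E m * r (m - 1)) + norm (E m * r (m - 1))"
    by (rule norm_triangle_ineq4)
  also have "\<dots> \<le> (norm (r 0) + (ct 0 - ct (m - 1)) / 2) + norm (r (m - 1))"
    using abel[of "m - 1"] False by (simp add: norm_mult E_def)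
  \<comment> \<open>The two boundary terms cost \<open>1 / (4 * \<theta>)\<close> each, the total
    variation of \<open>r\<close> costs \<open>1 / (2 * \<theta>)\<close>.\<close>
  also have "\<dots> \<le> (1 / (4 * \<theta>) + (1 / (2 * \<theta>) + 1 / (2 * \<theta>)) / 2) + 1 / (4 * \<theta>)"
    using nr[of 0] nr[of "m - 1"] nct[of 0] nct[of "m - 1"] False by (intro add_mono) auto
  also have "\<dots> = 1 / \<theta>" using \<theta> by (simp add: field_simps)
  finally show ?thesis .
qed (use \<theta> in simp)

lemma card_separated:
  fixes d :: "nat \<Rightarrow> real"
  assumes "0 < \<kappa>" "0 \<le> w" and sep: "\<And>i j. \<lbrakk>i < j; j < m\<rbrakk> \<Longrightarrow> d i + (real j - real i) * \<kappa> \<le> d j"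
    and S: "S \<subseteq> {..<m}" and width: "\<And>i. i \<in> S \<Longrightarrow> a \<le> d i \<and> d i \<le> a + w"
  shows "card S \<le> w / \<kappa> + 1"
proof (cases "S = {}")
  case False
  have fin: "finite S" using S finite_subset by blast
  let ?i = "Min S" and ?j = "Max S"
  have ij: "?i \<in> S" "?j \<in> S" "?i \<le> ?j" using fin False by auto
  have "(real ?j - real ?i) * \<kappa> \<le> w"
    using width[OF ij(1)] width[OF ij(2)] sep[of ?i ?j] ij S assms(2) by (cases "?i = ?j") auto
  then have "real ?j - real ?i \<le> w / \<kappa>" using assms(1) by (simp add: field_simps)
  moreover have "card S \<le> card {?i..?j}"
    using fin by (intro card_mono) auto
  ultimately show ?thesis using ij by (simp add: of_nat_diff)
qed (use assms in simp)

text \<open>The indices are sorted by the integer part of the difference, which takes at most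
  \<open>V + 2\<close> values. Within a class, differences closer than \<open>\<theta>\<close> to an
  integer are few, since consecutive differences are \<open>\<kappa>\<close>-separated; the
  remaining indices are consecutive by monotonicity and fall under the Kusmin-Landau bound.\<close>

lemma van_der_corput_discrete:
  fixes \<psi> :: "nat \<Rightarrow> real"
  assumes \<theta>: "0 < \<theta>" and \<kappa>: "0 < \<kappa>"
    and incr: "\<And>n. Suc n < m \<Longrightarrow> \<psi> (Suc n) - \<psi> n + \<kappa> \<le> \<psi> (Suc (Suc n)) - \<psi> (Suc n)"
    and var: "0 < m \<Longrightarrow> \<psi> m - \<psi> (m - 1) - (\<psi> 1 - \<psi> 0) \<le> V" and "0 \<le> V"
  shows "norm (\<Sum>n<m. ee (\<psi> n)) \<le> (V + 2) * (1 / \<theta> + 2 * (\<theta> / \<kappa> + 1))"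
proof (cases "m = 0")
  case m: False
  define d where "d n = \<psi> (Suc n) - \<psi> n" for n
  have sep: "d i + (real j - real i) * \<kappa> \<le> d j" if "i < j" "j < m" for i j
    using that
  proof (induction j)
    case (Suc j)
    have "d j + \<kappa> \<le> d (Suc j)" using incr[of j] Suc.prems by (simp add: d_def)
    then show ?case
      using Suc by (cases "i = j") (auto simp: algebra_simps less_Suc_eq)
  qed simp
  have mono: "d i \<le> d j" if "i \<le> j" "j < m" for i j
  proof (cases "i = j")
    case False
    then have "0 \<le> (real j - real i) * \<kappa>" using that \<kappa> by simp
    then show ?thesis using sep[of i j] that False by linarith
  qed simp
  define K where "K = (\<lambda>n. \<lfloor>d n\<rfloor>) ` {..<m}"
  have "K \<subseteq> {\<lfloor>d 0\<rfloor>..\<lfloor>d (m - 1)\<rfloor>}"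
    using mono m by (auto simp: K_def intro!: floor_mono)
  then have "card K \<le> card {\<lfloor>d 0\<rfloor>..\<lfloor>d (m - 1)\<rfloor>}" by (intro card_mono) auto
  moreover have "d (m - 1) - d 0 \<le> V" using var m by (simp add: d_def)
  then have "real (card {\<lfloor>d 0\<rfloor>..\<lfloor>d (m - 1)\<rfloor>}) \<le> V + 2"
    using \<open>0 \<le> V\<close> by simp linarith
  ultimately have cardK: "real (card K) \<le> V + 2" by linarith
  have cls: "norm (\<Sum>n\<in>{n\<in>{..<m}. \<lfloor>d n\<rfloor> = k}. ee (\<psi> n)) \<le> 1 / \<theta> + 2 * (\<theta> / \<kappa> + 1)" for k
  proof -
    define L where "L = {n\<in>{..<m}. \<lfloor>d n\<rfloor> = k \<and> d n < k + \<theta>}"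
    define R where "R = {n\<in>{..<m}. \<lfloor>d n\<rfloor> = k \<and> \<not> d n < k + \<theta> \<and> k + 1 - \<theta> < d n}"
    define M where "M = {n\<in>{..<m}. k + \<theta> \<le> d n \<and> d n \<le> k + 1 - \<theta>}"
    have fin: "finite L" "finite R" "finite M" by (auto simp: L_def R_def M_def)
    have eq: "{n\<in>{..<m}. \<lfloor>d n\<rfloor> = k} = (L \<union> R) \<union> M"
      using \<theta> by (auto simp: L_def R_def M_def floor_eq_iff)
    have disj: "L \<inter> R = {}" "(L \<union> R) \<inter> M = {}" by (auto simp: L_def R_def M_def)
    have cL: "card L \<le> \<theta> / \<kappa> + 1"
      by (rule card_separated[where d = d and a = k and m = m])
        (use \<kappa> \<theta> sep in \<open>auto simp: L_def floor_eq_iff\<close>)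
    have cR: "card R \<le> \<theta> / \<kappa> + 1"
      by (rule card_separated[where d = d and a = "k + 1 - \<theta>" and m = m])
        (use \<kappa> \<theta> sep in \<open>auto simp: R_def floor_eq_iff\<close>)
    have cM: "norm (\<Sum>n\<in>M. ee (\<psi> n)) \<le> 1 / \<theta>"
    proof (cases "M = {}")
      case False
      let ?i = "Min M" and ?j = "Max M"
      have ij: "?i \<in> M" "?j \<in> M" "?i \<le> ?j" using fin False by auto
      have "M = {?i..?j}"
      proof
        show "{?i..?j} \<subseteq> M"
        proof
          fix n assume n: "n \<in> {?i..?j}"
          then show "n \<in> M"
            using ij mono[of ?i n] mono[of n ?j] by (auto simp: M_def)
        qed
      qed (use fin in auto)
      define l where "l = Suc ?j - ?i"
      have "(\<Sum>n\<in>M. ee (\<psi> n)) = (\<Sum>n\<in>{?i..<Suc ?j}. ee (\<psi> n))"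
        using \<open>M = {?i..?j}\<close> by (simp add: atLeastLessThanSuc_atLeastAtMost)
      also have "\<dots> = (\<Sum>n<l. ee (\<psi> (?i + n)))"
        by (rule sum.reindex_bij_witness[where i = "\<lambda>n. ?i + n" and j = "\<lambda>n. n - ?i"])
          (auto simp: l_def)
      finally have eq: "(\<Sum>n\<in>M. ee (\<psi> n)) = (\<Sum>n<l. ee (\<psi> (?i + n)))" .
      have inM: "?i + n \<in> M" if "n < l" for n
      proof -
        have "?i + n \<in> {?i..?j}" using that by (auto simp: l_def)
        then show ?thesis using \<open>M = {?i..?j}\<close> by simp
      qed
      show ?thesis unfolding eq
      proof (rule kusmin_landau[OF \<theta>])
        fix n assume "n < l"
        then show "k + \<theta> \<le> \<psi> (?i + Suc n) - \<psi> (?i + n) \<and> \<psi> (?i + Suc n) - \<psi> (?i + n) \<le> k + 1 - \<theta>"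
          using inM[of n] by (simp add: M_def d_def)
      next
        fix n assume "Suc n < l"
        then show "\<psi> (?i + Suc n) - \<psi> (?i + n) \<le> \<psi> (?i + Suc (Suc n)) - \<psi> (?i + Suc n)"
          using mono[of "?i + n" "?i + Suc n"] inM[of "Suc n"] by (simp add: M_def d_def)
      qed
    qed (use \<theta> in simp)
    have "(\<Sum>n\<in>{n\<in>{..<m}. \<lfloor>d n\<rfloor> = k}. ee (\<psi> n))
        = ((\<Sum>n\<in>L. ee (\<psi> n)) + (\<Sum>n\<in>R. ee (\<psi> n))) + (\<Sum>n\<in>M. ee (\<psi> n))"
      unfolding eq using fin disj by (simp add: sum.union_disjoint)
    also have "norm \<dots> \<le> (norm (\<Sum>n\<in>L. ee (\<psi> n)) + norm (\<Sum>n\<in>R. ee (\<psi> n))) + norm (\<Sum>n\<in>M. ee (\<psi> n))"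
      by (intro order_trans[OF norm_triangle_ineq] add_right_mono norm_triangle_ineq)
    also have "\<dots> \<le> (real (card L) + real (card R)) + 1 / \<theta>"
      by (intro add_mono cM order_trans[OF norm_sum]) auto
    also have "\<dots> \<le> ((\<theta> / \<kappa> + 1) + (\<theta> / \<kappa> + 1)) + 1 / \<theta>"
      by (intro add_mono cL cR order_refl)
    finally show ?thesis by (simp add: algebra_simps)
  qed
  have "(\<Sum>n<m. ee (\<psi> n)) = (\<Sum>k\<in>K. \<Sum>n\<in>{n\<in>{..<m}. \<lfloor>d n\<rfloor> = k}. ee (\<psi> n))"
    unfolding K_def by (rule sum.image_gen) simp
  also have "norm \<dots> \<le> card K * (1 / \<theta> + 2 * (\<theta> / \<kappa> + 1))"
    by (intro order_trans[OF norm_sum] sum_bounded_above cls)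
  also have "\<dots> \<le> (V + 2) * (1 / \<theta> + 2 * (\<theta> / \<kappa> + 1))"
    using cardK \<theta> \<kappa> by (intro mult_right_mono) auto
  finally show ?thesis .
qed (use assms in simp)

text \<open>The choice \<open>\<theta> = sqrt \<kappa>\<close> balances the losses
  \<open>1 / \<theta>\<close> and \<open>\<theta> / \<kappa>\<close>. Since differences may only use
  points of \<open>[a, b]\<close>, the discrete bound covers \<open>b - a\<close> terms, and the
  term at \<open>b\<close> is the final \<open>+ 1\<close>.\<close>

lemma van_der_corput_second:
  fixes \<psi> \<psi>' \<psi>'' :: "real \<Rightarrow> real" and a b :: int and \<kappa> \<Lambda> :: real
  assumes "a \<le> b" and \<kappa>: "0 < \<kappa>"
    and d1: "\<And>t :: real. \<lbrakk>a \<le> t; t \<le> b\<rbrakk> \<Longrightarrow> (\<psi> has_real_derivative \<psi>' t) (at t)"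
    and d2: "\<And>t :: real. \<lbrakk>a \<le> t; t \<le> b\<rbrakk> \<Longrightarrow> (\<psi>' has_real_derivative \<psi>'' t) (at t)"
    and bounds: "\<And>t :: real. \<lbrakk>a \<le> t; t \<le> b\<rbrakk> \<Longrightarrow> \<kappa> \<le> \<psi>'' t \<and> \<psi>'' t \<le> \<Lambda>"
  shows "norm (\<Sum>n\<in>{a..b}. ee (\<psi> n)) \<le> (\<Lambda> * (b - a) + 2) * (3 / sqrt \<kappa> + 2) + 1"
proof -
  define m where "m = nat (b - a)"
  define \<phi> where "\<phi> n = \<psi> (a + real n)" for n :: nat
  have m: "real m = b - a" using assms(1) by (simp add: m_def)
  have \<Lambda>: "0 \<le> \<Lambda>" using bounds[of a] \<kappa> assms(1) by auto
  have first: "\<exists>\<xi>. a + real n \<le> \<xi> \<and> \<xi> \<le> a + real n + 1 \<and> \<phi> (Suc n) - \<phi> n = \<psi>' \<xi>" if "n < m" for n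
  proof -
    have "\<exists>z. a + real n < z \<and> z < a + real n + 1 \<and>
        \<psi> (a + real n + 1) - \<psi> (a + real n) = (a + real n + 1 - (a + real n)) * \<psi>' z"
      using that m by (intro MVT2 d1) (auto simp: less_imp_le)
    then show ?thesis by (auto simp: \<phi>_def add_ac intro: order_less_imp_le)
  qed
  \<comment> \<open>The mean value theorem is applied first to the unit difference of
    \<open>\<psi>\<close>, then to \<open>\<psi>'\<close>, so a second difference is a value of
    \<open>\<psi>''\<close>.\<close>
  have second: "\<phi> (Suc n) - \<phi> n + \<kappa> \<le> \<phi> (Suc (Suc n)) - \<phi> (Suc n)" if n: "Suc n < m" for n
  proof -
    let ?g = "\<lambda>t. \<psi> (t + 1) - \<psi> t"
    have "\<exists>z. a + real n < z \<and> z < a + real n + 1 \<and>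
        ?g (a + real n + 1) - ?g (a + real n) = (a + real n + 1 - (a + real n)) * (\<psi>' (z + 1) - \<psi>' z)"
    proof (intro MVT2)
      fix t :: real assume t: "a + real n \<le> t" "t \<le> a + real n + 1"
      have "((\<lambda>t. \<psi> (t + 1)) has_real_derivative \<psi>' (t + 1)) (at t)"
        using d1[of "t + 1"] t n m DERIV_shift[of \<psi> "\<psi>' (t + 1)" t 1] by auto
      then show "(?g has_real_derivative \<psi>' (t + 1) - \<psi>' t) (at t)"
        using d1[of t] t n m by (intro derivative_eq_intros) auto
    qed simp
    then obtain z where z: "a + real n < z" "z < a + real n + 1"
      "?g (a + real n + 1) - ?g (a + real n) = \<psi>' (z + 1) - \<psi>' z" by auto
    have "\<exists>w. z < w \<and> w < z + 1 \<and> \<psi>' (z + 1) - \<psi>' z = (z + 1 - z) * \<psi>'' w"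
      using z n m by (intro MVT2 d2) auto
    then obtain w where w: "z < w" "w < z + 1" "\<psi>' (z + 1) - \<psi>' z = \<psi>'' w" by auto
    have "\<kappa> \<le> \<psi>'' w" using bounds[of w] w z n m by auto
    then show ?thesis using z(3) w(3) by (simp add: \<phi>_def add_ac)
  qed
  have var: "\<phi> m - \<phi> (m - 1) - (\<phi> 1 - \<phi> 0) \<le> \<Lambda> * m" if "0 < m"
  proof (cases "m \<le> 1")
    case True
    then have "m = 1" using that by simp
    then show ?thesis using \<Lambda> by simp
  next
    case False
    obtain x :: real where x: "a \<le> x" "x \<le> a + 1" "\<phi> 1 - \<phi> 0 = \<psi>' x"
      using first[of 0] False by auto
    obtain y :: real where y: "a + real (m - 1) \<le> y" "y \<le> a + real (m - 1) + 1" "\<phi> m - \<phi> (m - 1) = \<psi>' y"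
      using first[of "m - 1"] False by auto
    have rm: "real (m - 1) = real m - 1" using False by simp
    show ?thesis
    proof (cases "x = y")
      case True
      then show ?thesis using x y \<Lambda> by simp
    next
      case False2: False
      have xy: "x < y" using x y rm False False2 by auto
      have "\<exists>w. x < w \<and> w < y \<and> \<psi>' y - \<psi>' x = (y - x) * \<psi>'' w"
        by (intro MVT2 d2) (use x y xy rm m in auto)
      then obtain w where w: "x < w" "w < y" "\<psi>' y - \<psi>' x = (y - x) * \<psi>'' w"
        by blast
      have "\<psi>'' w \<le> \<Lambda>" using bounds[of w] w x y rm m by auto
      then have "(y - x) * \<psi>'' w \<le> m * \<Lambda>"
        using xy x y rm \<Lambda> by (intro order_trans[OF mult_left_mono mult_right_mono]) auto
      then show ?thesis using x y w by (simp add: mult_ac)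
    qed
  qed
  have "norm (\<Sum>n<m. ee (\<phi> n)) \<le> (\<Lambda> * m + 2) * (1 / sqrt \<kappa> + 2 * (sqrt \<kappa> / \<kappa> + 1))"
    using \<kappa> \<Lambda> second var by (intro van_der_corput_discrete) auto
  also have "1 / sqrt \<kappa> + 2 * (sqrt \<kappa> / \<kappa> + 1) = 3 / sqrt \<kappa> + 2"
    using \<kappa> by (simp add: field_simps real_sqrt_mult_self) 
  finally have main: "norm (\<Sum>n<m. ee (\<phi> n)) \<le> (\<Lambda> * (b - a) + 2) * (3 / sqrt \<kappa> + 2)"
    using m by simp
  have "(\<Sum>n\<in>{a..b}. ee (\<psi> n)) = (\<Sum>n\<le>m. ee (\<phi> n))"
    by (rule sum.reindex_bij_witness[where i = "\<lambda>n. a + int n" and j = "\<lambda>z. nat (z - a)"])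
      (use assms(1) in \<open>auto simp: m_def \<phi>_def\<close>)
  also have "\<dots> = (\<Sum>n<m. ee (\<phi> n)) + ee (\<phi> m)"
    by (simp add: lessThan_Suc_atMost[symmetric])
  also have "norm \<dots> \<le> norm (\<Sum>n<m. ee (\<phi> n)) + norm (ee (\<phi> m))"
    by (rule norm_triangle_ineq)
  finally show ?thesis using main by simp
qed

section \<open>Exponential sums with a phase made of two shifted powers\<close>

lemma phase_numerics:
  fixes n K e c1 :: real
  assumes "1 \<le> e" "e < 2" "1 \<le> n" "1 \<le> K" "K \<le> n powr e" "0 < c1"
  defines "\<delta> \<equiv> (1 / e - 1 / 2) / 2"
  shows "(2 * K powr (-\<delta>) * n + 1)
      + 2 * ((8 * K / n\<^sup>2 * n + 2) * (3 / sqrt (c1 * K powr (1 - 2 * \<delta>) / n\<^sup>2) + 2) + 1)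
    \<le> (60 / sqrt c1 + 45) * (K powr (-\<delta>) * n)"
proof -
  define X where "X = K powr (-\<delta>) * n"
  \<comment> \<open>In this form the hypothesis on \<open>K\<close> reads
    \<open>K powr (1/2 + 2 * \<delta>) \<le> n\<close>. Half of the surplus
    \<open>2 * \<delta>\<close> is kept as the gain in \<open>X\<close>; the other half pays for the
    lower bound of the second derivative, which carries only
    \<open>K powr (1 - 2 * \<delta>)\<close> instead of \<open>K\<close>.\<close>
  have \<delta>: "0 < \<delta>" "\<delta> \<le> 1/4" "1 / e = 1/2 + 2 * \<delta>"
    using assms(1,2) by (auto simp: \<delta>_def field_simps)
  have root: "K powr (1/2 + 2 * \<delta>) \<le> n"
  proof -
    have "K powr (1 / e) \<le> (n powr e) powr (1 / e)"
      using assms by (intro powr_mono2) auto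
    also have "\<dots> = n" using assms by (simp add: powr_powr)
    finally show ?thesis unfolding \<delta>(3) .
  qed
  have 1: "K powr (1/2 + \<delta>) \<le> X"
  proof -
    have "K powr (1/2 + \<delta>) = K powr (-\<delta>) * K powr (1/2 + 2 * \<delta>)"
      by (simp add: powr_add[symmetric] add.commute)
    also have "\<dots> \<le> X" unfolding X_def using root by (intro mult_left_mono) auto
    finally show ?thesis .
  qed
  have 2: "K / n \<le> X"
  proof -
    have "K * K powr \<delta> = K powr (1 + \<delta>)" using assms by (simp add: powr_add)
    also have "\<dots> \<le> K powr ((1/2 + 2 * \<delta>) + (1/2 + 2 * \<delta>))"
      using assms \<delta> by (intro powr_mono) auto
    also have "\<dots> = K powr (1/2 + 2 * \<delta>) * K powr (1/2 + 2 * \<delta>)" by (rule powr_add)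
    also have "\<dots> \<le> n * n" using root assms by (intro mult_mono) auto
    finally show ?thesis using assms by (simp add: X_def powr_minus field_simps)
  qed
  have 3: "n * K powr (\<delta> - 1/2) \<le> X"
    unfolding X_def using assms \<delta> by (subst mult.commute) (intro mult_right_mono powr_mono, auto)
  have 4: "1 \<le> X"
  proof -
    have "K powr \<delta> \<le> K powr (1/2 + 2 * \<delta>)" using assms \<delta> by (intro powr_mono) auto
    then have "K powr \<delta> \<le> n" using root by simp
    then show ?thesis using assms by (simp add: X_def powr_minus field_simps)
  qed
  have sq: "1 / sqrt (c1 * K powr (1 - 2 * \<delta>) / n\<^sup>2) = n * K powr (\<delta> - 1/2) / sqrt c1"
  proof -
    have "sqrt (K powr (1 - 2 * \<delta>)) = K powr (1/2 - \<delta>)"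
      by (simp add: powr_half_sqrt[symmetric] powr_powr diff_divide_distrib left_diff_distrib)
    then have "sqrt (c1 * K powr (1 - 2 * \<delta>) / n\<^sup>2) = sqrt c1 * K powr (1/2 - \<delta>) / n"
      using assms by (simp add: real_sqrt_mult real_sqrt_divide)
    moreover have "K powr (\<delta> - 1/2) = inverse (K powr (1/2 - \<delta>))"
      by (simp add: powr_minus[symmetric])
    ultimately show ?thesis by (simp add: field_simps)
  qed
  let ?y = "n * K powr (\<delta> - 1/2) / sqrt c1"
  have "(2 * K powr (-\<delta>) * n + 1)
      + 2 * ((8 * K / n\<^sup>2 * n + 2) * (3 / sqrt (c1 * K powr (1 - 2 * \<delta>) / n\<^sup>2) + 2) + 1)
      = 2 * X + 1 + 2 * ((8 * (K / n) + 2) * (3 * ?y + 2) + 1)"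
    using sq assms by (simp add: X_def power2_eq_square mult.assoc)
  also have "\<dots> = 2 * X + 48 * ((K / n) * ?y) + 32 * (K / n) + 12 * ?y + 11"
  proof -
    have "2 * X + 1 + 2 * ((8 * u + 2) * (3 * y + 2) + 1) = 2 * X + 48 * (u * y) + 32 * u + 12 * y + 11"
      for u y :: real by (simp add: algebra_simps)
    then show ?thesis .
  qed
  also have "(K / n) * ?y = K powr (1/2 + \<delta>) / sqrt c1"
  proof -
    have "K * K powr (\<delta> - 1/2) = K powr (1/2 + \<delta>)"
      using assms powr_add[of K 1 "\<delta> - 1/2"] by (simp add: add.commute)
    then show ?thesis using assms by (simp add: field_simps)
  qed
  also have "2 * X + 48 * (K powr (1/2 + \<delta>) / sqrt c1) + 32 * (K / n) + 12 * ?y + 11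
      \<le> 2 * X + 48 * (X / sqrt c1) + 32 * X + 12 * (X / sqrt c1) + 11 * X"
    using 1 2 3 4 assms by (intro add_mono mult_left_mono divide_right_mono) auto
  also have "\<dots> = (60 / sqrt c1 + 45) * X" by (simp add: algebra_simps)
  finally show ?thesis by (simp add: X_def)
qed

lemma card_int_separated:
  fixes W :: "real \<Rightarrow> real" and S :: "int set"
  assumes "finite S" "0 < s" "0 \<le> \<omega>"
    and sep: "\<And>x y. \<lbrakk>x \<in> S; y \<in> S; x < y\<rbrakk> \<Longrightarrow> s * (real_of_int y - real_of_int x) \<le> W y - W x"
    and small: "\<And>x. x \<in> S \<Longrightarrow> \<bar>W x\<bar> < \<omega>"
  shows "real (card S) \<le> 2 * \<omega> / s + 1"
proof (cases "S = {}")
  case False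
  let ?i = "Min S" and ?j = "Max S"
  have ij: "?i \<in> S" "?j \<in> S" "?i \<le> ?j" using assms(1) False by auto
  have "s * (real_of_int ?j - real_of_int ?i) \<le> 2 * \<omega>"
    using small[OF ij(1)] small[OF ij(2)] sep[OF ij(1,2)] ij assms(3) by (cases "?i = ?j") auto
  then have "real_of_int ?j - real_of_int ?i \<le> 2 * \<omega> / s" using assms(2) by (simp add: field_simps)
  moreover have "card S \<le> card {?i..?j}"
    using assms(1) by (intro card_mono) auto
  then have "real (card S) \<le> real_of_int (?j - ?i + 1)" using ij by (simp add: nat_le_eq_zle le_nat_iff)
  ultimately show ?thesis by simp
qed (use assms in simp)

lemma has_real_derivative_shift_powr:
  fixes t a r :: real
  assumes "0 < t - a"
  shows "((\<lambda>t. (t - a) powr r) has_real_derivative r * (t - a) powr (r - 1)) (at t)"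
  by (rule DERIV_cong[OF DERIV_chain2[where f = "\<lambda>z. z powr r" and g = "\<lambda>t. t - a",
        OF has_real_derivative_powr[OF assms]]])
    (auto intro!: derivative_eq_intros)

text \<open>The second derivative of the phase is \<open>c (c - 1) t powr (c - 2) * W t\<close> with \<open>W\<close> monotone of slope at least \<open>s\<close>.
  Hence \<open>\<bar>W\<bar> \<ge> \<omega>\<close> outside at most \<open>2 \<omega> / s + 1\<close> integers, and the second derivative test applies to the two
  remaining intervals.\<close>
lemma phase_sum_bound_increasing:
  fixes c e :: real
  assumes c: "1 < c" "c < 2" and e: "1 \<le> e" "e < 2"
    and NN: "1 \<le> N'" "N' \<le> N" and K: "1 \<le> K" "K \<le> N' powr e"
    and mu: "\<bar>\<mu>\<bar> * N powr c < 2 * K" "K \<le> \<bar>\<mu>'\<bar> * N' powr c" "\<bar>\<mu>'\<bar> * N' powr c < 2 * K"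
    and h: "K powr (- ((1 / e - 1 / 2) / 2)) * N \<le> \<bar>real_of_int h\<bar>" and sgn: "0 < \<mu>' * real_of_int h"
    and pq: "p \<le> q" "N \<le> real_of_int p" "real_of_int q \<le> 2 * N"
      "N' \<le> real_of_int p - real_of_int h" "real_of_int q - real_of_int h \<le> 2 * N'"
  defines "c1 \<equiv> c * (c - 1) * (2 - c) / 8"
  shows "norm (\<Sum>n\<in>{p..q}. ee (\<mu> * real_of_int n powr c - \<mu>' * (real_of_int n - real_of_int h) powr c))
    \<le> (60 / sqrt c1 + 45) * (K powr (- ((1 / e - 1 / 2) / 2)) * N')"
proof -
  define \<delta> where "\<delta> = (1 / e - 1 / 2) / 2"
  define \<tau> where "\<tau> = K powr (-\<delta>)"
  define \<psi> where "\<psi> t = \<mu> * t powr c - \<mu>' * (t - real_of_int h) powr c" for t :: real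
  define \<psi>' where "\<psi>' t = c * (\<mu> * t powr (c - 1) - \<mu>' * (t - real_of_int h) powr (c - 1))" for t :: real
  define \<psi>'' where "\<psi>'' t = c * (c - 1) * (\<mu> * t powr (c - 2) - \<mu>' * (t - real_of_int h) powr (c - 2))" for t :: real
  define W where "W t = \<mu> - \<mu>' * (t / (t - real_of_int h)) powr (2 - c)" for t :: real
  define W' where "W' t = \<mu>' * real_of_int h * (2 - c) * (t / (t - real_of_int h)) powr (1 - c) / (t - real_of_int h)\<^sup>2" for t :: real
  \<comment> \<open>\<open>s\<close> bounds the derivative of \<open>W\<close> from below on the
    whole range, and \<open>\<omega>\<close> is then chosen such that at most
    \<open>2 * \<tau> * N' + 1\<close> integers have \<open>\<bar>W\<bar> < \<omega>\<close>: the
    trivial bound for these already has the desired size.\<close>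
  define s where "s = \<bar>\<mu>' * real_of_int h\<bar> * (2 - c) * (2 * N / N') powr (1 - c) / (2 * N')\<^sup>2"
  define \<omega> where "\<omega> = \<tau> * N' * s"
  define \<kappa> where "\<kappa> = c1 * K powr (1 - 2 * \<delta>) / N'\<^sup>2"
  have N: "0 < N" "0 < N'" using NN by auto
  have c1: "0 < c1" using c by (simp add: c1_def)
  have \<tau>: "0 < \<tau>" using K by (simp add: \<tau>_def)
  have s: "0 < s" using c N sgn by (simp add: s_def)
  have \<omega>: "0 < \<omega>" using \<tau> s N by (simp add: \<omega>_def)
  have \<kappa>: "0 < \<kappa>" using c1 K N by (simp add: \<kappa>_def)
  have range: "N \<le> t" "t \<le> 2 * N" "N' \<le> t - real_of_int h" "t - real_of_int h \<le> 2 * N'" "0 < t" "0 < t - real_of_int h"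
    if "real_of_int p \<le> t" "t \<le> real_of_int q" for t
    using that pq N by auto
  have D1: "(\<psi> has_real_derivative \<psi>' t) (at t)" if "real_of_int p \<le> t" "t \<le> real_of_int q" for t
    unfolding \<psi>_def \<psi>'_def using range[OF that]
    by (auto intro!: derivative_eq_intros simp: algebra_simps powr_diff)
  have D2: "(\<psi>' has_real_derivative \<psi>'' t) (at t)" if "real_of_int p \<le> t" "t \<le> real_of_int q" for t
  proof -
    have "((\<lambda>t. c * (\<mu> * t powr (c - 1) - \<mu>' * (t - real_of_int h) powr (c - 1))) has_real_derivative
        c * (\<mu> * ((c - 1) * t powr (c - 1 - 1)) - \<mu>' * ((c - 1) * (t - real_of_int h) powr (c - 1 - 1)))) (at t)"
      using range[OF that]
      by (intro DERIV_cmult DERIV_diff has_real_derivative_powr has_real_derivative_shift_powr) auto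
    then show ?thesis unfolding \<psi>'_def \<psi>''_def
      by (rule DERIV_cong) (simp add: algebra_simps)
  qed
  have DW: "(W has_real_derivative W' t) (at t)" if "real_of_int p \<le> t" "t \<le> real_of_int q" for t
  proof -
    note r = range[OF that]
    have "((\<lambda>t. t / (t - real_of_int h)) has_real_derivative - real_of_int h / (t - real_of_int h)\<^sup>2) (at t)"
      using r by (auto intro!: derivative_eq_intros simp: power2_eq_square)
    from DERIV_chain2[OF has_real_derivative_powr[of "t / (t - real_of_int h)" "2 - c"] this]
    have "((\<lambda>t. (t / (t - real_of_int h)) powr (2 - c)) has_real_derivative
        (2 - c) * (t / (t - real_of_int h)) powr (2 - c - 1) * (- real_of_int h / (t - real_of_int h)\<^sup>2)) (at t)"
      using r by simp
    from DERIV_diff[OF DERIV_const[of \<mu>] DERIV_cmult[OF this, of \<mu>']]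
    show ?thesis unfolding W_def W'_def by (rule DERIV_cong) simp
  qed
  have W's: "s \<le> W' t" if "real_of_int p \<le> t" "t \<le> real_of_int q" for t
  proof -
    note r = range[OF that]
    have "t / (t - real_of_int h) \<le> 2 * N / N'"
      using r N by (intro frac_le) auto
    then have 1: "(2 * N / N') powr (1 - c) \<le> (t / (t - real_of_int h)) powr (1 - c)"
      using r c N by (intro powr_mono2') auto
    have 2: "(t - real_of_int h)\<^sup>2 \<le> (2 * N')\<^sup>2"
      using r by (intro power_mono) auto
    show ?thesis unfolding s_def W'_def using 1 2 c sgn r
      by (intro frac_le mult_mono) auto
  qed
  have Winc: "s * (y - x) \<le> W y - W x" if "real_of_int p \<le> x" "x < y" "y \<le> real_of_int q" for x y
  proof -
    have "\<exists>z. x < z \<and> z < y \<and> W y - W x = (y - x) * W' z"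
      by (intro MVT2 DW) (use that in auto)
    then obtain z where z: "x < z" "z < y" "W y - W x = (y - x) * W' z" by blast
    have "(y - x) * s \<le> (y - x) * W' z"
      using W's[of z] z that by (intro mult_left_mono) auto
    then show ?thesis using z by (simp add: mult.commute)
  qed
  have Wmono: "W x \<le> W y" if "real_of_int p \<le> x" "x \<le> y" "y \<le> real_of_int q" for x y
  proof (cases "x = y")
    case False
    then have "0 \<le> s * (y - x)" using s that by simp
    then show ?thesis using Winc[of x y] that False by linarith
  qed simp
  have \<psi>W: "\<psi>'' t = c * (c - 1) * t powr (c - 2) * W t" if "real_of_int p \<le> t" "t \<le> real_of_int q" for t
  proof -
    note r = range[OF that]
    have "t powr (c - 2) * (t / (t - real_of_int h)) powr (2 - c) = (t - real_of_int h) powr (c - 2)"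
    proof -
      have "(t / (t - real_of_int h)) powr (2 - c) = t powr (2 - c) / (t - real_of_int h) powr (2 - c)"
        using r by (simp add: powr_divide)
      moreover have "t powr (c - 2) * t powr (2 - c) = 1" using r by (simp add: powr_add[symmetric])
      moreover have "(t - real_of_int h) powr (c - 2) = 1 / (t - real_of_int h) powr (2 - c)"
        using powr_minus_divide[of "t - real_of_int h" "2 - c"] by simp
      ultimately show ?thesis by simp
    qed
    then show ?thesis unfolding \<psi>''_def W_def
      by (simp add: algebra_simps)
  qed
  have low: "\<kappa> \<le> c * (c - 1) * t powr (c - 2) * \<omega>" if "real_of_int p \<le> t" "t \<le> real_of_int q" for t
  proof -
    note r = range[OF that]
    \<comment> \<open>One factor \<open>\<tau>\<close> comes from \<open>\<omega>\<close>, the other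
      from the separation of \<open>h\<close> from zero. The denominator 8 in \<open>c1\<close>
      collects 4 from the square of \<open>2 * N'\<close> in \<open>s\<close> and 2 from the factor
      \<open>2 * N\<close>.\<close>
    have "\<kappa> = c1 * \<tau> * \<tau> * K / N'\<^sup>2"
    proof -
      have "K powr (1 - 2 * \<delta>) = K powr (-\<delta>) * K powr (-\<delta>) * K"
        using K by (simp add: powr_add[symmetric] powr_diff field_simps)
      then show ?thesis by (simp add: \<kappa>_def \<tau>_def)
    qed
    also have "\<dots> \<le> c1 * \<tau> * (\<bar>real_of_int h\<bar> / N) * (\<bar>\<mu>'\<bar> * N' powr c) / N'\<^sup>2"
      using h mu c1 \<tau> N K by (intro divide_right_mono mult_mono) (auto simp: \<tau>_def \<delta>_def field_simps)
    also have "\<dots> = c * (c - 1) * (2 * N) powr (c - 2) * \<omega>"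
    proof -
      have "(2 * N) powr (c - 2) * (2 * N / N') powr (1 - c) = (2 * N) powr (-1) * N' powr (c - 1)"
        using N powr_minus_divide[of N' "1 - c"] powr_add[of "2 * N" "c - 2" "1 - c"]
        by (simp add: powr_divide)
      also have "\<dots> = N' powr c / (2 * N * N')"
        using N by (simp add: powr_diff powr_minus field_simps)
      finally have "c * (c - 1) * (2 * N) powr (c - 2) * \<omega>
          = c * (c - 1) * (\<tau> * N' * (\<bar>\<mu>' * real_of_int h\<bar> * (2 - c) / (2 * N')\<^sup>2)) * (N' powr c / (2 * N * N'))"
        unfolding \<omega>_def s_def by (simp add: mult_ac)
      also have "\<dots> = c1 * \<tau> * (\<bar>real_of_int h\<bar> / N) * (\<bar>\<mu>'\<bar> * N' powr c) / N'\<^sup>2"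
        using N by (simp add: c1_def abs_mult field_simps power2_eq_square)
      finally show ?thesis by simp
    qed
    also have "\<dots> \<le> c * (c - 1) * t powr (c - 2) * \<omega>"
      using r c \<omega> N by (intro mult_right_mono mult_left_mono powr_mono2') auto
    finally show ?thesis .
  qed
  have up: "\<bar>\<psi>'' t\<bar> \<le> 8 * K / N'\<^sup>2" if "real_of_int p \<le> t" "t \<le> real_of_int q" for t
  proof -
    note r = range[OF that]
    have "\<bar>\<mu>\<bar> * t powr (c - 2) \<le> \<bar>\<mu>\<bar> * N powr (c - 2)"
      using r c N by (intro mult_left_mono powr_mono2') auto
    also have "\<dots> = \<bar>\<mu>\<bar> * N powr c / N\<^sup>2"
      using N by (simp add: powr_diff)
    also have "\<dots> \<le> 2 * K / N'\<^sup>2"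
      using mu N NN K by (intro frac_le power_mono) auto
    finally have 1: "\<bar>\<mu>\<bar> * t powr (c - 2) \<le> 2 * K / N'\<^sup>2" .
    have "\<bar>\<mu>'\<bar> * (t - real_of_int h) powr (c - 2) \<le> \<bar>\<mu>'\<bar> * N' powr (c - 2)"
      using r c N by (intro mult_left_mono powr_mono2') auto
    also have "\<dots> = \<bar>\<mu>'\<bar> * N' powr c / N'\<^sup>2"
      using N by (simp add: powr_diff)
    also have "\<dots> \<le> 2 * K / N'\<^sup>2"
      using mu N NN K by (intro divide_right_mono) auto
    finally have 2: "\<bar>\<mu>'\<bar> * (t - real_of_int h) powr (c - 2) \<le> 2 * K / N'\<^sup>2" .
    have "c * (c - 1) \<le> 2 * 1" using c by (intro mult_mono) auto
    have "\<bar>\<psi>'' t\<bar> = c * (c - 1) * \<bar>\<mu> * t powr (c - 2) - \<mu>' * (t - real_of_int h) powr (c - 2)\<bar>"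
      using c by (simp add: \<psi>''_def abs_mult)
    also have "\<dots> \<le> 2 * (2 * K / N'\<^sup>2 + 2 * K / N'\<^sup>2)"
    proof (rule mult_mono)
      show "\<bar>\<mu> * t powr (c - 2) - \<mu>' * (t - real_of_int h) powr (c - 2)\<bar> \<le> 2 * K / N'\<^sup>2 + 2 * K / N'\<^sup>2"
        using 1 2 by (intro order_trans[OF abs_triangle_ineq4] add_mono) (auto simp: abs_mult)
    qed (use \<open>c * (c - 1) \<le> 2 * 1\<close> in auto)
    finally show ?thesis by simp
  qed
  \<comment> \<open>By monotonicity of \<open>W\<close>, \<open>A\<close> is a final and
    \<open>B\<close> an initial segment of \<open>{p..q}\<close>. On each of them
    \<open>\<psi>''\<close> has a fixed sign and is at least \<open>\<kappa>\<close> in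
    modulus.\<close>
  define A where "A = {n\<in>{p..q}. \<omega> \<le> W n}"
  define B where "B = {n\<in>{p..q}. W n \<le> - \<omega>}"
  define M where "M = {n\<in>{p..q}. \<bar>W n\<bar> < \<omega>}"
  define D where "D = (8 * K / N'\<^sup>2 * N' + 2) * (3 / sqrt \<kappa> + 2) + 1"
  have fins: "finite A" "finite B" "finite M"
    unfolding A_def B_def M_def by (auto intro: finite_subset[of _ "{p..q}"])
  have qp: "real_of_int q - real_of_int p \<le> N'" using pq by auto
  have D0: "0 \<le> D" using K N \<kappa> by (auto simp: D_def intro!: add_nonneg_nonneg mult_nonneg_nonneg)
  have block: "norm (\<Sum>n\<in>{a..b}. ee (\<psi> n)) \<le> D"
    if ab: "p \<le> a" "a \<le> b" "b \<le> q" and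
      sign: "(\<forall>t. real_of_int a \<le> t \<and> t \<le> real_of_int b \<longrightarrow> \<omega> \<le> W t)
        \<or> (\<forall>t. real_of_int a \<le> t \<and> t \<le> real_of_int b \<longrightarrow> W t \<le> - \<omega>)" for a b :: int
  proof -
    have in_pq: "real_of_int p \<le> t \<and> t \<le> real_of_int q" if "real_of_int a \<le> t" "t \<le> real_of_int b" for t
      using ab that by linarith
    have "norm (\<Sum>n\<in>{a..b}. ee (\<psi> n))
        \<le> (8 * K / N'\<^sup>2 * (real_of_int b - real_of_int a) + 2) * (3 / sqrt \<kappa> + 2) + 1"
      using sign
    proof
      assume W: "\<forall>t. real_of_int a \<le> t \<and> t \<le> real_of_int b \<longrightarrow> \<omega> \<le> W t"
      have "norm (\<Sum>n\<in>{a..b}. ee (\<psi> n))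
        \<le> (8 * K / N'\<^sup>2 * real_of_int (b - a) + 2) * (3 / sqrt \<kappa> + 2) + 1"
      proof (rule van_der_corput_second[OF ab(2) \<kappa>, of \<psi> \<psi>' \<psi>''])
        fix t :: real assume t: "real_of_int a \<le> t" "t \<le> real_of_int b"
        note t' = in_pq[OF t]
        show "(\<psi> has_real_derivative \<psi>' t) (at t)" "(\<psi>' has_real_derivative \<psi>'' t) (at t)"
          using D1 D2 t' by auto
        have "c * (c - 1) * t powr (c - 2) * \<omega> \<le> \<psi>'' t"
          using \<psi>W[of t] t' W t c by (auto intro!: mult_left_mono)
        then show "\<kappa> \<le> \<psi>'' t \<and> \<psi>'' t \<le> 8 * K / N'\<^sup>2"
          using low[of t] up[of t] t' by auto
      qed
      then show ?thesis by simp
    next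
      assume W: "\<forall>t. real_of_int a \<le> t \<and> t \<le> real_of_int b \<longrightarrow> W t \<le> - \<omega>"
      have "norm (\<Sum>n\<in>{a..b}. ee (- \<psi> n))
        \<le> (8 * K / N'\<^sup>2 * real_of_int (b - a) + 2) * (3 / sqrt \<kappa> + 2) + 1"
      proof (rule van_der_corput_second[OF ab(2) \<kappa>, of "\<lambda>t. - \<psi> t" "\<lambda>t. - \<psi>' t" "\<lambda>t. - \<psi>'' t"])
        fix t :: real assume t: "real_of_int a \<le> t" "t \<le> real_of_int b"
        note t' = in_pq[OF t]
        show "((\<lambda>t. - \<psi> t) has_real_derivative - \<psi>' t) (at t)" "((\<lambda>t. - \<psi>' t) has_real_derivative - \<psi>'' t) (at t)"
          using D1 D2 t' by (auto intro!: DERIV_minus)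
        have "c * (c - 1) * t powr (c - 2) * W t \<le> c * (c - 1) * t powr (c - 2) * (- \<omega>)"
          using W t c by (intro mult_left_mono) auto
        then have "c * (c - 1) * t powr (c - 2) * \<omega> \<le> - \<psi>'' t"
          using \<psi>W[of t] t' by simp
        then show "\<kappa> \<le> - \<psi>'' t \<and> - \<psi>'' t \<le> 8 * K / N'\<^sup>2"
          using low[of t] up[of t] t' by auto
      qed
      moreover have "norm (\<Sum>n\<in>{a..b}. ee (- \<psi> n)) = norm (\<Sum>n\<in>{a..b}. ee (\<psi> n))"
        by (simp add: ee_minus flip: cnj_sum)
      ultimately show ?thesis by simp
    qed
    also have "\<dots> \<le> D" unfolding D_def
      using qp ab K \<kappa> N by (intro add_mono mult_right_mono mult_left_mono) auto
    finally show ?thesis .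
  qed
  have "norm (\<Sum>n\<in>A. ee (\<psi> n)) \<le> D"
  proof (cases "A = {}")
    case False
    note fin = fins(1)
    let ?a = "Min A"
    have a: "?a \<in> A" using fin False by simp
    have "A = {?a..q}"
    proof
      show "{?a..q} \<subseteq> A"
      proof
        fix n assume n: "n \<in> {?a..q}"
        then have "W ?a \<le> W n" using a by (intro Wmono) (auto simp: A_def)
        then show "n \<in> A" using a n by (auto simp: A_def)
      qed
      show "A \<subseteq> {?a..q}" using fin by (auto simp: A_def)
    qed
    moreover have "norm (\<Sum>n\<in>{?a..q}. ee (\<psi> n)) \<le> D"
    proof (rule block)
      show "(\<forall>t. real_of_int ?a \<le> t \<and> t \<le> real_of_int q \<longrightarrow> \<omega> \<le> W t)
        \<or> (\<forall>t. real_of_int ?a \<le> t \<and> t \<le> real_of_int q \<longrightarrow> W t \<le> - \<omega>)"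
        using a Wmono[of ?a] by (auto simp: A_def intro: order_trans)
    qed (use a in \<open>auto simp: A_def\<close>)
    ultimately show ?thesis by simp
  qed (use D0 in simp)
  moreover have "norm (\<Sum>n\<in>B. ee (\<psi> n)) \<le> D"
  proof (cases "B = {}")
    case False
    note fin = fins(2)
    let ?b = "Max B"
    have b: "?b \<in> B" using fin False by simp
    have "B = {p..?b}"
    proof
      show "{p..?b} \<subseteq> B"
      proof
        fix n assume n: "n \<in> {p..?b}"
        then have "W n \<le> W ?b" using b by (intro Wmono) (auto simp: B_def)
        then show "n \<in> B" using b n by (auto simp: B_def)
      qed
      show "B \<subseteq> {p..?b}" using fin by (auto simp: B_def)
    qed
    moreover have "norm (\<Sum>n\<in>{p..?b}. ee (\<psi> n)) \<le> D"
    proof (rule block)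
      show "(\<forall>t. real_of_int p \<le> t \<and> t \<le> real_of_int ?b \<longrightarrow> \<omega> \<le> W t)
        \<or> (\<forall>t. real_of_int p \<le> t \<and> t \<le> real_of_int ?b \<longrightarrow> W t \<le> - \<omega>)"
        using b Wmono[of _ ?b] by (auto simp: B_def intro: order_trans)
    qed (use b in \<open>auto simp: B_def\<close>)
    ultimately show ?thesis by simp
  qed (use D0 in simp)
  moreover have "norm (\<Sum>n\<in>M. ee (\<psi> n)) \<le> 2 * \<tau> * N' + 1"
  proof -
    have "norm (\<Sum>n\<in>M. ee (\<psi> n)) \<le> card M"
      by (rule order_trans[OF norm_sum]) simp
    also have "real (card M) \<le> 2 * \<omega> / s + 1"
      by (rule card_int_separated[where W = W]) (use s \<omega> Winc fins(3) in \<open>auto simp: M_def\<close>)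
    also have "2 * \<omega> / s + 1 = 2 * \<tau> * N' + 1" using s by (simp add: \<omega>_def)
    finally show ?thesis .
  qed
  moreover have "(\<Sum>n\<in>{p..q}. ee (\<psi> n)) = (\<Sum>n\<in>A. ee (\<psi> n)) + (\<Sum>n\<in>B. ee (\<psi> n)) + (\<Sum>n\<in>M. ee (\<psi> n))"
  proof -
    have "{p..q} = (A \<union> B) \<union> M" by (auto simp: A_def B_def M_def)
    moreover have "A \<inter> B = {}" "(A \<union> B) \<inter> M = {}" using \<omega> by (auto simp: A_def B_def M_def)
    ultimately show ?thesis using fins by (simp add: sum.union_disjoint)
  qed
  ultimately have "norm (\<Sum>n\<in>{p..q}. ee (\<psi> n)) \<le> D + D + (2 * \<tau> * N' + 1)"
    by (smt (verit) norm_triangle_ineq)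
  also have "\<dots> = (2 * \<tau> * N' + 1) + 2 * D" by simp
  also have "\<dots> \<le> (60 / sqrt c1 + 45) * (K powr (- \<delta>) * N')"
    unfolding D_def \<tau>_def \<kappa>_def \<delta>_def by (rule phase_numerics[OF e NN(1) K c1])
  finally show ?thesis by (simp add: \<psi>_def \<delta>_def)
qed


text \<open>Negating both \<open>\<mu>\<close> and \<open>\<mu>'\<close> conjugates the sum, so the
  sign of \<open>\<mu>' * h\<close> is immaterial; neither factor vanishes, by the lower bounds in
  the hypotheses.\<close>

lemma phase_sum_bound:
  fixes c e :: real
  assumes c: "1 < c" "c < 2" and e: "1 \<le> e" "e < 2"
    and NN: "1 \<le> N'" "N' \<le> N" and K: "1 \<le> K" "K \<le> N' powr e"
    and mu: "\<bar>\<mu>\<bar> * N powr c < 2 * K" "K \<le> \<bar>\<mu>'\<bar> * N' powr c" "\<bar>\<mu>'\<bar> * N' powr c < 2 * K"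
    and h: "K powr (- ((1 / e - 1 / 2) / 2)) * N \<le> \<bar>real_of_int h\<bar>"
    and pq: "p \<le> q" "N \<le> real_of_int p" "real_of_int q \<le> 2 * N"
      "N' \<le> real_of_int p - real_of_int h" "real_of_int q - real_of_int h \<le> 2 * N'"
  defines "c1 \<equiv> c * (c - 1) * (2 - c) / 8"
  shows "norm (\<Sum>n\<in>{p..q}. ee (\<mu> * real_of_int n powr c - \<mu>' * (real_of_int n - real_of_int h) powr c))
    \<le> (60 / sqrt c1 + 45) * (K powr (- ((1 / e - 1 / 2) / 2)) * N')"
proof -
  have "\<mu>' \<noteq> 0" using K mu by auto
  moreover have "0 < K powr (- ((1 / e - 1 / 2) / 2)) * N" using NN K by simp
  then have "h \<noteq> 0" using h by auto
  ultimately consider "0 < \<mu>' * real_of_int h" | "0 < (- \<mu>') * real_of_int h"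
    by (metis mult_eq_0_iff mult_minus_left neg_0_less_iff_less not_less_iff_gr_or_eq of_int_eq_0_iff)
  then show ?thesis
  proof cases
    case 1
    then show ?thesis using phase_sum_bound_increasing[OF c e NN K mu h 1 pq] by (simp add: c1_def)
  next
    case 2
    let ?pos = "\<Sum>n\<in>{p..q}. ee (\<mu> * real_of_int n powr c - \<mu>' * (real_of_int n - real_of_int h) powr c)"
    let ?neg = "\<Sum>n\<in>{p..q}. ee (- \<mu> * real_of_int n powr c - - \<mu>' * (real_of_int n - real_of_int h) powr c)"
    have "?neg = cnj ?pos" by (simp flip: ee_minus)
    then have "norm ?neg = norm ?pos" by (simp only: complex_mod_cnj)
    moreover have "norm ?neg \<le> (60 / sqrt c1 + 45) * (K powr (- ((1 / e - 1 / 2) / 2)) * N')"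
      unfolding c1_def using mu
      by (intro phase_sum_bound_increasing[OF c e NN K _ _ _ h 2 pq]) auto
    ultimately show ?thesis by simp
  qed
qed

section \<open>Summation by parts and the TT* principle\<close>

lemma norm_sum_antimono_weight:
  fixes w :: "int \<Rightarrow> real" and z :: "int \<Rightarrow> complex"
  assumes "p \<le> q" and w: "\<And>n. \<lbrakk>p \<le> n; n \<le> q\<rbrakk> \<Longrightarrow> 0 \<le> w n"
    and dec: "\<And>n. \<lbrakk>p \<le> n; n < q\<rbrakk> \<Longrightarrow> w (n + 1) \<le> w n"
    and D: "\<And>r. \<lbrakk>p \<le> r; r \<le> q\<rbrakk> \<Longrightarrow> norm (\<Sum>n\<in>{p..r}. z n) \<le> D"
  shows "norm (\<Sum>n\<in>{p..q}. of_real (w n) * z n) \<le> w p * D"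
proof -
  have step: "{p..i + 1} = insert (i + 1) {p..i}" if "p \<le> i" for i using that by auto
  \<comment> \<open>With the boundary term subtracted, each step adds one decrement of
    \<open>w\<close> times a partial sum, and the decrements telescope.\<close>
  have "norm ((\<Sum>n\<in>{p..r}. of_real (w n) * z n) - of_real (w r) * (\<Sum>n\<in>{p..r}. z n)) \<le> (w p - w r) * D"
    if "p \<le> r" "r \<le> q" for r
    using that
  proof (induction r rule: int_ge_induct)
    case (step i)
    let ?S = "\<Sum>n\<in>{p..i}. of_real (w n) * z n" and ?Z = "\<Sum>n\<in>{p..i}. z n"
    have "(\<Sum>n\<in>{p..i + 1}. of_real (w n) * z n) - of_real (w (i + 1)) * (\<Sum>n\<in>{p..i + 1}. z n)
        = (?S - of_real (w i) * ?Z) + of_real (w i - w (i + 1)) * ?Z"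
      using \<open>\<And>i. p \<le> i \<Longrightarrow> {p..i + 1} = insert (i + 1) {p..i}\<close>[OF step.hyps] by (simp add: algebra_simps)
    also have "norm \<dots> \<le> (w p - w i) * D + (w i - w (i + 1)) * D"
      using step dec[of i] D[of i] by (intro order_trans[OF norm_triangle_ineq] add_mono)
        (auto simp: norm_mult mult_left_mono simp del: of_real_diff)
    finally show ?case by (simp add: algebra_simps)
  qed simp
  from this[of q] assms(1)
  have 1: "norm ((\<Sum>n\<in>{p..q}. of_real (w n) * z n) - of_real (w q) * (\<Sum>n\<in>{p..q}. z n)) \<le> (w p - w q) * D"
    by simp
  have 2: "norm (of_real (w q) * (\<Sum>n\<in>{p..q}. z n)) \<le> w q * D"
    using w[of q] D[of q] assms(1) by (simp add: norm_mult mult_left_mono)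
  have "norm (\<Sum>n\<in>{p..q}. of_real (w n) * z n) \<le> (w p - w q) * D + w q * D"
    using norm_triangle_sub[of "\<Sum>n\<in>{p..q}. of_real (w n) * z n" "of_real (w q) * (\<Sum>n\<in>{p..q}. z n)"] 1 2
    by linarith
  then show ?thesis by (simp add: algebra_simps)
qed

lemma Cauchy_Schwarz_norm_sum:
  fixes a b :: "'a \<Rightarrow> complex"
  shows "(norm (\<Sum>i\<in>I. a i * b i))\<^sup>2 \<le> (\<Sum>i\<in>I. (norm (a i))\<^sup>2) * (\<Sum>i\<in>I. (norm (b i))\<^sup>2)"
proof -
  have "norm (\<Sum>i\<in>I. a i * b i) \<le> (\<Sum>i\<in>I. norm (a i) * norm (b i))"
    by (rule order_trans[OF norm_sum]) (simp add: norm_mult)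
  then have "(norm (\<Sum>i\<in>I. a i * b i))\<^sup>2 \<le> (\<Sum>i\<in>I. norm (a i) * norm (b i))\<^sup>2"
    by (intro power_mono) auto
  also have "\<dots> \<le> (\<Sum>i\<in>I. (norm (a i))\<^sup>2) * (\<Sum>i\<in>I. (norm (b i))\<^sup>2)"
    by (rule Cauchy_Schwarz_ineq_sum)
  finally show ?thesis .
qed

text \<open>With \<open>G\<close> the image of \<open>f\<close>, the squared norm \<open>W\<close>
  of \<open>G\<close> is the pairing of \<open>f\<close> with \<open>h\<close>, the adjoint applied
  to \<open>G\<close> up to conjugation. The squared norm of \<open>h\<close> is a quadratic form in
  the correlations, hence at most \<open>B * W\<close>, and Cauchy-Schwarz gives
  \<open>W * W \<le> B * W * F\<close>. Only the moduli of \<open>G\<close> enter, so the form is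
  needed just for nonnegative \<open>g\<close>.\<close>

lemma TTstar_bound:
  fixes a :: "'a \<Rightarrow> 'b \<Rightarrow> complex" and \<kappa> :: "'a \<Rightarrow> 'a \<Rightarrow> real"
  assumes kern: "\<And>x x'. \<lbrakk>x \<in> X; x' \<in> X\<rbrakk> \<Longrightarrow> norm (\<Sum>y\<in>Y. a x y * cnj (a x' y)) \<le> \<kappa> x x'"
    and form: "\<And>g. (\<And>x. 0 \<le> g x) \<Longrightarrow> (\<Sum>x\<in>X. \<Sum>x'\<in>X. g x * g x' * \<kappa> x x') \<le> B * (\<Sum>x\<in>X. (g x)\<^sup>2)"
    and "0 \<le> B"
  shows "(\<Sum>x\<in>X. (norm (\<Sum>y\<in>Y. a x y * f y))\<^sup>2) \<le> B * (\<Sum>y\<in>Y. (norm (f y))\<^sup>2)"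
proof -
  define G where "G x = (\<Sum>y\<in>Y. a x y * f y)" for x
  define h where "h y = (\<Sum>x\<in>X. cnj (G x) * a x y)" for y
  define W where "W = (\<Sum>x\<in>X. (norm (G x))\<^sup>2)"
  define F where "F = (\<Sum>y\<in>Y. (norm (f y))\<^sup>2)"
  have W0: "0 \<le> W" "0 \<le> F" by (auto simp: W_def F_def sum_nonneg)
  have "complex_of_real W = (\<Sum>x\<in>X. cnj (G x) * G x)"
    unfolding W_def of_real_sum complex_norm_square by (simp add: mult.commute)
  also have "\<dots> = (\<Sum>x\<in>X. \<Sum>y\<in>Y. cnj (G x) * a x y * f y)"
    by (simp add: G_def sum_distrib_left mult.assoc)
  also have "\<dots> = (\<Sum>y\<in>Y. h y * f y)"
    by (subst sum.swap) (simp add: h_def sum_distrib_right)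
  finally have Weq: "complex_of_real W = (\<Sum>y\<in>Y. h y * f y)" .
  have "complex_of_real (\<Sum>y\<in>Y. (norm (h y))\<^sup>2) = (\<Sum>y\<in>Y. h y * cnj (h y))"
    unfolding of_real_sum complex_norm_square ..
  also have "\<dots> = (\<Sum>y\<in>Y. \<Sum>x\<in>X. \<Sum>x'\<in>X. cnj (G x) * G x' * (a x y * cnj (a x' y)))"
    unfolding h_def cnj_sum sum_product by (simp add: mult_ac)
  also have "\<dots> = (\<Sum>x\<in>X. \<Sum>x'\<in>X. \<Sum>y\<in>Y. cnj (G x) * G x' * (a x y * cnj (a x' y)))"
    by (subst sum.swap) (intro sum.cong refl sum.swap)
  also have "\<dots> = (\<Sum>x\<in>X. \<Sum>x'\<in>X. cnj (G x) * G x' * (\<Sum>y\<in>Y. a x y * cnj (a x' y)))"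
    by (simp add: sum_distrib_left)
  finally have "(\<Sum>y\<in>Y. (norm (h y))\<^sup>2)
      = norm (\<Sum>x\<in>X. \<Sum>x'\<in>X. cnj (G x) * G x' * (\<Sum>y\<in>Y. a x y * cnj (a x' y)))"
    using norm_of_real[of "\<Sum>y\<in>Y. (norm (h y))\<^sup>2", where 'a = complex]
    by (simp add: sum_nonneg)
  also have "\<dots> \<le> (\<Sum>x\<in>X. \<Sum>x'\<in>X. norm (G x) * norm (G x') * \<kappa> x x')"
    by (intro order_trans[OF norm_sum] sum_mono) (auto simp: norm_mult intro!: mult_left_mono kern)
  also have "\<dots> \<le> B * W"
    unfolding W_def by (rule form) simp
  finally have hB: "(\<Sum>y\<in>Y. (norm (h y))\<^sup>2) \<le> B * W" .
  have "W\<^sup>2 = (norm (\<Sum>y\<in>Y. h y * f y))\<^sup>2"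
    using Weq W0 by (metis norm_of_real abs_of_nonneg)
  also have "\<dots> \<le> (\<Sum>y\<in>Y. (norm (h y))\<^sup>2) * F"
    unfolding F_def by (rule Cauchy_Schwarz_norm_sum)
  also have "\<dots> \<le> B * W * F"
    using hB W0 by (intro mult_right_mono)
  finally have "W * W \<le> W * (B * F)" by (simp add: power2_eq_square mult_ac)
  then have "W \<le> B * F"
    using W0 \<open>0 \<le> B\<close> by (cases "W = 0") auto
  then show ?thesis by (simp add: W_def F_def G_def)
qed

section \<open>Single-scale oscillatory operators\<close>

text \<open>Only positive \<open>n\<close> occur; the negative half-line is reached by reflecting
  \<open>f\<close>.\<close>

definition osc :: "real \<Rightarrow> nat \<Rightarrow> real \<Rightarrow> (int \<Rightarrow> complex) \<Rightarrow> int \<Rightarrow> complex" where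
  "osc c j \<mu> f x = (\<Sum>n\<in>{2 ^ j..<2 ^ Suc j}. f (x - n) * ee (\<mu> * real_of_int n powr c) / of_int n)"

definition osc_kernel :: "real \<Rightarrow> nat \<Rightarrow> real \<Rightarrow> int \<Rightarrow> complex" where
  "osc_kernel c j \<mu> n = (if 2 ^ j \<le> n \<and> n < 2 ^ Suc j then ee (\<mu> * real_of_int n powr c) / of_int n else 0)"

definition window :: "nat \<Rightarrow> int \<Rightarrow> int set" where
  "window j x = {x - 2 ^ Suc j<..x - 2 ^ j}"

lemma finite_window [simp]: "finite (window j x)"
  by (simp add: window_def)

lemma osc_eq_sum:
  assumes "finite Y" "window j x \<subseteq> Y"
  shows "osc c j \<mu> f x = (\<Sum>y\<in>Y. osc_kernel c j \<mu> (x - y) * f y)"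
proof -
  have "osc c j \<mu> f x = (\<Sum>y\<in>window j x. osc_kernel c j \<mu> (x - y) * f y)"
    unfolding osc_def
    by (rule sum.reindex_bij_witness[where i = "\<lambda>y. x - y" and j = "\<lambda>n. x - n"])
      (auto simp: window_def osc_kernel_def)
  also have "\<dots> = (\<Sum>y\<in>Y. osc_kernel c j \<mu> (x - y) * f y)"
    using assms by (intro sum.mono_neutral_left) (auto simp: window_def osc_kernel_def)
  finally show ?thesis .
qed

lemma osc_cong:
  assumes "\<And>y. y \<in> window j x \<Longrightarrow> f y = g y"
  shows "osc c j \<mu> f x = osc c j \<mu> g x"
  unfolding osc_def using assms by (intro sum.cong) (auto simp: window_def)

lemma osc_add: "osc c j \<mu> (\<lambda>y. f y + g y) x = osc c j \<mu> f x + osc c j \<mu> g x"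
  by (simp add: osc_def distrib_right add_divide_distrib sum.distrib)

lemma norm_osc_le_sum: "norm (osc c j \<mu> f x) \<le> (\<Sum>y\<in>window j x. norm (f y)) / 2 ^ j"
proof -
  have "norm (osc c j \<mu> f x) \<le> (\<Sum>n\<in>{2 ^ j..<2 ^ Suc j}. norm (f (x - n)) / 2 ^ j)"
    unfolding osc_def
  proof (rule sum_norm_le)
    fix n :: int assume "n \<in> {2 ^ j..<2 ^ Suc j}"
    then have "2 ^ j \<le> n" by simp
    then have "(2::real) ^ j \<le> real_of_int n" by (metis of_int_le_iff of_int_numeral of_int_power)
    moreover from this have "0 < real_of_int n" by (rule less_le_trans[rotated]) simp
    ultimately show "norm (f (x - n) * ee (\<mu> * real_of_int n powr c) / of_int n) \<le> norm (f (x - n)) / 2 ^ j"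
      by (simp add: norm_mult norm_divide frac_le)
  qed
  also have "\<dots> = (\<Sum>y\<in>window j x. norm (f y) / 2 ^ j)"
    by (rule sum.reindex_bij_witness[where i = "\<lambda>y. x - y" and j = "\<lambda>n. x - n"])
      (auto simp: window_def)
  finally show ?thesis by (simp add: sum_divide_distrib)
qed

lemma norm_osc_le_avg: "norm (osc c j \<mu> f x) \<le> 2 * avg (2 ^ Suc j) f x"
proof -
  have "window j x \<subseteq> {x - int (2 ^ Suc j)..x + int (2 ^ Suc j)}"
    by (auto simp: window_def intro: order_trans[of _ "x - 2 ^ j"])
  then have "(\<Sum>y\<in>window j x. norm (f y)) \<le> (\<Sum>y\<in>{x - int (2 ^ Suc j)..x + int (2 ^ Suc j)}. norm (f y))"
    by (intro sum_mono2) auto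
  then have "(\<Sum>y\<in>window j x. norm (f y)) / 2 ^ j
      \<le> (\<Sum>y\<in>{x - int (2 ^ Suc j)..x + int (2 ^ Suc j)}. norm (f y)) / 2 ^ j"
    by (intro divide_right_mono) auto
  with norm_osc_le_sum[of c j \<mu> f x] show ?thesis by (simp add: avg_def)
qed

lemma norm_osc_le_sup:
  assumes "\<And>y. y \<in> window j x \<Longrightarrow> norm (f y) \<le> a"
  shows "norm (osc c j \<mu> f x) \<le> a"
proof -
  have "card (window j x) = 2 ^ j" by (simp add: window_def nat_power_eq)
  then have "(\<Sum>y\<in>window j x. norm (f y)) \<le> 2 ^ j * a"
    using sum_bounded_above[of "window j x" "\<lambda>y. norm (f y)" a] assms by simp
  then show ?thesis
    by (intro order_trans[OF norm_osc_le_sum]) (simp add: divide_le_eq mult.commute)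
qed

text \<open>With \<open>n = x - y\<close> and \<open>h = x - x'\<close> the correlation is an
  exponential sum over the overlap of two windows, with decreasing weights
  \<open>1 / (n * (n - h))\<close>. The overlap has at most \<open>N'\<close> terms of size at most
  \<open>1 / (N * N')\<close>, which suffices for \<open>\<bar>h\<bar> < T * N\<close>; for larger
  \<open>h\<close> the phase bound gains the factor \<open>T\<close>. The result involves only the
  larger scale \<open>N\<close>, so for fixed \<open>x\<close> it is supported in an interval of
  known radius about \<open>x\<close>.\<close>

lemma osc_kernel_correlation:
  fixes c e K \<mu> \<mu>' :: real and j j' :: nat
  defines "N \<equiv> 2 ^ j" and "N' \<equiv> 2 ^ j'"
  assumes c: "1 < c" "c < 2" and e: "1 \<le> e" "e < 2" and jj: "j' \<le> j"
    and K: "1 \<le> K" "K \<le> N' powr e"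
    and mu: "\<bar>\<mu>\<bar> * N powr c < 2 * K" "K \<le> \<bar>\<mu>'\<bar> * N' powr c" "\<bar>\<mu>'\<bar> * N' powr c < 2 * K"
    and Y: "finite Y" "window j x \<subseteq> Y" "window j' x' \<subseteq> Y"
  defines "A \<equiv> 60 / sqrt (c * (c - 1) * (2 - c) / 8) + 45"
    and "T \<equiv> K powr (- ((1 / e - 1 / 2) / 2))"
  shows "norm (\<Sum>y\<in>Y. osc_kernel c j \<mu> (x - y) * cnj (osc_kernel c j' \<mu>' (x' - y)))
    \<le> (if \<bar>real_of_int (x - x')\<bar> \<le> 2 * N
        then (A * T + (if \<bar>real_of_int (x - x')\<bar> < T * N then 1 else 0)) / N else 0)"
proof -
  define h where "h = x - x'"
  define p where "p = max (2 ^ j) (2 ^ j' + h)"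
  define q where "q = min (2 ^ Suc j - 1) (2 ^ Suc j' - 1 + h)"
  have N: "0 < N" "1 \<le> N'" "N' \<le> N" using jj by (auto simp: N_def N'_def power_increasing)
  have NI: "N = real_of_int (2 ^ j)" "N' = real_of_int (2 ^ j')" by (auto simp: N_def N'_def)
  have A: "0 \<le> A" using c by (simp add: A_def)
  have T: "0 < T" using K by (simp add: T_def)
  let ?t = "\<lambda>n. ee (\<mu> * real_of_int n powr c - \<mu>' * (real_of_int n - real_of_int h) powr c)"
  let ?w = "\<lambda>n. 1 / (real_of_int n * (real_of_int n - real_of_int h))"
  have pq: "N \<le> real_of_int n" "real_of_int n \<le> 2 * N" "N' \<le> real_of_int n - real_of_int h"
      "real_of_int n - real_of_int h \<le> 2 * N'" if "p \<le> n" "n \<le> q" for n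
  proof -
    have "2 ^ j \<le> n" "n \<le> 2 * 2 ^ j" "2 ^ j' \<le> n - h" "n - h \<le> 2 * 2 ^ j'"
      using that by (auto simp: p_def q_def)
    then show "N \<le> real_of_int n" "real_of_int n \<le> 2 * N" "N' \<le> real_of_int n - real_of_int h"
      "real_of_int n - real_of_int h \<le> 2 * N'"
      unfolding NI by linarith+
  qed
  have w: "0 \<le> ?w n" "?w n \<le> 1 / (N * N')" if "p \<le> n" "n \<le> q" for n
    using pq[OF that] N by (auto intro!: divide_nonneg_nonneg mult_nonneg_nonneg frac_le mult_mono)
  have eq: "(\<Sum>y\<in>Y. osc_kernel c j \<mu> (x - y) * cnj (osc_kernel c j' \<mu>' (x' - y)))
      = (\<Sum>n\<in>{p..q}. of_real (?w n) * ?t n)"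
  proof -
    have "(\<Sum>y\<in>Y. osc_kernel c j \<mu> (x - y) * cnj (osc_kernel c j' \<mu>' (x' - y)))
        = (\<Sum>y\<in>window j x \<inter> window j' x'. osc_kernel c j \<mu> (x - y) * cnj (osc_kernel c j' \<mu>' (x' - y)))"
      using Y by (intro sum.mono_neutral_right) (auto simp: window_def osc_kernel_def)
    also have "\<dots> = (\<Sum>n\<in>{p..q}. of_real (?w n) * ?t n)"
      by (rule sum.reindex_bij_witness[where i = "\<lambda>n. x - n" and j = "\<lambda>y. x - y"])
        (auto simp: window_def osc_kernel_def p_def q_def h_def ee_diff algebra_simps)
    finally show ?thesis .
  qed
  show ?thesis
  proof (cases "p \<le> q")
    case False
    then show ?thesis unfolding eq using A T N by simp
  next
    case le: True
    have near: "\<bar>real_of_int (x - x')\<bar> \<le> 2 * N"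
      using pq[of p] le N by (auto simp: h_def)
    show ?thesis
    proof (cases "\<bar>real_of_int (x - x')\<bar> < T * N")
      case True
      have "norm (\<Sum>n\<in>{p..q}. of_real (?w n) * ?t n) \<le> (\<Sum>n\<in>{p..q}. 1 / (N * N'))"
      proof (rule sum_norm_le)
        fix n assume "n \<in> {p..q}"
        then have "0 \<le> ?w n" "?w n \<le> 1 / (N * N')" using w[of n] by auto
        then show "norm (of_real (?w n) * ?t n) \<le> 1 / (N * N')"
          by (simp only: norm_mult norm_of_real norm_ee abs_of_nonneg mult_1_right)
      qed
      also have "\<dots> = real (card {p..q}) / (N * N')" by simp
      also have "\<dots> \<le> N' / (N * N')"
      proof (rule divide_right_mono)
        have "q - p + 1 \<le> 2 ^ j'" by (auto simp: p_def q_def)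
        then have "real_of_int (q - p + 1) \<le> N'" unfolding NI by linarith
        then show "real (card {p..q}) \<le> N'" using le by simp
      qed (use N in auto)
      also have "\<dots> = 1 / N" using N by simp
      also have "\<dots> \<le> (A * T + 1) / N" using A T N by (intro divide_right_mono) auto
      finally show ?thesis unfolding eq using near True by simp
    next
      case False
      have "norm (\<Sum>n\<in>{p..q}. of_real (?w n) * ?t n) \<le> ?w p * (A * (T * N'))"
      proof (rule norm_sum_antimono_weight[OF le])
        fix n assume n: "p \<le> n" "n < q"
        show "?w (n + 1) \<le> ?w n"
          using pq[of n] n N by (intro divide_left_mono mult_mono mult_pos_pos) auto
      next
        fix r assume r: "p \<le> r" "r \<le> q"
        show "norm (\<Sum>n\<in>{p..r}. ?t n) \<le> A * (T * N')"
          unfolding A_def T_def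
        proof (rule phase_sum_bound[OF c e N(2,3) K mu _ r(1)])
          show "K powr - ((1 / e - 1 / 2) / 2) * N \<le> \<bar>real_of_int h\<bar>"
            using False by (simp add: T_def h_def)
        qed (use pq[of p] pq[of r] r in auto)
      qed (use w in auto)
      also have "\<dots> \<le> 1 / (N * N') * (A * (T * N'))"
        using w[of p] le A T N by (intro mult_right_mono) auto
      also have "\<dots> = A * T / N" using N by simp
      finally show ?thesis unfolding eq using near False by simp
    qed
  qed
qed

text \<open>The condition \<open>K \<le> (2 ^ j) powr e\<close> with \<open>e < 2\<close> limits \<open>\<bar>\<mu>\<bar>\<close> to \<open>(2 ^ j) powr (e - c)\<close>.  Taking \<open>e > c\<close> leaves room for
  the frequencies \<open>\<theta> + m\<close> that arise from the expansion of the integer part.\<close>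
definition adapted :: "real \<Rightarrow> real \<Rightarrow> real \<Rightarrow> (int \<Rightarrow> nat) \<Rightarrow> (int \<Rightarrow> real) \<Rightarrow> int set \<Rightarrow> int set \<Rightarrow> bool" where
  "adapted c e K j \<mu> X Y \<longleftrightarrow> finite X \<and> finite Y \<and> 1 \<le> K \<and> (\<forall>x\<in>X. window (j x) x \<subseteq> Y \<and>
    K \<le> \<bar>\<mu> x\<bar> * (2 ^ j x) powr c \<and> \<bar>\<mu> x\<bar> * (2 ^ j x) powr c < 2 * K \<and> K \<le> (2 ^ j x) powr e)"

lemma adaptedD:
  assumes "adapted c e K j \<mu> X Y"
  shows "finite X" "finite Y" "1 \<le> K" "\<And>x. x \<in> X \<Longrightarrow> window (j x) x \<subseteq> Y"
    "\<And>x. x \<in> X \<Longrightarrow> K \<le> \<bar>\<mu> x\<bar> * (2 ^ j x) powr c \<and> \<bar>\<mu> x\<bar> * (2 ^ j x) powr c < 2 * K \<and> K \<le> (2 ^ j x) powr e"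
  using assms by (auto simp: adapted_def)

text \<open>For fixed \<open>x\<close> the kernel bound \<open>k0 x x'\<close> combines the
  indicators of two intervals about \<open>x\<close>, of radii \<open>2 * 2 ^ j x\<close> and
  \<open>T * 2 ^ j x\<close>, both depending on \<open>x\<close> alone. Row sums are therefore
  averages at \<open>x\<close>, and the quadratic form is a pairing of \<open>g\<close> with
  linearised maximal functions. Each interval yields a factor \<open>T\<close>: the wide one through
  its coefficient, the narrow one through its length.\<close>

lemma osc_l2:
  fixes c e :: real
  assumes c: "1 < c" "c < 2" and e: "1 \<le> e" "e < 2"
  shows "\<exists>C>0. \<forall>X Y j \<mu> K f. adapted c e K j \<mu> X Y \<longrightarrow>
    (\<Sum>x\<in>X. (norm (osc c (j x) (\<mu> x) f x))\<^sup>2)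
      \<le> C * K powr (- ((1 / e - 1 / 2) / 2)) * (\<Sum>y\<in>Y. (norm (f y))\<^sup>2)"
proof -
  have "1 < (2::real)" by simp
  from avg_strong_type[OF this, where 'a = real] obtain M where M: "0 < M"
    "\<forall>X Y N (g :: int \<Rightarrow> real). finite X \<longrightarrow> finite Y \<longrightarrow>
      (\<forall>x\<in>X. 1 \<le> N x \<and> {x - int (N x)..x + int (N x)} \<subseteq> Y) \<longrightarrow>
      (\<Sum>x\<in>X. avg (N x) g x powr 2) \<le> M * (\<Sum>y\<in>Y. norm (g y) powr 2)"
    by (elim exE conjE) (rule that)
  define A where "A = 60 / sqrt (c * (c - 1) * (2 - c) / 8) + 45"
  have A: "0 < A" using c by (simp add: A_def add_nonneg_pos)
  have maxi: "(\<Sum>x\<in>X. g x * avg (r x) (\<lambda>y. if y \<in> X then g y else 0) x) \<le> (1 + M) * (\<Sum>x\<in>X. (g x)\<^sup>2)"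
    if X: "finite X" and r: "\<And>x. x \<in> X \<Longrightarrow> 1 \<le> r x" for X :: "int set" and g :: "int \<Rightarrow> real" and r
  proof -
    let ?G = "\<lambda>y. if y \<in> X then g y else 0"
    let ?Y = "\<Union>x\<in>X. {x - int (r x)..x + int (r x)}"
    have "(\<Sum>x\<in>X. (avg (r x) ?G x)\<^sup>2) = (\<Sum>x\<in>X. avg (r x) ?G x powr 2)"
      by (simp add: avg_nonneg)
    also have "\<dots> \<le> M * (\<Sum>y\<in>?Y. norm (?G y) powr 2)"
      using X r by (intro M(2)[rule_format]) auto
    also have "\<dots> \<le> M * (\<Sum>x\<in>X. (g x)\<^sup>2)"
    proof (rule mult_left_mono)
      have "(\<Sum>y\<in>?Y. norm (?G y) powr 2) = (\<Sum>y\<in>?Y \<inter> X. norm (?G y) powr 2)"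
        using X by (intro sum.mono_neutral_right) auto
      also have "\<dots> \<le> (\<Sum>y\<in>X. norm (?G y) powr 2)"
        using X by (intro sum_mono2) auto
      finally show "(\<Sum>y\<in>?Y. norm (?G y) powr 2) \<le> (\<Sum>x\<in>X. (g x)\<^sup>2)" by simp
    qed (use M in simp)
    finally have 1: "(\<Sum>x\<in>X. (avg (r x) ?G x)\<^sup>2) \<le> M * (\<Sum>x\<in>X. (g x)\<^sup>2)" .
    have "g x * avg (r x) ?G x \<le> (g x)\<^sup>2 + (avg (r x) ?G x)\<^sup>2" for x
    proof -
      have "2 * (g x * avg (r x) ?G x) \<le> (g x)\<^sup>2 + (avg (r x) ?G x)\<^sup>2"
        using sum_squares_bound[of "g x" "avg (r x) ?G x"] by (simp only: mult.assoc)
      moreover have "0 \<le> (g x)\<^sup>2 + (avg (r x) ?G x)\<^sup>2" by simp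
      ultimately show ?thesis by linarith
    qed
    then have "(\<Sum>x\<in>X. g x * avg (r x) ?G x) \<le> (\<Sum>x\<in>X. (g x)\<^sup>2 + (avg (r x) ?G x)\<^sup>2)"
      by (intro sum_mono)
    then show ?thesis using 1 by (simp add: sum.distrib algebra_simps)
  qed
  show ?thesis
  proof (intro exI[of _ "2 * ((2 * A + 2) * (1 + M))"] conjI allI impI)
    show "0 < 2 * ((2 * A + 2) * (1 + M))" using A M by (intro mult_pos_pos) auto
    fix X Y and j :: "int \<Rightarrow> nat" and \<mu> :: "int \<Rightarrow> real" and K :: real and f
    assume ad: "adapted c e K j \<mu> X Y"
    note X = adaptedD(1)[OF ad] and Y = adaptedD(2)[OF ad] and K = adaptedD(3)[OF ad]
      and win = adaptedD(4)[OF ad] and size = adaptedD(5)[OF ad]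
    define T where "T = K powr (- ((1 / e - 1 / 2) / 2))"
    define k0 where "k0 x x' = (if \<bar>real_of_int (x - x')\<bar> \<le> 2 * 2 ^ j x
        then (A * T + (if \<bar>real_of_int (x - x')\<bar> < T * 2 ^ j x then 1 else 0)) / 2 ^ j x else 0)" for x x' :: int
    \<comment> \<open>The correlation bound wants the larger scale first. Adding both orders covers
      either case, and the two halves of the form coincide after swapping the summation
      variables.\<close>
    define \<kappa> where "\<kappa> x x' = k0 x x' + k0 x' x" for x x'
    have T: "0 < T" using K by (simp add: T_def)
    have k0: "0 \<le> k0 x x'" for x x' using A T by (simp add: k0_def)
    \<comment> \<open>The narrow interval has radius at least 1, so rounding its radius up to an
      integer at most doubles it.\<close>
    have TN: "1 \<le> T * 2 ^ j x" if "x \<in> X" for x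
    proof -
      have "(1 / e - 1 / 2) / 2 \<le> 1 / e" using e by (simp add: field_simps)
      then have "K powr ((1 / e - 1 / 2) / 2) \<le> K powr (1 / e)" using K by (intro powr_mono) auto
      also have "\<dots> \<le> ((2 ^ j x) powr e) powr (1 / e)"
        using size[OF that] K e by (intro powr_mono2) auto
      also have "\<dots> = 2 ^ j x" using e by (simp add: powr_powr)
      finally show ?thesis using K by (simp add: T_def powr_minus field_simps)
    qed
    have rho: "1 \<le> nat \<lceil>T * 2 ^ j x\<rceil>" "T * 2 ^ j x \<le> real (nat \<lceil>T * 2 ^ j x\<rceil>)" if "x \<in> X" for x
    proof -
      show 1: "T * 2 ^ j x \<le> real (nat \<lceil>T * 2 ^ j x\<rceil>)" by (rule real_nat_ceiling_ge)
      then have "1 \<le> real (nat \<lceil>T * 2 ^ j x\<rceil>)" using TN[OF that] by linarith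
      then show "1 \<le> nat \<lceil>T * 2 ^ j x\<rceil>" by linarith
    qed
    have row: "(\<Sum>x'\<in>X. g x' * k0 x x') \<le> T * (2 * A * avg (2 ^ Suc (j x)) (\<lambda>y. if y \<in> X then g y else 0) x
        + 2 * avg (nat \<lceil>T * 2 ^ j x\<rceil>) (\<lambda>y. if y \<in> X then g y else 0) x)"
      if x: "x \<in> X" and g: "\<And>x. 0 \<le> g x" for x g
    proof -
      let ?G = "\<lambda>y. if y \<in> X then g y else 0" and ?N = "(2::real) ^ j x" and ?\<rho> = "nat \<lceil>T * 2 ^ j x\<rceil>"
      have local: "(\<Sum>x'\<in>{x'\<in>X. P x'}. g x') \<le> r * avg r ?G x"
        if r: "1 \<le> r" and P: "\<And>x'. P x' \<Longrightarrow> \<bar>real_of_int (x - x')\<bar> \<le> real r" for P r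
      proof -
        have P': "x' \<in> {x - int r..x + int r}" if "P x'" for x'
        proof -
          have "\<bar>x - x'\<bar> \<le> int r"
            using P[OF that] by (metis of_int_abs of_int_le_iff of_int_of_nat_eq)
          then show ?thesis by auto
        qed
        have "(\<Sum>x'\<in>{x'\<in>X. P x'}. g x') = (\<Sum>x'\<in>{x'\<in>X. P x'}. norm (?G x'))"
          using g by (intro sum.cong) auto
        also have "\<dots> \<le> (\<Sum>y\<in>{x - int r..x + int r}. norm (?G y))"
          using P' by (intro sum_mono2) auto
        also have "\<dots> = r * avg r ?G x" using r by (simp add: avg_def)
        finally show ?thesis .
      qed
      have "(\<Sum>x'\<in>X. g x' * k0 x x') = A * T / ?N * (\<Sum>x'\<in>{x'\<in>X. \<bar>real_of_int (x - x')\<bar> \<le> 2 * ?N}. g x')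
          + 1 / ?N * (\<Sum>x'\<in>{x'\<in>X. \<bar>real_of_int (x - x')\<bar> \<le> 2 * ?N \<and> \<bar>real_of_int (x - x')\<bar> < T * ?N}. g x')"
        unfolding sum.inter_filter[OF X] sum_distrib_left sum.distrib[symmetric]
        by (intro sum.cong) (auto simp: k0_def add_divide_distrib algebra_simps)
      also have "\<dots> \<le> A * T / ?N * (real (2 ^ Suc (j x)) * avg (2 ^ Suc (j x)) ?G x) + 1 / ?N * (?\<rho> * avg ?\<rho> ?G x)"
        using A T rho[OF x]
        by (intro add_mono mult_left_mono local)
          (auto intro: order_trans[OF less_imp_le le_of_int_ceiling])
      also have "\<dots> \<le> T * (2 * A * avg (2 ^ Suc (j x)) ?G x) + 2 * T * avg ?\<rho> ?G x"
      proof (rule add_mono)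
        have "real ?\<rho> \<le> 2 * T * ?N" using TN[OF x] by linarith
        then have "1 / ?N * real ?\<rho> \<le> 2 * T" by (simp add: field_simps)
        then have "(1 / ?N * real ?\<rho>) * avg ?\<rho> ?G x \<le> (2 * T) * avg ?\<rho> ?G x"
          by (intro mult_right_mono avg_nonneg)
        then show "1 / ?N * (?\<rho> * avg ?\<rho> ?G x) \<le> 2 * T * avg ?\<rho> ?G x"
          by (simp only: mult.assoc)
      qed simp
      finally show ?thesis by (simp add: algebra_simps)
    qed
    have form: "(\<Sum>x\<in>X. \<Sum>x'\<in>X. g x * g x' * \<kappa> x x') \<le> 2 * ((2 * A + 2) * (1 + M)) * T * (\<Sum>x\<in>X. (g x)\<^sup>2)"
      if g: "\<And>x. 0 \<le> g x" for g :: "int \<Rightarrow> real"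
    proof -
      let ?G = "\<lambda>y. if y \<in> X then g y else 0" and ?\<rho> = "\<lambda>x. nat \<lceil>T * 2 ^ j x\<rceil>"
      have "(\<Sum>x\<in>X. \<Sum>x'\<in>X. g x * g x' * \<kappa> x x')
          = (\<Sum>x\<in>X. \<Sum>x'\<in>X. g x * g x' * k0 x x') + (\<Sum>x\<in>X. \<Sum>x'\<in>X. g x * g x' * k0 x' x)"
        by (simp add: \<kappa>_def distrib_left sum.distrib)
      also have "(\<Sum>x\<in>X. \<Sum>x'\<in>X. g x * g x' * k0 x' x) = (\<Sum>x\<in>X. \<Sum>x'\<in>X. g x * g x' * k0 x x')"
        by (subst sum.swap) (simp add: mult_ac)
      also have "(\<Sum>x\<in>X. \<Sum>x'\<in>X. g x * g x' * k0 x x') = (\<Sum>x\<in>X. g x * (\<Sum>x'\<in>X. g x' * k0 x x'))"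
        by (simp add: sum_distrib_left mult.assoc)
      finally have "(\<Sum>x\<in>X. \<Sum>x'\<in>X. g x * g x' * \<kappa> x x') = 2 * (\<Sum>x\<in>X. g x * (\<Sum>x'\<in>X. g x' * k0 x x'))"
        by simp
      also have "\<dots> \<le> 2 * (\<Sum>x\<in>X. g x * (T * (2 * A * avg (2 ^ Suc (j x)) ?G x + 2 * avg (?\<rho> x) ?G x)))"
        using row g by (intro mult_left_mono sum_mono) auto
      also have "\<dots> = 2 * T * (2 * A * (\<Sum>x\<in>X. g x * avg (2 ^ Suc (j x)) ?G x) + 2 * (\<Sum>x\<in>X. g x * avg (?\<rho> x) ?G x))"
        by (simp add: sum_distrib_left sum.distrib distrib_left mult_ac)
      also have "\<dots> \<le> 2 * T * (2 * A * ((1 + M) * (\<Sum>x\<in>X. (g x)\<^sup>2)) + 2 * ((1 + M) * (\<Sum>x\<in>X. (g x)\<^sup>2)))"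
        using A T rho X by (intro mult_left_mono add_mono maxi) (use rho in auto)
      finally show ?thesis by (simp add: algebra_simps)
    qed
    have kern: "norm (\<Sum>y\<in>Y. osc_kernel c (j x) (\<mu> x) (x - y) * cnj (osc_kernel c (j x') (\<mu> x') (x' - y))) \<le> \<kappa> x x'"
      if x: "x \<in> X" "x' \<in> X" for x x'
    proof (cases "j x' \<le> j x")
      case True
      have "norm (\<Sum>y\<in>Y. osc_kernel c (j x) (\<mu> x) (x - y) * cnj (osc_kernel c (j x') (\<mu> x') (x' - y))) \<le> k0 x x'"
        unfolding k0_def A_def T_def
        by (rule osc_kernel_correlation) (use c e True K size x Y win in auto)
      then show ?thesis using k0[of x' x] by (simp add: \<kappa>_def)
    next
      case False
      have "norm (\<Sum>y\<in>Y. osc_kernel c (j x') (\<mu> x') (x' - y) * cnj (osc_kernel c (j x) (\<mu> x) (x - y))) \<le> k0 x' x"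
        unfolding k0_def A_def T_def
        by (rule osc_kernel_correlation) (use c e False K size x Y win in auto)
      moreover have "(\<Sum>y\<in>Y. osc_kernel c (j x) (\<mu> x) (x - y) * cnj (osc_kernel c (j x') (\<mu> x') (x' - y)))
        = cnj (\<Sum>y\<in>Y. osc_kernel c (j x') (\<mu> x') (x' - y) * cnj (osc_kernel c (j x) (\<mu> x) (x - y)))"
        by (simp add: mult.commute)
      ultimately show ?thesis using k0[of x x'] by (simp only: complex_mod_cnj \<kappa>_def)
    qed
    have "(\<Sum>x\<in>X. (norm (osc c (j x) (\<mu> x) f x))\<^sup>2)
        = (\<Sum>x\<in>X. (norm (\<Sum>y\<in>Y. osc_kernel c (j x) (\<mu> x) (x - y) * f y))\<^sup>2)"
      using Y win by (intro sum.cong refl) (simp add: osc_eq_sum)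
    also have "\<dots> \<le> 2 * ((2 * A + 2) * (1 + M)) * T * (\<Sum>y\<in>Y. (norm (f y))\<^sup>2)"
      by (rule TTstar_bound[OF kern form]) (use A M T in auto)
    finally show "(\<Sum>x\<in>X. (norm (osc c (j x) (\<mu> x) f x))\<^sup>2)
      \<le> 2 * ((2 * A + 2) * (1 + M)) * K powr (- ((1 / e - 1 / 2) / 2)) * (\<Sum>y\<in>Y. (norm (f y))\<^sup>2)"
      by (simp add: T_def)
  qed
qed


lemma osc_lp:
  fixes c e p :: real
  assumes c: "1 < c" "c < 2" and e: "1 \<le> e" "e < 2" and p: "1 < p"
  shows "\<exists>C>0. \<exists>\<epsilon>>0. \<forall>X Y j \<mu> K f. adapted c e K j \<mu> X Y \<longrightarrow>
    (\<Sum>x\<in>X. norm (osc c (j x) (\<mu> x) f x) powr p) \<le> C * K powr (- \<epsilon>) * (\<Sum>y\<in>Y. norm (f y) powr p)"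
proof -
  define \<delta> where "\<delta> = (1 / e - 1 / 2) / 2"
  have \<delta>: "0 < \<delta>" using e by (simp add: \<delta>_def field_simps)
  obtain A where A: "0 < A"
    "\<And>X Y j \<mu> K f. adapted c e K j \<mu> X Y \<Longrightarrow> (\<Sum>x\<in>X. (norm (osc c (j x) (\<mu> x) f x))\<^sup>2)
      \<le> A * K powr (- \<delta>) * (\<Sum>y\<in>Y. (norm (f y))\<^sup>2)"
    unfolding \<delta>_def using osc_l2[OF c e] by blast
  have weak2: "real (card {x\<in>X. a < norm (osc c (j x) (\<mu> x) f x)})
      \<le> A * K powr (- \<delta>) * a powr (-2) * (\<Sum>y\<in>Y. norm (f y) powr 2)"
    if ad: "adapted c e K j \<mu> X Y" and a: "0 < a" for X Y j \<mu> K f and a :: real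
  proof -
    let ?S = "{x\<in>X. a < norm (osc c (j x) (\<mu> x) f x)}"
    have "real (card ?S) * a\<^sup>2 = (\<Sum>x\<in>?S. a\<^sup>2)" by simp
    also have "\<dots> \<le> (\<Sum>x\<in>?S. (norm (osc c (j x) (\<mu> x) f x))\<^sup>2)"
      using a by (intro sum_mono power_mono) auto
    also have "\<dots> \<le> (\<Sum>x\<in>X. (norm (osc c (j x) (\<mu> x) f x))\<^sup>2)"
      using adaptedD(1)[OF ad] by (intro sum_mono2) auto
    also have "\<dots> \<le> A * K powr (- \<delta>) * (\<Sum>y\<in>Y. (norm (f y))\<^sup>2)"
      by (rule A(2)[OF ad])
    also have "A * K powr (- \<delta>) * (\<Sum>y\<in>Y. (norm (f y))\<^sup>2)
        = (A * K powr (- \<delta>) * a powr (-2) * (\<Sum>y\<in>Y. norm (f y) powr 2)) * a\<^sup>2"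
      using a by (simp add: powr_minus)
    finally show ?thesis using a by (simp add: mult_le_cancel_right)
  qed
  have split_bound: "real (card {x\<in>X. \<alpha> < norm (osc c (j x) (\<mu> x) f x)})
      \<le> real (card {x\<in>X. \<alpha> / 2 < norm (osc c (j x) (\<mu> x) (\<lambda>y. if y \<in> Y \<and> t < norm (f y) then f y else 0) x)})
      + real (card {x\<in>X. \<alpha> / 2 < norm (osc c (j x) (\<mu> x) (\<lambda>y. if y \<in> Y \<and> norm (f y) \<le> t then f y else 0) x)})"
    if "finite X" "\<And>x. x \<in> X \<Longrightarrow> window (j x) x \<subseteq> Y" for X Y and j :: "int \<Rightarrow> nat" and \<mu> f and \<alpha> t :: real
  proof -
    let ?h = "\<lambda>y. if y \<in> Y \<and> t < norm (f y) then f y else 0"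
    let ?l = "\<lambda>y. if y \<in> Y \<and> norm (f y) \<le> t then f y else 0"
    let ?H = "{x\<in>X. \<alpha> / 2 < norm (osc c (j x) (\<mu> x) ?h x)}"
    let ?L = "{x\<in>X. \<alpha> / 2 < norm (osc c (j x) (\<mu> x) ?l x)}"
    have "{x\<in>X. \<alpha> < norm (osc c (j x) (\<mu> x) f x)} \<subseteq> ?H \<union> ?L"
    proof
      fix x assume x: "x \<in> {x\<in>X. \<alpha> < norm (osc c (j x) (\<mu> x) f x)}"
      have "osc c (j x) (\<mu> x) f x = osc c (j x) (\<mu> x) (\<lambda>y. ?h y + ?l y) x"
        using that(2)[of x] x by (intro osc_cong) auto
      also have "\<dots> = osc c (j x) (\<mu> x) ?h x + osc c (j x) (\<mu> x) ?l x" by (rule osc_add)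
      finally have "norm (osc c (j x) (\<mu> x) f x) \<le> norm (osc c (j x) (\<mu> x) ?h x) + norm (osc c (j x) (\<mu> x) ?l x)"
        by (simp only: norm_triangle_ineq)
      then show "x \<in> ?H \<union> ?L" using x by auto
    qed
    then have "card {x\<in>X. \<alpha> < norm (osc c (j x) (\<mu> x) f x)} \<le> card (?H \<union> ?L)"
      using that(1) by (intro card_mono) auto
    also have "\<dots> \<le> card ?H + card ?L" by (rule card_Un_le)
    finally show ?thesis by linarith
  qed
  show ?thesis
  proof (cases "p < 2")
    case True
    define D where "D = 2 powr p * (1 / (1 - 2 powr (- (p - 1))) + 1 / (1 - 2 powr (- (2 - p))))"
    have D: "0 < D" using p True powr_less_one[of 2 "- (p - 1)"] powr_less_one[of 2 "- (2 - p)"]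
      by (auto simp: D_def intro!: mult_pos_pos add_pos_pos)
    have pos: "0 < D * (20 + 4 * A)" "0 < \<delta> * (p - 1)" using D A \<delta> p by auto
    show ?thesis
    proof (rule exI[of _ "D * (20 + 4 * A)"], rule conjI[OF pos(1)], rule exI[of _ "\<delta> * (p - 1)"],
        rule conjI[OF pos(2)], intro allI impI)
      fix X Y and j :: "int \<Rightarrow> nat" and \<mu> :: "int \<Rightarrow> real" and K :: real and f
      assume ad: "adapted c e K j \<mu> X Y"
      note X = adaptedD(1)[OF ad] and Y = adaptedD(2)[OF ad] and K = adaptedD(3)[OF ad]
        and win = adaptedD(4)[OF ad]
      have "(\<Sum>x\<in>X. norm (osc c (j x) (\<mu> x) f x) powr p)
        \<le> D * (20 * (K powr \<delta>) powr (1 - p) + 4 * A * K powr (-\<delta>) * (K powr \<delta>) powr (2 - p)) * (\<Sum>y\<in>Y. norm (f y) powr p)"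
        unfolding D_def
      proof (rule marcinkiewicz)
        fix \<alpha> :: real assume \<alpha>: "0 < \<alpha>"
        \<comment> \<open>This height balances the weak l^1 bound, which has no decay, against the
          l^2 bound: both \<open>(K powr \<delta>) powr (1 - p)\<close> and
          \<open>K powr (-\<delta>) * (K powr \<delta>) powr (2 - p)\<close> equal
          \<open>K powr (- (\<delta> * (p - 1)))\<close>.\<close>
        define t where "t = K powr \<delta> * \<alpha>"
        define fh where "fh y = (if y \<in> Y \<and> t < norm (f y) then f y else 0)" for y
        define fl where "fl y = (if y \<in> Y \<and> norm (f y) \<le> t then f y else 0)" for y
        have fh0: "fh y = 0" if "y \<notin> Y" for y using that by (simp add: fh_def)
        have "card {x\<in>X. \<alpha> / 2 < norm (osc c (j x) (\<mu> x) fh x)} \<le> card {x\<in>X. \<alpha> / 4 < avg (2 ^ Suc (j x)) fh x}"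
          using X norm_osc_le_avg[of c "j _" "\<mu> _" fh]
          by (intro card_mono) (auto intro: less_le_trans simp: field_simps)
        moreover have "real (card {x\<in>X. \<alpha> / 4 < avg (2 ^ Suc (j x)) fh x}) \<le> 5 / (\<alpha> / 4) * (\<Sum>y\<in>Y. norm (fh y))"
          by (rule avg_weak_type[where N = "\<lambda>x. 2 ^ Suc (j x)"]) (use X Y \<alpha> fh0 in auto)
        moreover have "(\<Sum>y\<in>Y. norm (fh y)) = (\<Sum>y\<in>{y\<in>Y. t < norm (f y)}. norm (f y) powr 1)"
          using Y by (simp add: fh_def sum.inter_filter) (auto intro!: sum.cong)
        \<comment> \<open>The threshold is \<open>\<alpha> / 4\<close>: one factor 2 comes from
          splitting \<open>f\<close>, another from bounding \<open>osc\<close> by twice an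
          average.\<close>
        moreover have "5 / (\<alpha> / 4) = 20 * \<alpha> powr (-1)" using \<alpha> by (simp add: powr_minus field_simps)
        ultimately have high: "real (card {x\<in>X. \<alpha> / 2 < norm (osc c (j x) (\<mu> x) fh x)})
            \<le> 20 * \<alpha> powr (-1) * (\<Sum>y\<in>{y\<in>Y. t < norm (f y)}. norm (f y) powr 1)"
          by simp
        have "real (card {x\<in>X. \<alpha> / 2 < norm (osc c (j x) (\<mu> x) fl x)})
            \<le> A * K powr (- \<delta>) * (\<alpha> / 2) powr (-2) * (\<Sum>y\<in>Y. norm (fl y) powr 2)"
          by (rule weak2[OF ad]) (use \<alpha> in auto)
        also have "(\<Sum>y\<in>Y. norm (fl y) powr 2) = (\<Sum>y\<in>{y\<in>Y. norm (f y) \<le> t}. norm (f y) powr 2)"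
          using Y by (simp add: fl_def sum.inter_filter) (auto intro!: sum.cong)
        also have "(\<alpha> / 2) powr (-2) = 4 * \<alpha> powr (-2)"
          using \<alpha> by (simp add: powr_minus field_simps)
        finally have low: "real (card {x\<in>X. \<alpha> / 2 < norm (osc c (j x) (\<mu> x) fl x)})
            \<le> 4 * A * K powr (- \<delta>) * \<alpha> powr (-2) * (\<Sum>y\<in>{y\<in>Y. norm (f y) \<le> t}. norm (f y) powr 2)"
          by (simp add: mult_ac)
        show "real (card {x\<in>X. \<alpha> < norm (osc c (j x) (\<mu> x) f x)})
          \<le> 20 * \<alpha> powr (- 1) * (\<Sum>y\<in>{y\<in>Y. K powr \<delta> * \<alpha> < norm (f y)}. norm (f y) powr 1)
            + 4 * A * K powr (-\<delta>) * \<alpha> powr (- 2) * (\<Sum>y\<in>{y\<in>Y. norm (f y) \<le> K powr \<delta> * \<alpha>}. norm (f y) powr 2)"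
        proof -
          have "real (card {x\<in>X. \<alpha> < norm (osc c (j x) (\<mu> x) f x)})
            \<le> real (card {x\<in>X. \<alpha> / 2 < norm (osc c (j x) (\<mu> x) fh x)})
            + real (card {x\<in>X. \<alpha> / 2 < norm (osc c (j x) (\<mu> x) fl x)})"
            unfolding fh_def fl_def by (rule split_bound[OF X win])
          then show ?thesis using high low unfolding t_def by linarith
        qed
      qed (use X Y K A p True in auto)
      also have "20 * (K powr \<delta>) powr (1 - p) + 4 * A * K powr (-\<delta>) * (K powr \<delta>) powr (2 - p)
          = (20 + 4 * A) * K powr (- (\<delta> * (p - 1)))"
      proof -
        have "K powr (-\<delta>) * (K powr \<delta>) powr (2 - p) = K powr (- (\<delta> * (p - 1)))"
          by (simp add: powr_powr powr_add[symmetric] algebra_simps)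
        moreover have "(K powr \<delta>) powr (1 - p) = K powr (- (\<delta> * (p - 1)))"
          by (simp add: powr_powr algebra_simps)
        ultimately show ?thesis by (simp add: mult.assoc algebra_simps)
      qed
      finally show "(\<Sum>x\<in>X. norm (osc c (j x) (\<mu> x) f x) powr p)
        \<le> D * (20 + 4 * A) * K powr - (\<delta> * (p - 1)) * (\<Sum>y\<in>Y. norm (f y) powr p)"
        by (simp add: mult.assoc)
    qed
  next
    case False
    show ?thesis
    proof (cases "p = 2")
      case True
      show ?thesis
      proof (rule exI[of _ A], rule conjI[OF A(1)], rule exI[of _ \<delta>], rule conjI[OF \<delta>], intro allI impI)
        fix X Y and j :: "int \<Rightarrow> nat" and \<mu> :: "int \<Rightarrow> real" and K :: real and f
        assume "adapted c e K j \<mu> X Y"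
        from A(2)[OF this]
        show "(\<Sum>x\<in>X. norm (osc c (j x) (\<mu> x) f x) powr p)
          \<le> A * K powr - \<delta> * (\<Sum>y\<in>Y. norm (f y) powr p)"
          using True by simp
      qed
    next
      case False2: False
      define D where "D = 2 powr p * (1 / (1 - 2 powr (- (p - 2))) + 1 / (1 - 2 powr (- (p + 1 - p))))"
      have D: "0 < D" using p False False2 powr_less_one[of 2 "- (p - 2)"]
        by (auto simp: D_def intro!: mult_pos_pos add_pos_pos)
      have pos: "0 < D * (4 * A * (1/2) powr (2 - p))" using D A by auto
      show ?thesis
      proof (rule exI[of _ "D * (4 * A * (1/2) powr (2 - p))"], rule conjI[OF pos], rule exI[of _ \<delta>],
          rule conjI[OF \<delta>], intro allI impI)
        fix X Y and j :: "int \<Rightarrow> nat" and \<mu> :: "int \<Rightarrow> real" and K :: real and f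
        assume ad: "adapted c e K j \<mu> X Y"
        note X = adaptedD(1)[OF ad] and Y = adaptedD(2)[OF ad] and K = adaptedD(3)[OF ad]
          and win = adaptedD(4)[OF ad]
        have "(\<Sum>x\<in>X. norm (osc c (j x) (\<mu> x) f x) powr p)
          \<le> D * (4 * A * K powr (-\<delta>) * (1/2) powr (2 - p) + 0 * (1/2) powr (p + 1 - p)) * (\<Sum>y\<in>Y. norm (f y) powr p)"
          unfolding D_def
        proof (rule marcinkiewicz)
          fix \<alpha> :: real assume \<alpha>: "0 < \<alpha>"
          \<comment> \<open>For \<open>p > 2\<close> the other endpoint is the supremum bound: cut
            at \<open>\<alpha> / 2\<close>, the low part never exceeds its threshold, whence the
            coefficient 0 and the dummy exponent \<open>p + 1\<close>.\<close>
          define t where "t = 1/2 * \<alpha>"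
          define fh where "fh y = (if y \<in> Y \<and> t < norm (f y) then f y else 0)" for y
          define fl where "fl y = (if y \<in> Y \<and> norm (f y) \<le> t then f y else 0)" for y
          have "norm (osc c (j x) (\<mu> x) fl x) \<le> t" for x
            using \<alpha> by (intro norm_osc_le_sup) (auto simp: fl_def t_def)
          then have low: "{x\<in>X. \<alpha> / 2 < norm (osc c (j x) (\<mu> x) fl x)} = {}"
            by (auto simp: t_def not_less)
          have "real (card {x\<in>X. \<alpha> / 2 < norm (osc c (j x) (\<mu> x) fh x)})
              \<le> A * K powr (- \<delta>) * (\<alpha> / 2) powr (-2) * (\<Sum>y\<in>Y. norm (fh y) powr 2)"
            by (rule weak2[OF ad]) (use \<alpha> in auto)
          also have "(\<Sum>y\<in>Y. norm (fh y) powr 2) = (\<Sum>y\<in>{y\<in>Y. t < norm (f y)}. norm (f y) powr 2)"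
            using Y by (simp add: fh_def sum.inter_filter) (auto intro!: sum.cong)
          also have "(\<alpha> / 2) powr (-2) = 4 * \<alpha> powr (-2)"
            using \<alpha> by (simp add: powr_minus field_simps)
          finally have high: "real (card {x\<in>X. \<alpha> / 2 < norm (osc c (j x) (\<mu> x) fh x)})
              \<le> 4 * A * K powr (- \<delta>) * \<alpha> powr (-2) * (\<Sum>y\<in>{y\<in>Y. t < norm (f y)}. norm (f y) powr 2)"
            by (simp add: mult_ac)
          have "real (card {x\<in>X. \<alpha> < norm (osc c (j x) (\<mu> x) f x)})
            \<le> real (card {x\<in>X. \<alpha> / 2 < norm (osc c (j x) (\<mu> x) fh x)})
            + real (card {x\<in>X. \<alpha> / 2 < norm (osc c (j x) (\<mu> x) fl x)})"
            unfolding fh_def fl_def by (rule split_bound[OF X win])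
          then show "real (card {x\<in>X. \<alpha> < norm (osc c (j x) (\<mu> x) f x)})
            \<le> 4 * A * K powr (-\<delta>) * \<alpha> powr (- 2) * (\<Sum>y\<in>{y\<in>Y. 1/2 * \<alpha> < norm (f y)}. norm (f y) powr 2)
              + 0 * \<alpha> powr (- (p + 1)) * (\<Sum>y\<in>{y\<in>Y. norm (f y) \<le> 1/2 * \<alpha>}. norm (f y) powr (p + 1))"
            using high unfolding low t_def by simp
        qed (use X Y K A p False False2 in auto)
        then show "(\<Sum>x\<in>X. norm (osc c (j x) (\<mu> x) f x) powr p)
          \<le> D * (4 * A * (1/2) powr (2 - p)) * K powr - \<delta> * (\<Sum>y\<in>Y. norm (f y) powr p)"
          by (simp add: mult_ac)
      qed
    qed
  qed
qed

section \<open>The discrete Hilbert transform\<close>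

lemma powr_add_le:
  fixes a b p :: real
  assumes "0 \<le> a" "0 \<le> b" "0 < p"
  shows "(a + b) powr p \<le> 2 powr p * (a powr p + b powr p)"
proof -
  have "(a + b) powr p \<le> (2 * max a b) powr p"
    using assms by (intro powr_mono2) auto
  also have "\<dots> = 2 powr p * max a b powr p" using assms by (simp add: powr_mult)
  also have "\<dots> \<le> 2 powr p * (a powr p + b powr p)"
    by (intro mult_left_mono) (auto simp: max_def)
  finally show ?thesis .
qed

text \<open>Jensen's inequality for the weights \<open>w\<close>, of total mass
  \<open>V \<le> W\<close>. Young's inequality is applied to \<open>g i\<close> against a power of
  the weighted mean \<open>a\<close>; equality for \<open>g i = a\<close> is the reason that summing
  over \<open>i\<close> loses no constant.\<close>

lemma powr_sum_weighted_le:
  fixes w g :: "'a \<Rightarrow> real"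
  assumes p: "1 < p" and fin: "finite I" and w: "\<And>i. i \<in> I \<Longrightarrow> 0 \<le> w i" and g: "\<And>i. i \<in> I \<Longrightarrow> 0 \<le> g i"
    and W: "(\<Sum>i\<in>I. w i) \<le> W"
  shows "(\<Sum>i\<in>I. w i * g i) powr p \<le> W powr (p - 1) * (\<Sum>i\<in>I. w i * g i powr p)"
proof (cases "(\<Sum>i\<in>I. w i) = 0")
  case True
  then have "\<forall>i\<in>I. w i = 0" using fin w by (simp add: sum_nonneg_eq_0_iff)
  then show ?thesis by simp
next
  case False
  define V where "V = (\<Sum>i\<in>I. w i)"
  define a where "a = (\<Sum>i\<in>I. w i * g i) / V"
  define q where "q = p / (p - 1)"
  have V: "0 < V" using False w unfolding V_def by (metis sum_nonneg order_less_le)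
  have a: "0 \<le> a" unfolding a_def using V w g by (intro divide_nonneg_pos sum_nonneg) auto
  have q: "1 < q" "1 / p + 1 / q = 1" using p by (auto simp: q_def field_simps)
  have aV: "(\<Sum>i\<in>I. w i * g i) = a * V" using V by (simp add: a_def)
  have pq: "(a powr (p - 1)) powr q = a powr p" using p by (simp add: q_def powr_powr)
  have "V * a powr p = a powr (p - 1) * (\<Sum>i\<in>I. w i * g i)"
    unfolding aV using a p by (cases "a = 0") (auto simp: powr_diff)
  also have "\<dots> = (\<Sum>i\<in>I. w i * (g i * a powr (p - 1)))"
    by (simp add: sum_distrib_left mult_ac)
  also have "\<dots> \<le> (\<Sum>i\<in>I. w i * (g i powr p / p + a powr p / q))"
  proof (intro sum_mono mult_left_mono)
    fix i assume "i \<in> I"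
    then show "g i * a powr (p - 1) \<le> g i powr p / p + a powr p / q"
      using Youngs_inequality[OF p q(1) q(2), of "g i" "a powr (p - 1)"] g pq by simp
  qed (use w in auto)
  also have "\<dots> = (\<Sum>i\<in>I. w i * g i powr p) / p + V * a powr p / q"
    by (simp add: V_def sum.distrib distrib_left sum_distrib_right sum_divide_distrib)
  finally have "V * a powr p * (1 - 1 / q) \<le> (\<Sum>i\<in>I. w i * g i powr p) / p"
    by (simp add: algebra_simps)
  moreover have "1 - 1 / q = 1 / p" using q(2) by linarith
  ultimately have main: "V * a powr p \<le> (\<Sum>i\<in>I. w i * g i powr p)"
    using p by (simp add: divide_le_cancel)
  have "(\<Sum>i\<in>I. w i * g i) powr p = V powr (p - 1) * (V * a powr p)"
    unfolding aV using a V by (simp add: powr_mult powr_diff)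
  also have "\<dots> \<le> W powr (p - 1) * (\<Sum>i\<in>I. w i * g i powr p)"
    using main V W p by (intro mult_mono powr_mono2) (auto simp: V_def)
  finally show ?thesis .
qed

lemma sum_inverse_squares_nat: "(\<Sum>n\<in>{1..m}. 1 / (real n)\<^sup>2) \<le> 2"
proof -
  \<comment> \<open>The stronger bound makes the induction close by telescoping; for
    \<open>m = 0\<close> it is read with \<open>1 / 0 = 0\<close>.\<close>
  have "(\<Sum>n\<in>{1..m}. 1 / (real n)\<^sup>2) \<le> 2 - 1 / real m"
  proof (induction m)
    case (Suc m)
    show ?case
    proof (cases "m = 0")
      case False
      have "1 / (real (Suc m))\<^sup>2 \<le> 1 / (real m * real (Suc m))"
        using False by (intro divide_left_mono) (auto simp: power2_eq_square)
      also have "\<dots> = 1 / real m - 1 / real (Suc m)"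
        using False by (simp add: field_simps)
      finally show ?thesis using Suc by simp
    qed simp
  qed simp
  then show ?thesis by (rule order_trans) simp
qed

lemma sum_inverse_squares:
  fixes A :: "int set" and y :: int
  assumes "finite A"
  shows "(\<Sum>x\<in>A. 1 / (real_of_int (x - y))\<^sup>2) \<le> 4"
proof -
  define m where "m = nat (Max (insert 0 ((\<lambda>x. \<bar>x - y\<bar>) ` A)))"
  have m: "\<bar>x - y\<bar> \<le> int m" if "x \<in> A" for x
  proof -
    have "\<bar>x - y\<bar> \<le> Max (insert 0 ((\<lambda>x. \<bar>x - y\<bar>) ` A))"
      using assms that by (intro Max_ge) auto
    moreover have "0 \<le> Max (insert 0 ((\<lambda>x. \<bar>x - y\<bar>) ` A))"
      using assms by (intro Max_ge) auto
    ultimately show ?thesis by (simp add: m_def)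
  qed
  let ?P = "(\<lambda>n. y + int n) ` {1..m}" and ?N = "(\<lambda>n. y - int n) ` {1..m}"
  have sub: "A \<subseteq> insert y (?P \<union> ?N)"
  proof
    fix x assume "x \<in> A"
    then have "\<bar>x - y\<bar> \<le> int m" by (rule m)
    then consider "x = y" | "x = y + int (nat (x - y))" "nat (x - y) \<in> {1..m}"
      | "x = y - int (nat (y - x))" "nat (y - x) \<in> {1..m}"
      by (cases x y rule: linorder_cases) (auto simp: Suc_le_eq nat_le_iff)
    then show "x \<in> insert y (?P \<union> ?N)" by cases blast+
  qed
  have "(\<Sum>x\<in>A. 1 / (real_of_int (x - y))\<^sup>2) \<le> (\<Sum>x\<in>insert y (?P \<union> ?N). 1 / (real_of_int (x - y))\<^sup>2)"
    using sub by (intro sum_mono2) auto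
  also have "\<dots> = (\<Sum>x\<in>?P. 1 / (real_of_int (x - y))\<^sup>2) + (\<Sum>x\<in>?N. 1 / (real_of_int (x - y))\<^sup>2)"
  proof -
    have "?P \<inter> ?N = {}" "y \<notin> ?P \<union> ?N" by auto
    then show ?thesis by (simp add: sum.union_disjoint)
  qed
  also have "(\<Sum>x\<in>?P. 1 / (real_of_int (x - y))\<^sup>2) = (\<Sum>n\<in>{1..m}. 1 / (real n)\<^sup>2)"
    by (subst sum.reindex) (auto simp: inj_on_def)
  also have "(\<Sum>x\<in>?N. 1 / (real_of_int (x - y))\<^sup>2) = (\<Sum>n\<in>{1..m}. 1 / (real n)\<^sup>2)"
    by (subst sum.reindex) (auto simp: inj_on_def)
  finally show ?thesis using sum_inverse_squares_nat[of m] by simp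
qed

text \<open>The kernel has mass at most 4 in either variable: Jensen uses the mass in
  \<open>y\<close>, giving \<open>4 powr (p - 1)\<close>, and the exchange of sums uses the mass in
  \<open>x\<close>, giving the last factor 4.\<close>

lemma inverse_square_convolution:
  fixes g :: "int \<Rightarrow> real"
  assumes p: "1 < p" and fin: "finite X" "finite S" and g: "\<And>y. 0 \<le> g y"
  shows "(\<Sum>x\<in>X. (\<Sum>y\<in>S. g y / (real_of_int (x - y))\<^sup>2) powr p) \<le> 4 powr p * (\<Sum>y\<in>S. g y powr p)"
proof -
  have sw: "(\<Sum>y\<in>S. 1 / (real_of_int (x - y))\<^sup>2) \<le> 4" for x
    using sum_inverse_squares[OF fin(2), of x] by (simp add: power2_commute)
  have "(\<Sum>x\<in>X. (\<Sum>y\<in>S. g y / (real_of_int (x - y))\<^sup>2) powr p)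
      \<le> (\<Sum>x\<in>X. 4 powr (p - 1) * (\<Sum>y\<in>S. 1 / (real_of_int (x - y))\<^sup>2 * g y powr p))"
  proof (rule sum_mono)
    fix x
    show "(\<Sum>y\<in>S. g y / (real_of_int (x - y))\<^sup>2) powr p
        \<le> 4 powr (p - 1) * (\<Sum>y\<in>S. 1 / (real_of_int (x - y))\<^sup>2 * g y powr p)"
      using powr_sum_weighted_le[OF p fin(2), of "\<lambda>y. 1 / (real_of_int (x - y))\<^sup>2" g 4] sw g by simp
  qed
  also have "\<dots> = 4 powr (p - 1) * (\<Sum>y\<in>S. g y powr p * (\<Sum>x\<in>X. 1 / (real_of_int (x - y))\<^sup>2))"
    unfolding sum_distrib_left by (subst sum.swap) (simp add: mult_ac)
  also have "\<dots> \<le> 4 powr (p - 1) * (\<Sum>y\<in>S. g y powr p * 4)"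
    using sum_inverse_squares[OF fin(1)] by (intro mult_left_mono sum_mono) auto
  also have "\<dots> = 4 powr p * (\<Sum>y\<in>S. g y powr p)"
    by (simp add: sum_distrib_right[symmetric] powr_diff)
  finally show ?thesis .
qed

section \<open>Cotlar's identity and the l^2 bound\<close>

definition hilb :: "int set \<Rightarrow> (int \<Rightarrow> real) \<Rightarrow> int \<Rightarrow> real" where
  "hilb S f x = (\<Sum>y\<in>S. f y / real_of_int (x - y))"

text \<open>Since \<open>1 / 0 = 0\<close>, the terms with \<open>x = y\<close> vanish, and the partial fraction identity
  for \<open>1 / ((x - y) * (x - z))\<close> acquires the three correction terms below.\<close>
lemma hilbert_partial_fractions:
  fixes x y z :: int
  shows "1 / real_of_int (x - y) * (1 / real_of_int (x - z))
    = 1 / real_of_int (x - y) * (1 / real_of_int (y - z)) + 1 / real_of_int (x - z) * (1 / real_of_int (z - y))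
      + (if y = z then 1 / (real_of_int (x - y))\<^sup>2 else 0)
      + (if x = z then 1 / (real_of_int (x - y))\<^sup>2 else 0) + (if x = y then 1 / (real_of_int (x - z))\<^sup>2 else 0)"
proof -
  have "1 / a * (1 / b) = 1 / a * (1 / (b - a)) + 1 / b * (1 / (a - b)) + (if a = b then 1 / a\<^sup>2 else 0)
      + (if b = 0 then 1 / a\<^sup>2 else 0) + (if a = 0 then 1 / b\<^sup>2 else 0)" for a b :: real
  proof (cases "a = 0 \<or> b = 0 \<or> a = b")
    case False
    have "1 / (a - b) = - (1 / (b - a))" by (metis minus_diff_eq minus_divide_right)
    then have "1 / a * (1 / (b - a)) + 1 / b * (1 / (a - b)) = (1 / a - 1 / b) / (b - a)"
      by (simp add: diff_divide_distrib)
    also have "1 / a - 1 / b = (b - a) * (1 / a * (1 / b))" using False by (simp add: field_simps)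
    finally show ?thesis using False by simp
  qed (auto simp: power2_eq_square)
  from this[of "real_of_int (x - y)" "real_of_int (x - z)"] show ?thesis by simp
qed

text \<open>Cotlar's identity: the square of \<open>H f\<close> is \<open>2 H (f H f)\<close> up to terms controlled by an absolutely
  summable kernel.  It gives the \<open>L\<^sup>2\<close> bound and the passage from \<open>L\<^sup>p\<close> to \<open>L\<^sup>2\<^sup>p\<close>.\<close>
lemma hilb_square:
  assumes "finite S"
  shows "(hilb S f x)\<^sup>2 = 2 * hilb S (\<lambda>y. f y * hilb S f y) x + (\<Sum>y\<in>S. (f y)\<^sup>2 / (real_of_int (x - y))\<^sup>2)
    + 2 * (if x \<in> S then f x else 0) * (\<Sum>y\<in>S. f y / (real_of_int (x - y))\<^sup>2)"
proof -
  let ?i = "\<lambda>n. 1 / real_of_int n"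
  have "(hilb S f x)\<^sup>2 = (\<Sum>y\<in>S. \<Sum>z\<in>S. f y * f z * (?i (x - y) * ?i (x - z)))"
    by (simp add: hilb_def power2_eq_square sum_product mult_ac)
  also have "\<dots> = (\<Sum>y\<in>S. \<Sum>z\<in>S. f y * f z * (?i (x - y) * ?i (y - z)))
      + (\<Sum>y\<in>S. \<Sum>z\<in>S. f y * f z * (?i (x - z) * ?i (z - y)))
      + (\<Sum>y\<in>S. \<Sum>z\<in>S. if z = y then f y * f z * (1 / (real_of_int (x - y))\<^sup>2) else 0)
      + (\<Sum>y\<in>S. \<Sum>z\<in>S. if z = x then f y * f z * (1 / (real_of_int (x - y))\<^sup>2) else 0)
      + (\<Sum>y\<in>S. \<Sum>z\<in>S. if x = y then f y * f z * (1 / (real_of_int (x - z))\<^sup>2) else 0)"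
    unfolding sum.distrib[symmetric]
    by (intro sum.cong refl, subst hilbert_partial_fractions) (auto simp: algebra_simps)
  also have "(\<Sum>y\<in>S. \<Sum>z\<in>S. f y * f z * (?i (x - y) * ?i (y - z))) = hilb S (\<lambda>y. f y * hilb S f y) x"
    by (simp add: hilb_def sum_distrib_left sum_divide_distrib mult_ac)
  also have "(\<Sum>y\<in>S. \<Sum>z\<in>S. f y * f z * (?i (x - z) * ?i (z - y))) = hilb S (\<lambda>y. f y * hilb S f y) x"
    by (subst sum.swap) (simp add: hilb_def sum_distrib_left sum_divide_distrib mult_ac)
  also have "(\<Sum>y\<in>S. \<Sum>z\<in>S. if z = y then f y * f z * (1 / (real_of_int (x - y))\<^sup>2) else 0)
      = (\<Sum>y\<in>S. (f y)\<^sup>2 / (real_of_int (x - y))\<^sup>2)"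
    using assms by (simp add: power2_eq_square)
  also have "(\<Sum>y\<in>S. \<Sum>z\<in>S. if z = x then f y * f z * (1 / (real_of_int (x - y))\<^sup>2) else 0)
      = (if x \<in> S then f x else 0) * (\<Sum>y\<in>S. f y / (real_of_int (x - y))\<^sup>2)"
    using assms by (simp add: sum_distrib_left mult_ac)
  also have "(\<Sum>y\<in>S. \<Sum>z\<in>S. if x = y then f y * f z * (1 / (real_of_int (x - z))\<^sup>2) else 0)
      = (if x \<in> S then f x else 0) * (\<Sum>y\<in>S. f y / (real_of_int (x - y))\<^sup>2)"
    using assms by (subst sum.swap) (simp add: sum_distrib_left mult_ac)
  finally show ?thesis by simp
qed

text \<open>At \<open>y = 0\<close> the kernel is odd and the sum vanishes; moving \<open>y\<close>
  by one changes it only by two boundary terms of order \<open>1 / R\<close>. Summed over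
  \<open>x\<close>, the main term of Cotlar's identity is a finite combination of such sums.\<close>

lemma hilbert_kernel_window_sum_tendsto:
  "(\<lambda>R. \<Sum>x\<in>{- int R..int R}. 1 / real_of_int (x - y)) \<longlonglongrightarrow> 0"
proof -
  define E where "E y R = (\<Sum>x\<in>{- int R..int R}. 1 / real_of_int (x - y))" for y R
  have shift: "E (y + 1) R = E y R + (1 / (- real R - 1 - real_of_int y) - 1 / (real R - real_of_int y))" for y R
  proof -
    have "E (y + 1) R = (\<Sum>x\<in>{- int R - 1..int R - 1}. 1 / real_of_int (x - y))"
      unfolding E_def
      by (rule sum.reindex_bij_witness[where i = "\<lambda>x. x + 1" and j = "\<lambda>x. x - 1"]) (auto simp: algebra_simps)
    also have "{- int R - 1..int R - 1} = insert (- int R - 1) ({- int R..int R} - {int R})" by auto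
    also have "(\<Sum>x\<in>\<dots>. 1 / real_of_int (x - y))
        = 1 / (- real R - 1 - real_of_int y) + (E y R - 1 / (real R - real_of_int y))"
      by (subst sum.insert) (auto simp: E_def sum_diff1)
    finally show ?thesis by simp
  qed
  have small: "(\<lambda>R. 1 / (- real R - 1 - real_of_int y) - 1 / (real R - real_of_int y)) \<longlonglongrightarrow> 0" for y
    by real_asymp
  have "E y \<longlonglongrightarrow> 0"
  proof (induction y rule: int_induct[of _ 0])
    case base
    have "E 0 R = - E 0 R" for R
      unfolding E_def sum_negf[symmetric]
      by (rule sum.reindex_bij_witness[where i = uminus and j = uminus]) auto
    then have "E 0 = (\<lambda>R. 0)" by (auto simp: fun_eq_iff)
    then show ?case by simp
  next
    case (step1 i)
    then show ?case using tendsto_add[OF step1(2) small[of i]] by (simp add: shift[abs_def])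
  next
    case (step2 i)
    have "E (i - 1) = (\<lambda>R. E i R - (1 / (- real R - 1 - real_of_int (i - 1)) - 1 / (real R - real_of_int (i - 1))))"
      using shift[of "i - 1"] by (auto simp: fun_eq_iff)
    then show ?case using tendsto_diff[OF step2(2) small[of "i - 1"]] by simp
  qed
  then show ?thesis by (simp add: E_def[abs_def])
qed


text \<open>Cotlar's identity is summed over a growing symmetric window: its main term disappears in
  the limit, and inverse-square sums of mass at most 4 bound the two corrections by 4 and by 2 * 4
  times the right-hand sum.\<close>

lemma hilb_l2:
  assumes fin: "finite X" "finite S"
  shows "(\<Sum>x\<in>X. (hilb S f x)\<^sup>2) \<le> 12 * (\<Sum>y\<in>S. (f y)\<^sup>2)"
proof -
  let ?F = "\<Sum>y\<in>S. (f y)\<^sup>2" and ?Z = "\<lambda>R. {- int R..int R}"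
  define E where "E R = 2 * (\<Sum>y\<in>S. f y * hilb S f y * (\<Sum>x\<in>?Z R. 1 / real_of_int (x - y)))" for R
  obtain R0 where R0: "X \<subseteq> ?Z R0"
  proof (rule that)
    show "X \<subseteq> ?Z (nat (Max (insert 0 (abs ` X))))"
    proof
      fix x assume "x \<in> X"
      then have "\<bar>x\<bar> \<le> Max (insert 0 (abs ` X))" using fin by (intro Max_ge) auto
      then show "x \<in> ?Z (nat (Max (insert 0 (abs ` X))))" by auto
    qed
  qed
  have bound: "(\<Sum>x\<in>X. (hilb S f x)\<^sup>2) \<le> E R + 12 * ?F" if "R0 \<le> R" for R
  proof -
    have "(\<Sum>x\<in>X. (hilb S f x)\<^sup>2) \<le> (\<Sum>x\<in>?Z R. (hilb S f x)\<^sup>2)"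
      using R0 that by (intro sum_mono2) auto
    also have "\<dots> = 2 * (\<Sum>x\<in>?Z R. hilb S (\<lambda>y. f y * hilb S f y) x)
        + (\<Sum>x\<in>?Z R. \<Sum>y\<in>S. (f y)\<^sup>2 / (real_of_int (x - y))\<^sup>2)
        + 2 * (\<Sum>x\<in>?Z R. (if x \<in> S then f x else 0) * (\<Sum>y\<in>S. f y / (real_of_int (x - y))\<^sup>2))"
      by (simp add: hilb_square[OF fin(2)] sum.distrib sum_distrib_left mult_ac)
    also have "2 * (\<Sum>x\<in>?Z R. hilb S (\<lambda>y. f y * hilb S f y) x) = E R"
      unfolding E_def by (subst hilb_def, subst sum.swap) (simp add: sum_distrib_left)
    also have "(\<Sum>x\<in>?Z R. \<Sum>y\<in>S. (f y)\<^sup>2 / (real_of_int (x - y))\<^sup>2) \<le> 4 * ?F"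
    proof -
      have "(\<Sum>x\<in>?Z R. \<Sum>y\<in>S. (f y)\<^sup>2 / (real_of_int (x - y))\<^sup>2)
          = (\<Sum>y\<in>S. (f y)\<^sup>2 * (\<Sum>x\<in>?Z R. 1 / (real_of_int (x - y))\<^sup>2))"
        by (subst sum.swap) (simp add: sum_distrib_left)
      also have "\<dots> \<le> (\<Sum>y\<in>S. (f y)\<^sup>2 * 4)"
        by (intro sum_mono mult_left_mono sum_inverse_squares) auto
      finally show ?thesis by (simp add: sum_distrib_left mult.commute)
    qed
    also have "(\<Sum>x\<in>?Z R. (if x \<in> S then f x else 0) * (\<Sum>y\<in>S. f y / (real_of_int (x - y))\<^sup>2)) \<le> 4 * ?F"
    proof -
      have "(\<Sum>x\<in>?Z R. (if x \<in> S then f x else 0) * (\<Sum>y\<in>S. f y / (real_of_int (x - y))\<^sup>2))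
          \<le> (\<Sum>x\<in>?Z R. if x \<in> S then (\<Sum>y\<in>S. ((f x)\<^sup>2 + (f y)\<^sup>2) / 2 * (1 / (real_of_int (x - y))\<^sup>2)) else 0)"
      proof (rule sum_mono)
        fix x
        show "(if x \<in> S then f x else 0) * (\<Sum>y\<in>S. f y / (real_of_int (x - y))\<^sup>2)
          \<le> (if x \<in> S then (\<Sum>y\<in>S. ((f x)\<^sup>2 + (f y)\<^sup>2) / 2 * (1 / (real_of_int (x - y))\<^sup>2)) else 0)"
        proof (cases "x \<in> S")
          case True
          have "f x * f y * (1 / (real_of_int (x - y))\<^sup>2) \<le> ((f x)\<^sup>2 + (f y)\<^sup>2) / 2 * (1 / (real_of_int (x - y))\<^sup>2)" for y
            using sum_squares_bound[of "f x" "f y"] by (intro mult_right_mono) auto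
          then have "(\<Sum>y\<in>S. f x * f y * (1 / (real_of_int (x - y))\<^sup>2))
            \<le> (\<Sum>y\<in>S. ((f x)\<^sup>2 + (f y)\<^sup>2) / 2 * (1 / (real_of_int (x - y))\<^sup>2))"
            by (rule sum_mono)
          then show ?thesis using True by (simp add: sum_distrib_left)
        qed simp
      qed
      also have "\<dots> = (\<Sum>x\<in>?Z R \<inter> S. \<Sum>y\<in>S. ((f x)\<^sup>2 + (f y)\<^sup>2) / 2 * (1 / (real_of_int (x - y))\<^sup>2))"
        by (rule sum.inter_restrict[symmetric]) simp
      also have "\<dots> \<le> (\<Sum>x\<in>S. \<Sum>y\<in>S. ((f x)\<^sup>2 + (f y)\<^sup>2) / 2 * (1 / (real_of_int (x - y))\<^sup>2))"
        using fin by (intro sum_mono2 sum_nonneg) auto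
      also have "\<dots> = (\<Sum>x\<in>S. \<Sum>y\<in>S. (f x)\<^sup>2 / 2 * (1 / (real_of_int (x - y))\<^sup>2))
          + (\<Sum>x\<in>S. \<Sum>y\<in>S. (f y)\<^sup>2 / 2 * (1 / (real_of_int (x - y))\<^sup>2))"
        unfolding sum.distrib[symmetric] by (intro sum.cong refl) (simp add: add_divide_distrib algebra_simps)
      also have "(\<Sum>x\<in>S. \<Sum>y\<in>S. (f x)\<^sup>2 / 2 * (1 / (real_of_int (x - y))\<^sup>2)) \<le> (\<Sum>x\<in>S. (f x)\<^sup>2 / 2 * 4)"
        unfolding sum_distrib_left[symmetric] using sum_inverse_squares[OF fin(2)]
        by (intro sum_mono mult_left_mono) (auto simp: power2_commute)
      also have "(\<Sum>x\<in>S. \<Sum>y\<in>S. (f y)\<^sup>2 / 2 * (1 / (real_of_int (x - y))\<^sup>2)) \<le> (\<Sum>y\<in>S. (f y)\<^sup>2 / 2 * 4)"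
        by (subst sum.swap, unfold sum_distrib_left[symmetric])
          (intro sum_mono mult_left_mono sum_inverse_squares fin, auto)
      finally show ?thesis by (simp add: sum_distrib_left[symmetric] sum_distrib_right mult.commute)
    qed
    finally show ?thesis by simp
  qed
  have "E \<longlonglongrightarrow> 2 * (\<Sum>y\<in>S. f y * hilb S f y * 0)"
    unfolding E_def by (intro tendsto_intros hilbert_kernel_window_sum_tendsto)
  then have "(\<lambda>R. E R + 12 * ?F) \<longlonglongrightarrow> 12 * ?F"
    by (auto intro: tendsto_eq_intros)
  then show ?thesis
    by (rule LIMSEQ_le_const) (use bound in blast)
qed

section \<open>Bounds on l^p by doubling, interpolation and duality\<close>

definition hilb_bounded :: "real \<Rightarrow> bool" where
  "hilb_bounded p \<longleftrightarrow> (\<exists>A>0. \<forall>X S f. finite X \<longrightarrow> finite S \<longrightarrow>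
    (\<Sum>x\<in>X. \<bar>hilb S f x\<bar> powr p) \<le> A * (\<Sum>y\<in>S. \<bar>f y\<bar> powr p))"

lemma hilb_bounded_2: "hilb_bounded 2"
  unfolding hilb_bounded_def using hilb_l2 by (intro exI[of _ 12]) simp

text \<open>By Cotlar's identity the square of \<open>hilb S f\<close> is controlled in l^p by the
  product \<open>f * hilb S f\<close>. Young's inequality bounds the latter by \<open>f\<close> in
  l^(2p) plus one half of the sum to be estimated, which is absorbed; all sums are finite, so the
  absorption is legitimate.\<close>

lemma hilb_bounded_double:
  assumes "hilb_bounded p" and p: "1 < p"
  shows "hilb_bounded (2 * p)"
proof -
  obtain A where A: "0 < A" "\<forall>X S f. finite X \<longrightarrow> finite S \<longrightarrow>
    (\<Sum>x\<in>X. \<bar>hilb S f x\<bar> powr p) \<le> A * (\<Sum>y\<in>S. \<bar>f y\<bar> powr p)"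
    using assms(1) unfolding hilb_bounded_def by blast
  define D where "D = 6 powr p * A"
  define C where "C = D\<^sup>2 / 2 + 3 powr p * 4 powr p + 6 powr p * (1 + 4 powr (2 * p))"
  have D: "0 < D" using A by (simp add: D_def)
  have sq: "t powr (2 * p) = (t powr p)\<^sup>2" for t :: real
    by (simp add: powr_powr[symmetric] power2_eq_square powr_add[symmetric])
  have sq': "t\<^sup>2 powr p = \<bar>t\<bar> powr (2 * p)" for t :: real
    by (simp add: powr_powr[symmetric])
  have "(\<Sum>x\<in>X. \<bar>hilb S f x\<bar> powr (2 * p)) \<le> 2 * C * (\<Sum>y\<in>S. \<bar>f y\<bar> powr (2 * p))"
    if fin: "finite X" "finite S" for X S f
  proof -
    \<comment> \<open>The argument \<open>f * hilb S f\<close> brings in values of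
      \<open>hilb S f\<close> on \<open>S\<close>. Enlarging \<open>X\<close> by \<open>S\<close>
      makes them part of \<open>?W\<close>, so that they can be absorbed.\<close>
    let ?X = "X \<union> S" and ?F = "\<Sum>y\<in>S. \<bar>f y\<bar> powr (2 * p)"
    let ?H = "hilb S f" and ?G = "\<lambda>x. hilb S (\<lambda>y. f y * hilb S f y) x"
    let ?Q = "\<lambda>x. \<Sum>y\<in>S. (f y)\<^sup>2 / (real_of_int (x - y))\<^sup>2"
    let ?P = "\<lambda>x. \<Sum>y\<in>S. \<bar>f y\<bar> / (real_of_int (x - y))\<^sup>2"
    let ?f = "\<lambda>x. if x \<in> S then \<bar>f x\<bar> else 0"
    let ?W = "\<Sum>x\<in>?X. \<bar>?H x\<bar> powr (2 * p)"
    have finX: "finite ?X" using fin by simp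
    have pw: "\<bar>?H x\<bar> powr (2 * p) \<le> 6 powr p * \<bar>?G x\<bar> powr p + 3 powr p * ?Q x powr p
        + 6 powr p * (?f x powr (2 * p) + ?P x powr (2 * p))" for x
    proof -
      have Q0: "0 \<le> ?Q x" and P0: "0 \<le> ?P x" by (auto intro!: sum_nonneg)
      have "\<bar>2 * (if x \<in> S then f x else 0) * (\<Sum>y\<in>S. f y / (real_of_int (x - y))\<^sup>2)\<bar> \<le> 2 * ?f x * ?P x"
        using sum_abs[of "\<lambda>y. f y / (real_of_int (x - y))\<^sup>2" S] by (auto simp: abs_mult intro!: mult_left_mono)
      then have "(?H x)\<^sup>2 \<le> 2 * \<bar>?G x\<bar> + ?Q x + 2 * ?f x * ?P x"
        unfolding hilb_square[OF fin(2), of f x] by linarith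
      also have "\<dots> \<le> 3 * max (2 * \<bar>?G x\<bar>) (max (?Q x) (2 * ?f x * ?P x))" by linarith
      finally have "(?H x)\<^sup>2 powr p \<le> (3 * max (2 * \<bar>?G x\<bar>) (max (?Q x) (2 * ?f x * ?P x))) powr p"
        by (rule powr_mono2[rotated 2]) (use p in simp_all)
      moreover have "(?H x)\<^sup>2 powr p = \<bar>?H x\<bar> powr (2 * p)"
        by (rule sq')
      ultimately have "\<bar>?H x\<bar> powr (2 * p) \<le> (3 * max (2 * \<bar>?G x\<bar>) (max (?Q x) (2 * ?f x * ?P x))) powr p"
        by (simp only:)
      also have "\<dots> = 3 powr p * max (2 * \<bar>?G x\<bar>) (max (?Q x) (2 * ?f x * ?P x)) powr p"
        by (subst powr_mult) auto
      also have "\<dots> \<le> 3 powr p * ((2 * \<bar>?G x\<bar>) powr p + ?Q x powr p + (2 * ?f x * ?P x) powr p)"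
        by (intro mult_left_mono) (auto simp: max_def)
      also have "(2 * \<bar>?G x\<bar>) powr p = 2 powr p * \<bar>?G x\<bar> powr p" by (simp add: powr_mult)
      also have "(2 * ?f x * ?P x) powr p = 2 powr p * (?f x powr p * ?P x powr p)"
        using P0 by (simp add: powr_mult)
      also have "?f x powr p * ?P x powr p \<le> ?f x powr (2 * p) + ?P x powr (2 * p)"
      proof -
        have "2 * (a * b) \<le> a\<^sup>2 + b\<^sup>2" for a b :: real
          using sum_squares_bound[of a b] by (simp only: mult.assoc)
        then show ?thesis unfolding sq
          by (smt (verit) mult_nonneg_nonneg powr_ge_zero)
      qed
      also have "3 powr p * (2 powr p * \<bar>?G x\<bar> powr p + ?Q x powr p + 2 powr p * (?f x powr (2 * p) + ?P x powr (2 * p)))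
          = (3 powr p * 2 powr p) * \<bar>?G x\<bar> powr p + 3 powr p * ?Q x powr p
            + (3 powr p * 2 powr p) * (?f x powr (2 * p) + ?P x powr (2 * p))"
        by (simp only: distrib_left mult.assoc)
      also have "3 powr p * 2 powr p = (6::real) powr p" by (simp add: powr_mult[symmetric])
      finally show ?thesis by simp
    qed
    have "?W \<le> (\<Sum>x\<in>?X. 6 powr p * \<bar>?G x\<bar> powr p + 3 powr p * ?Q x powr p
        + 6 powr p * (?f x powr (2 * p) + ?P x powr (2 * p)))"
      by (rule sum_mono) (rule pw)
    also have "\<dots> = 6 powr p * (\<Sum>x\<in>?X. \<bar>?G x\<bar> powr p) + 3 powr p * (\<Sum>x\<in>?X. ?Q x powr p)
        + 6 powr p * ((\<Sum>x\<in>?X. ?f x powr (2 * p)) + (\<Sum>x\<in>?X. ?P x powr (2 * p)))"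
      by (simp only: sum.distrib sum_distrib_left distrib_left)
    also have "\<dots> \<le> (D\<^sup>2 / 2 * ?F + ?W / 2) + 3 powr p * (4 powr p * ?F) + 6 powr p * (?F + 4 powr (2 * p) * ?F)"
    proof (intro add_mono mult_left_mono)
      have "(\<Sum>x\<in>?X. \<bar>?G x\<bar> powr p) \<le> A * (\<Sum>y\<in>S. \<bar>f y * ?H y\<bar> powr p)"
        by (rule A(2)[rule_format, OF finX fin(2)])
      then have "6 powr p * (\<Sum>x\<in>?X. \<bar>?G x\<bar> powr p) \<le> 6 powr p * (A * (\<Sum>y\<in>S. \<bar>f y * ?H y\<bar> powr p))"
        by (rule mult_left_mono) simp
      also have "\<dots> = (\<Sum>y\<in>S. D * (\<bar>f y\<bar> powr p * \<bar>?H y\<bar> powr p))"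
        by (simp add: D_def sum_distrib_left abs_mult powr_mult mult_ac)
      also have "\<dots> \<le> (\<Sum>y\<in>S. D\<^sup>2 / 2 * \<bar>f y\<bar> powr (2 * p) + \<bar>?H y\<bar> powr (2 * p) / 2)"
      proof (rule sum_mono)
        fix y
        show "D * (\<bar>f y\<bar> powr p * \<bar>?H y\<bar> powr p) \<le> D\<^sup>2 / 2 * \<bar>f y\<bar> powr (2 * p) + \<bar>?H y\<bar> powr (2 * p) / 2"
          using sum_squares_bound[of "D * \<bar>f y\<bar> powr p" "\<bar>?H y\<bar> powr p"] unfolding sq
          by (simp add: power_mult_distrib algebra_simps)
      qed
      also have "\<dots> = D\<^sup>2 / 2 * ?F + (\<Sum>y\<in>S. \<bar>?H y\<bar> powr (2 * p)) / 2"
        by (simp add: sum.distrib sum_distrib_left sum_divide_distrib)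
      also have "(\<Sum>y\<in>S. \<bar>?H y\<bar> powr (2 * p)) \<le> ?W"
        using fin by (intro sum_mono2) auto
      finally show "6 powr p * (\<Sum>x\<in>?X. \<bar>?G x\<bar> powr p) \<le> D\<^sup>2 / 2 * ?F + ?W / 2" by simp
      show "(\<Sum>x\<in>?X. ?Q x powr p) \<le> 4 powr p * ?F"
      proof -
        have "(\<Sum>x\<in>?X. ?Q x powr p) \<le> 4 powr p * (\<Sum>y\<in>S. (f y)\<^sup>2 powr p)"
          by (rule inverse_square_convolution[OF p finX fin(2)]) simp
        also have "(\<Sum>y\<in>S. (f y)\<^sup>2 powr p) = ?F"
          by (intro sum.cong refl) (simp add: powr_powr[symmetric])
        finally show ?thesis .
      qed
      show "(\<Sum>x\<in>?X. ?P x powr (2 * p)) \<le> 4 powr (2 * p) * ?F"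
        by (rule inverse_square_convolution[OF _ finX fin(2)]) (use p in auto)
      have "(\<Sum>x\<in>?X. ?f x powr (2 * p)) = (\<Sum>x\<in>S. ?f x powr (2 * p))"
        using finX by (intro sum.mono_neutral_right) auto
      then show "(\<Sum>x\<in>?X. ?f x powr (2 * p)) \<le> ?F" by simp
    qed auto
    finally have "?W \<le> ?W / 2 + C * ?F" by (simp add: C_def algebra_simps)
    moreover have "(\<Sum>x\<in>X. \<bar>?H x\<bar> powr (2 * p)) \<le> ?W"
      using fin by (intro sum_mono2) auto
    ultimately show ?thesis by linarith
  qed
  moreover have "0 < C" using D by (auto simp: C_def intro!: add_nonneg_pos mult_pos_pos add_pos_pos add_pos_nonneg)
  ultimately show ?thesis unfolding hilb_bounded_def by (intro exI[of _ "2 * C"]) auto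
qed

lemma hilb_add: "hilb S (\<lambda>y. f y + g y) x = hilb S f x + hilb S g x"
  by (simp add: hilb_def add_divide_distrib sum.distrib)

lemma weak_of_strong:
  fixes u :: "'a \<Rightarrow> real"
  assumes "finite X" "0 < a" "0 < q" "\<And>x. 0 \<le> u x"
  shows "real (card {x\<in>X. a < u x}) \<le> a powr (- q) * (\<Sum>x\<in>X. u x powr q)"
proof -
  have "real (card {x\<in>X. a < u x}) * a powr q = (\<Sum>x\<in>{x\<in>X. a < u x}. a powr q)" by simp
  also have "\<dots> \<le> (\<Sum>x\<in>{x\<in>X. a < u x}. u x powr q)"
    using assms by (intro sum_mono powr_mono2) auto
  also have "\<dots> \<le> (\<Sum>x\<in>X. u x powr q)"
    using assms by (intro sum_mono2) auto
  also have "\<dots> = (a powr (- q) * (\<Sum>x\<in>X. u x powr q)) * a powr q"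
    using assms by (simp add: powr_minus)
  finally show ?thesis using assms by (simp add: mult_le_cancel_right)
qed

lemma hilb_bounded_interpolate:
  assumes "hilb_bounded q0" "hilb_bounded q1" "0 < q0" "q0 < p" "p < q1"
  shows "hilb_bounded p"
proof -
  obtain A0 where A0: "0 < A0" "\<forall>X S f. finite X \<longrightarrow> finite S \<longrightarrow>
    (\<Sum>x\<in>X. \<bar>hilb S f x\<bar> powr q0) \<le> A0 * (\<Sum>y\<in>S. \<bar>f y\<bar> powr q0)"
    using assms(1) unfolding hilb_bounded_def by blast
  obtain A1 where A1: "0 < A1" "\<forall>X S f. finite X \<longrightarrow> finite S \<longrightarrow>
    (\<Sum>x\<in>X. \<bar>hilb S f x\<bar> powr q1) \<le> A1 * (\<Sum>y\<in>S. \<bar>f y\<bar> powr q1)"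
    using assms(2) unfolding hilb_bounded_def by blast
  let ?B0 = "2 powr q0 * A0" and ?B1 = "2 powr q1 * A1"
  let ?D = "2 powr p * (1 / (1 - 2 powr (- (p - q0))) + 1 / (1 - 2 powr (- (q1 - p))))
      * (?B0 * 1 powr (q0 - p) + ?B1 * 1 powr (q1 - p))"
  have "0 < ?D" using assms A0(1) A1(1) powr_less_one[of 2 "- (p - q0)"] powr_less_one[of 2 "- (q1 - p)"]
    by (auto intro!: mult_pos_pos add_pos_pos)
  moreover have "(\<Sum>x\<in>X. \<bar>hilb S f x\<bar> powr p) \<le> ?D * (\<Sum>y\<in>S. \<bar>f y\<bar> powr p)"
    if fin: "finite X" "finite S" for X S f
  proof (rule marcinkiewicz)
    fix \<alpha> :: real assume \<alpha>: "0 < \<alpha>"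
    define fh where "fh y = (if 1 * \<alpha> < \<bar>f y\<bar> then f y else 0)" for y
    define fl where "fl y = (if \<bar>f y\<bar> \<le> 1 * \<alpha> then f y else 0)" for y
    let ?c = "\<lambda>g. real (card {x\<in>X. \<alpha> / 2 < \<bar>hilb S g x\<bar>})"
    have "{x\<in>X. \<alpha> < \<bar>hilb S f x\<bar>} \<subseteq> {x\<in>X. \<alpha> / 2 < \<bar>hilb S fh x\<bar>} \<union> {x\<in>X. \<alpha> / 2 < \<bar>hilb S fl x\<bar>}"
    proof
      fix x assume x: "x \<in> {x\<in>X. \<alpha> < \<bar>hilb S f x\<bar>}"
      have "f = (\<lambda>y. fh y + fl y)" by (auto simp: fh_def fl_def)
      then have "hilb S f x = hilb S fh x + hilb S fl x" using hilb_add by metis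
      then show "x \<in> {x\<in>X. \<alpha> / 2 < \<bar>hilb S fh x\<bar>} \<union> {x\<in>X. \<alpha> / 2 < \<bar>hilb S fl x\<bar>}" using x by auto
    qed
    then have "card {x\<in>X. \<alpha> < \<bar>hilb S f x\<bar>}
        \<le> card ({x\<in>X. \<alpha> / 2 < \<bar>hilb S fh x\<bar>} \<union> {x\<in>X. \<alpha> / 2 < \<bar>hilb S fl x\<bar>})"
      using fin by (intro card_mono) auto
    also have "\<dots> \<le> card {x\<in>X. \<alpha> / 2 < \<bar>hilb S fh x\<bar>} + card {x\<in>X. \<alpha> / 2 < \<bar>hilb S fl x\<bar>}"
      by (rule card_Un_le)
    finally have "real (card {x\<in>X. \<alpha> < \<bar>hilb S f x\<bar>}) \<le> ?c fh + ?c fl" by linarith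
    also have "?c fh \<le> ?B0 * \<alpha> powr (- q0) * (\<Sum>y\<in>{y\<in>S. 1 * \<alpha> < \<bar>f y\<bar>}. \<bar>f y\<bar> powr q0)"
    proof -
      have "?c fh \<le> (\<alpha> / 2) powr (- q0) * (\<Sum>x\<in>X. \<bar>hilb S fh x\<bar> powr q0)"
        using fin \<alpha> assms by (intro weak_of_strong) auto
      also have "\<dots> \<le> (\<alpha> / 2) powr (- q0) * (A0 * (\<Sum>y\<in>S. \<bar>fh y\<bar> powr q0))"
        using A0(2)[rule_format, OF fin] by (intro mult_left_mono) auto
      also have "(\<Sum>y\<in>S. \<bar>fh y\<bar> powr q0) = (\<Sum>y\<in>{y\<in>S. 1 * \<alpha> < \<bar>f y\<bar>}. \<bar>f y\<bar> powr q0)"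
        using fin by (simp add: fh_def sum.inter_filter) (auto intro!: sum.cong)
      also have "(\<alpha> / 2) powr (- q0) = 2 powr q0 * \<alpha> powr (- q0)"
        using \<alpha> by (simp add: powr_divide powr_minus field_simps)
      finally show ?thesis by (simp add: mult_ac)
    qed
    also have "?c fl \<le> ?B1 * \<alpha> powr (- q1) * (\<Sum>y\<in>{y\<in>S. \<bar>f y\<bar> \<le> 1 * \<alpha>}. \<bar>f y\<bar> powr q1)"
    proof -
      have "?c fl \<le> (\<alpha> / 2) powr (- q1) * (\<Sum>x\<in>X. \<bar>hilb S fl x\<bar> powr q1)"
        using fin \<alpha> assms by (intro weak_of_strong) auto
      also have "\<dots> \<le> (\<alpha> / 2) powr (- q1) * (A1 * (\<Sum>y\<in>S. \<bar>fl y\<bar> powr q1))"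
        using A1(2)[rule_format, OF fin] by (intro mult_left_mono) auto
      also have "(\<Sum>y\<in>S. \<bar>fl y\<bar> powr q1) = (\<Sum>y\<in>{y\<in>S. \<bar>f y\<bar> \<le> 1 * \<alpha>}. \<bar>f y\<bar> powr q1)"
        using fin by (simp add: fl_def sum.inter_filter) (auto intro!: sum.cong)
      also have "(\<alpha> / 2) powr (- q1) = 2 powr q1 * \<alpha> powr (- q1)"
        using \<alpha> by (simp add: powr_divide powr_minus field_simps)
      finally show ?thesis by (simp add: mult_ac)
    qed
    finally show "real (card {x\<in>X. \<alpha> < \<bar>hilb S f x\<bar>})
      \<le> ?B0 * \<alpha> powr (- q0) * (\<Sum>y\<in>{y\<in>S. 1 * \<alpha> < \<bar>f y\<bar>}. \<bar>f y\<bar> powr q0)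
        + ?B1 * \<alpha> powr (- q1) * (\<Sum>y\<in>{y\<in>S. \<bar>f y\<bar> \<le> 1 * \<alpha>}. \<bar>f y\<bar> powr q1)"
      by simp
  qed (use fin assms A0(1) A1(1) in auto)
  ultimately show ?thesis unfolding hilb_bounded_def by blast
qed

text \<open>The kernel is odd, so the transpose of \<open>hilb S\<close> evaluated on
  \<open>X\<close> is minus \<open>hilb X\<close> evaluated on \<open>S\<close>. Pairing with the
  extremal function \<open>g\<close> turns the bound at \<open>q\<close> into one at
  \<open>p\<close>.\<close>

lemma hilb_bounded_dual:
  assumes "hilb_bounded q" and pq: "1 < p" "1 < q" "1 / p + 1 / q = 1"
  shows "hilb_bounded p"
proof -
  obtain A where A: "0 < A" "\<forall>X S f. finite X \<longrightarrow> finite S \<longrightarrow>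
    (\<Sum>x\<in>X. \<bar>hilb S f x\<bar> powr q) \<le> A * (\<Sum>y\<in>S. \<bar>f y\<bar> powr q)"
    using assms(1) unfolding hilb_bounded_def by blast
  \<comment> \<open>The weight in Young's inequality is chosen so that the term containing
    \<open>A\<close> returns at most half of the left-hand side.\<close>
  define t where "t = (2 * A) powr (1 / q)"
  have t: "0 < t" "t powr q = 2 * A" using A pq by (auto simp: t_def powr_powr)
  have qp: "(p - 1) * q = p" using pq by (simp add: field_simps)
  have "(\<Sum>x\<in>X. \<bar>hilb S f x\<bar> powr p) \<le> 2 * t powr p * (\<Sum>y\<in>S. \<bar>f y\<bar> powr p)"
    if fin: "finite X" "finite S" for X S f
  proof -
    define g where "g x = sgn (hilb S f x) * \<bar>hilb S f x\<bar> powr (p - 1)" for x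
    let ?G = "\<Sum>x\<in>X. \<bar>hilb S f x\<bar> powr p" and ?F = "\<Sum>y\<in>S. \<bar>f y\<bar> powr p"
    have "?G = (\<Sum>x\<in>X. g x * hilb S f x)"
    proof (rule sum.cong)
      fix x
      have "g x * hilb S f x = \<bar>hilb S f x\<bar> powr (p - 1) * \<bar>hilb S f x\<bar>"
        by (simp add: g_def abs_sgn mult_ac)
      also have "\<dots> = \<bar>hilb S f x\<bar> powr p" by (cases "hilb S f x = 0") (auto simp: powr_diff)
      finally show "\<bar>hilb S f x\<bar> powr p = g x * hilb S f x" by simp
    qed simp
    also have "\<dots> = (\<Sum>y\<in>S. \<Sum>x\<in>X. g x * f y / real_of_int (x - y))"
      unfolding hilb_def sum_distrib_left by (subst sum.swap) simp
    also have "\<dots> = (\<Sum>y\<in>S. - (f y * hilb X g y))"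
      unfolding hilb_def sum_distrib_left sum_negf[symmetric]
      by (intro sum.cong refl) (metis minus_diff_eq of_int_minus minus_divide_right mult.commute times_divide_eq_right)
    also have "\<dots> \<le> (\<Sum>y\<in>S. (t * \<bar>f y\<bar>) powr p / p + (\<bar>hilb X g y\<bar> / t) powr q / q)"
    proof (rule sum_mono)
      fix y
      have "- (f y * hilb X g y) \<le> \<bar>f y * hilb X g y\<bar>" by simp
      also have "\<dots> = (t * \<bar>f y\<bar>) * (\<bar>hilb X g y\<bar> / t)" using t by (simp add: abs_mult)
      also have "\<dots> \<le> (t * \<bar>f y\<bar>) powr p / p + (\<bar>hilb X g y\<bar> / t) powr q / q"
        using t pq by (intro Youngs_inequality) auto
      finally show "- (f y * hilb X g y) \<le> (t * \<bar>f y\<bar>) powr p / p + (\<bar>hilb X g y\<bar> / t) powr q / q" .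
    qed
    also have "\<dots> = t powr p * ?F / p + (\<Sum>y\<in>S. \<bar>hilb X g y\<bar> powr q) / (t powr q * q)"
      using t by (simp add: sum.distrib powr_mult powr_divide sum_distrib_left sum_divide_distrib)
    also have "(\<Sum>y\<in>S. \<bar>hilb X g y\<bar> powr q) / (t powr q * q) \<le> A * ?G / (t powr q * q)"
    proof (rule divide_right_mono)
      have "(\<Sum>y\<in>S. \<bar>hilb X g y\<bar> powr q) \<le> A * (\<Sum>x\<in>X. \<bar>g x\<bar> powr q)"
        by (rule A(2)[rule_format, OF fin(2,1)])
      also have "(\<Sum>x\<in>X. \<bar>g x\<bar> powr q) = ?G"
        by (intro sum.cong refl) (auto simp: g_def abs_mult abs_sgn_eq powr_powr qp)
      finally show "(\<Sum>y\<in>S. \<bar>hilb X g y\<bar> powr q) \<le> A * ?G" .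
    qed (use t(1) pq in auto)
    also have "A * ?G / (t powr q * q) = ?G / (2 * q)" using A t by simp
    also have "t powr p * ?F / p + ?G / (2 * q) \<le> t powr p * ?F + ?G / 2"
    proof -
      have "u / r \<le> u" if "0 \<le> u" "1 < r" for u r :: real
        using that mult_left_mono[of 1 r u] by (simp add: divide_le_eq)
      then have "t powr p * ?F / p \<le> t powr p * ?F" "?G / 2 / q \<le> ?G / 2"
        using pq by (auto simp: sum_nonneg)
      then show ?thesis by simp
    qed
    finally show ?thesis by simp
  qed
  then show ?thesis unfolding hilb_bounded_def using t by (intro exI[of _ "2 * t powr p"]) auto
qed

lemma hilb_bounded_gt_1:
  assumes "1 < p"
  shows "hilb_bounded p"
proof -
  have pow: "hilb_bounded (2 ^ Suc n)" for n
  proof (induction n)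
    case (Suc n)
    have "1 < (2::real) ^ Suc n" by (intro one_less_power) auto
    from hilb_bounded_double[OF Suc this] show ?case by simp
  qed (simp add: hilb_bounded_2)
  have large: "hilb_bounded p" if p: "2 < p" for p
  proof -
    obtain n where n: "p < 2 ^ n" using real_arch_pow[of 2 p] by auto
    then have "p < 2 ^ Suc n" by (rule less_le_trans) simp
    from hilb_bounded_interpolate[OF hilb_bounded_2 pow _ p this] show ?thesis by simp
  qed
  consider "p < 2" | "p = 2" | "2 < p" by linarith
  then show ?thesis
  proof cases
    case 1
    show ?thesis
    proof (rule hilb_bounded_dual)
      show "hilb_bounded (p / (p - 1))" using 1 assms by (intro large) (simp add: field_simps)
    qed (use 1 assms in \<open>auto simp: field_simps\<close>)
  qed (use hilb_bounded_2 large in auto)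
qed

section \<open>Truncations of the Hilbert transform\<close>

definition mx :: "(int \<Rightarrow> 'a::real_normed_vector) \<Rightarrow> int \<Rightarrow> real" where
  "mx f x = (SUP N\<in>{1..}. avg N f x)"

lemma avg_le_sum:
  assumes "finite S" "\<And>y. y \<notin> S \<Longrightarrow> f y = 0" "1 \<le> N"
  shows "avg N f x \<le> (\<Sum>y\<in>S. norm (f y))"
proof -
  have "(\<Sum>y\<in>{x - int N..x + int N}. norm (f y)) = (\<Sum>y\<in>{x - int N..x + int N} \<inter> S. norm (f y))"
    using assms by (intro sum.mono_neutral_right) auto
  also have "\<dots> \<le> (\<Sum>y\<in>S. norm (f y))"
    using assms by (intro sum_mono2) auto
  finally have "avg N f x \<le> (\<Sum>y\<in>S. norm (f y)) / N"
    unfolding avg_def by (rule divide_right_mono) simp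
  also have "\<dots> \<le> (\<Sum>y\<in>S. norm (f y))"
    using assms(3) mult_left_mono[of 1 "real N" "\<Sum>y\<in>S. norm (f y)"] by (simp add: divide_le_eq sum_nonneg)
  finally show ?thesis .
qed

lemma bdd_above_avg:
  assumes "finite S" "\<And>y. y \<notin> S \<Longrightarrow> f y = 0"
  shows "bdd_above ((\<lambda>N. avg N f x) ` {1..})"
  using avg_le_sum[OF assms] by (intro bdd_aboveI2[where M = "\<Sum>y\<in>S. norm (f y)"]) auto

lemma avg_le_mx:
  assumes "finite S" "\<And>y. y \<notin> S \<Longrightarrow> f y = 0" "1 \<le> N"
  shows "avg N f x \<le> mx f x"
  unfolding mx_def using assms by (intro cSUP_upper bdd_above_avg[of S]) auto

lemma mx_nonneg:
  assumes "finite S" "\<And>y. y \<notin> S \<Longrightarrow> f y = 0"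
  shows "0 \<le> mx f x"
  using avg_le_mx[of S f 1 x, OF assms] avg_nonneg[of 1 f x] by simp

text \<open>Linearises a supremum at the cost of a factor 2. The factor 2 instead of a small
  additive error keeps the estimate homogeneous; a supremum equal to 0 is attained by any
  index.\<close>

lemma sup_half:
  fixes g :: "'a \<Rightarrow> real"
  assumes "I \<noteq> {}" "bdd_above (g ` I)" "\<And>i. i \<in> I \<Longrightarrow> 0 \<le> g i"
  shows "\<exists>i\<in>I. (SUP i\<in>I. g i) \<le> 2 * g i"
proof (cases "(SUP i\<in>I. g i) \<le> 0")
  case True
  obtain i where "i \<in> I" using assms(1) by blast
  then show ?thesis using True assms(3) by force
next
  case False
  then have "(SUP i\<in>I. g i) / 2 < (SUP i\<in>I. g i)" by simp
  then obtain i where "i \<in> I" "(SUP i\<in>I. g i) / 2 < g i"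
    using less_cSUP_iff[OF assms(1,2)] by blast
  then show ?thesis by (intro bexI[of _ i]) auto
qed

lemma mx_strong:
  fixes p :: real
  assumes "1 < p"
  shows "\<exists>C>0. \<forall>X S (f :: int \<Rightarrow> 'a::real_normed_vector). finite X \<longrightarrow> finite S \<longrightarrow>
    (\<forall>y. y \<notin> S \<longrightarrow> f y = 0) \<longrightarrow> (\<Sum>x\<in>X. mx f x powr p) \<le> C * (\<Sum>y\<in>S. norm (f y) powr p)"
proof -
  from avg_strong_type[OF assms, where 'a = 'a] obtain C where C: "0 < C"
    "\<forall>X Y N (g :: int \<Rightarrow> 'a). finite X \<longrightarrow> finite Y \<longrightarrow>
      (\<forall>x\<in>X. 1 \<le> N x \<and> {x - int (N x)..x + int (N x)} \<subseteq> Y) \<longrightarrow>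
      (\<Sum>x\<in>X. avg (N x) g x powr p) \<le> C * (\<Sum>y\<in>Y. norm (g y) powr p)"
    by (elim exE conjE) (rule that)
  have "(\<Sum>x\<in>X. mx f x powr p) \<le> 2 powr p * C * (\<Sum>y\<in>S. norm (f y) powr p)"
    if fin: "finite X" "finite S" and S: "\<And>y. y \<notin> S \<Longrightarrow> f y = 0" for X S and f :: "int \<Rightarrow> 'a"
  proof -
    have "\<exists>N\<in>{1..}. mx f x \<le> 2 * avg N f x" for x
      unfolding mx_def
      by (rule sup_half[OF _ bdd_above_avg[of S f, OF fin(2) S]]) (auto intro: avg_nonneg)
    then obtain N where N: "\<And>x. 1 \<le> N x" "\<And>x. mx f x \<le> 2 * avg (N x) f x"
      by (metis atLeast_iff)
    let ?Y = "\<Union>x\<in>X. {x - int (N x)..x + int (N x)}"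
    have "(\<Sum>x\<in>X. mx f x powr p) \<le> (\<Sum>x\<in>X. 2 powr p * avg (N x) f x powr p)"
    proof (rule sum_mono)
      fix x
      have "mx f x powr p \<le> (2 * avg (N x) f x) powr p"
        using N assms mx_nonneg[of S f, OF fin(2) S] by (intro powr_mono2) auto
      then show "mx f x powr p \<le> 2 powr p * avg (N x) f x powr p"
        by (simp add: powr_mult avg_nonneg)
    qed
    also have "\<dots> = 2 powr p * (\<Sum>x\<in>X. avg (N x) f x powr p)" by (simp add: sum_distrib_left)
    also have "\<dots> \<le> 2 powr p * (C * (\<Sum>y\<in>?Y. norm (f y) powr p))"
      using fin N by (intro mult_left_mono C(2)[rule_format]) auto
    also have "(\<Sum>y\<in>?Y. norm (f y) powr p) = (\<Sum>y\<in>?Y \<inter> S. norm (f y) powr p)"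
      using fin S by (intro sum.mono_neutral_right) auto
    also have "\<dots> \<le> (\<Sum>y\<in>S. norm (f y) powr p)"
      using fin by (intro sum_mono2) auto
    finally show ?thesis using C by (simp add: mult.assoc)
  qed
  then show ?thesis using C(1) by (intro exI[of _ "2 powr p * C"]) auto
qed

section \<open>The Hilbert kernel smoothed by a tent\<close>

definition tent :: "nat \<Rightarrow> int \<Rightarrow> real" where
  "tent N m = max 0 (real N - \<bar>real_of_int m\<bar>) / (real N)\<^sup>2"

lemma tent_nonneg: "0 \<le> tent N m"
  by (simp add: tent_def)

lemma tent_le: "tent N m \<le> 1 / N"
proof (cases "N = 0")
  case False
  have "max 0 (real N - \<bar>real_of_int m\<bar>) / (real N)\<^sup>2 \<le> real N / (real N)\<^sup>2"
    by (intro divide_right_mono) auto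
  then show ?thesis using False by (simp add: tent_def power2_eq_square)
qed (simp add: tent_def)

lemma tent_outside: "int N \<le> \<bar>m\<bar> \<Longrightarrow> tent N m = 0"
proof -
  assume "int N \<le> \<bar>m\<bar>"
  then have "real N \<le> \<bar>real_of_int m\<bar>" by linarith
  then show ?thesis by (simp add: tent_def)
qed

lemma tent_lipschitz: "\<bar>tent N a - tent N b\<bar> \<le> \<bar>real_of_int (a - b)\<bar> / (real N)\<^sup>2"
proof -
  have "\<bar>tent N a - tent N b\<bar>
      = \<bar>max 0 (real N - \<bar>real_of_int a\<bar>) - max 0 (real N - \<bar>real_of_int b\<bar>)\<bar> / (real N)\<^sup>2"
    by (simp add: tent_def diff_divide_distrib[symmetric])
  also have "\<dots> \<le> \<bar>real_of_int (a - b)\<bar> / (real N)\<^sup>2"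
    by (intro divide_right_mono) auto
  finally show ?thesis .
qed

lemma sum_tent:
  assumes "1 \<le> N"
  shows "(\<Sum>m\<in>{- int N..int N}. tent N m) = 1"
proof -
  have "(\<Sum>m\<in>{- int n..int n}. real n - \<bar>real_of_int m\<bar>) = (real n)\<^sup>2" for n
  proof (induction n)
    case (Suc n)
    have "{- int (Suc n)..int (Suc n)} = insert (int (Suc n)) (insert (- int (Suc n)) {- int n..int n})" by auto
    then have "(\<Sum>m\<in>{- int (Suc n)..int (Suc n)}. real (Suc n) - \<bar>real_of_int m\<bar>)
        = (\<Sum>m\<in>{- int n..int n}. (real n - \<bar>real_of_int m\<bar>) + 1)"
      by (simp add: algebra_simps)
    also have "\<dots> = (real n)\<^sup>2 + (2 * real n + 1)"
      by (simp only: sum.distrib Suc) simp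
    finally show ?case by (simp add: power2_eq_square algebra_simps)
  qed simp
  moreover have "(\<Sum>m\<in>{- int N..int N}. tent N m) = (\<Sum>m\<in>{- int N..int N}. real N - \<bar>real_of_int m\<bar>) / (real N)\<^sup>2"
    unfolding sum_divide_distrib by (intro sum.cong refl) (auto simp: tent_def)
  ultimately show ?thesis using assms by simp
qed

definition smooth_kernel :: "nat \<Rightarrow> int \<Rightarrow> real" where
  "smooth_kernel N n = (\<Sum>m\<in>{- int N..int N}. tent N m / real_of_int (n - m))"

definition kernel_error :: "nat \<Rightarrow> int \<Rightarrow> real" where
  "kernel_error N n = (if \<bar>n\<bar> < int N then 0 else 1 / real_of_int n) - smooth_kernel N n"

text \<open>The tent has mass one, so the error is an average of differences
  \<open>1 / n - 1 / (n - m)\<close> with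
  \<open>\<bar>m\<bar> \<le> N \<le> \<bar>n\<bar> / 2\<close>, each at most
  \<open>2 * N / n^2\<close> in modulus.\<close>

lemma kernel_error_far:
  assumes N: "1 \<le> N" and n: "2 * int N \<le> \<bar>n\<bar>"
  shows "\<bar>kernel_error N n\<bar> \<le> 2 * real N / (real_of_int n)\<^sup>2"
proof -
  have n0: "0 < \<bar>real_of_int n\<bar>" "2 * real N \<le> \<bar>real_of_int n\<bar>" using assms by linarith+
  have "kernel_error N n = 1 / real_of_int n * (\<Sum>m\<in>{- int N..int N}. tent N m) - smooth_kernel N n"
    using assms sum_tent[OF N] by (simp add: kernel_error_def)
  also have "\<dots> = (\<Sum>m\<in>{- int N..int N}. tent N m * (1 / real_of_int n - 1 / real_of_int (n - m)))"
    by (simp add: smooth_kernel_def sum_distrib_left sum_subtractf[symmetric] algebra_simps)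
  also have "\<bar>\<dots>\<bar> \<le> (\<Sum>m\<in>{- int N..int N}. tent N m * (2 * real N / (real_of_int n)\<^sup>2))"
  proof (intro order_trans[OF sum_abs] sum_mono)
    fix m assume m: "m \<in> {- int N..int N}"
    let ?n = "real_of_int n" and ?m = "real_of_int m"
    have mN: "\<bar>?m\<bar> \<le> real N" using m by auto
    have nm: "\<bar>?n\<bar> / 2 \<le> \<bar>?n - ?m\<bar>" using mN n0 by linarith
    have "1 / ?n - 1 / (?n - ?m) = - ?m / (?n * (?n - ?m))"
    proof -
      have "?n \<noteq> 0" "?n - ?m \<noteq> 0" using n0 nm by auto
      then show ?thesis by (simp add: diff_frac_eq)
    qed
    then have "\<bar>1 / ?n - 1 / (?n - ?m)\<bar> = \<bar>?m\<bar> / (\<bar>?n\<bar> * \<bar>?n - ?m\<bar>)"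
      by (simp add: abs_mult)
    also have "\<dots> \<le> real N / (\<bar>?n\<bar> * (\<bar>?n\<bar> / 2))"
      using mN nm n0 by (intro frac_le mult_left_mono mult_pos_pos) auto
    also have "\<dots> = 2 * real N / ?n\<^sup>2" by (simp add: power2_eq_square)
    finally have "\<bar>1 / ?n - 1 / (?n - ?m)\<bar> \<le> 2 * real N / ?n\<^sup>2" .
    from mult_left_mono[OF this tent_nonneg[of N m]] show "\<bar>tent N m * (1 / ?n - 1 / real_of_int (n - m))\<bar> \<le> tent N m * (2 * real N / ?n\<^sup>2)"
      by (simp add: abs_mult tent_nonneg)
  qed
  also have "\<dots> = 2 * real N / (real_of_int n)\<^sup>2"
    by (simp only: sum_distrib_right[symmetric] sum_tent[OF N] mult_1)
  finally show ?thesis .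
qed

text \<open>Averaging the sum with its image under \<open>l\<close> to \<open>- l\<close> replaces
  the tent by an odd difference, and the Lipschitz bound cancels the singularity
  \<open>1 / l\<close>. The \<open>6 * N\<close> remaining terms of size \<open>2 / N^2\<close> give
  \<open>6 / N\<close> after halving; the truncated kernel itself adds \<open>1 / N\<close>.\<close>

lemma kernel_error_near:
  assumes N: "1 \<le> N" and n: "\<bar>n\<bar> < 2 * int N"
  shows "\<bar>kernel_error N n\<bar> \<le> 7 / N"
proof -
  let ?L = "{- (3 * int N)..3 * int N}"
  have "smooth_kernel N n = (\<Sum>l\<in>{n - int N..n + int N}. tent N (n - l) / real_of_int l)"
    unfolding smooth_kernel_def
    by (rule sum.reindex_bij_witness[where i = "\<lambda>l. n - l" and j = "\<lambda>m. n - m"]) auto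
  also have "\<dots> = (\<Sum>l\<in>?L. tent N (n - l) / real_of_int l)"
    using n by (intro sum.mono_neutral_left) (auto intro!: tent_outside)
  finally have 1: "smooth_kernel N n = (\<Sum>l\<in>?L. tent N (n - l) / real_of_int l)" .
  also have "\<dots> = (\<Sum>l\<in>?L. - (tent N (n + l) / real_of_int l))"
    by (rule sum.reindex_bij_witness[where i = uminus and j = uminus]) auto
  finally have 2: "smooth_kernel N n = (\<Sum>l\<in>?L. - (tent N (n + l) / real_of_int l))" .
  have "2 * smooth_kernel N n = (\<Sum>l\<in>?L. tent N (n - l) / real_of_int l) + (\<Sum>l\<in>?L. - (tent N (n + l) / real_of_int l))"
    using 1 2 by linarith
  also have "\<dots> = (\<Sum>l\<in>?L. (tent N (n - l) - tent N (n + l)) / real_of_int l)"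
    by (simp add: sum.distrib[symmetric] diff_divide_distrib)
  also have "\<dots> = (\<Sum>l\<in>?L - {0}. (tent N (n - l) - tent N (n + l)) / real_of_int l)"
    by (rule sum.mono_neutral_right) auto
  also have "\<bar>\<dots>\<bar> \<le> (\<Sum>l\<in>?L - {0}. 2 / (real N)\<^sup>2)"
  proof (intro order_trans[OF sum_abs] sum_mono)
    fix l assume "l \<in> ?L - {0}"
    then have l: "0 < \<bar>real_of_int l\<bar>" by simp
    have "\<bar>tent N (n - l) - tent N (n + l)\<bar> \<le> \<bar>real_of_int ((n - l) - (n + l))\<bar> / (real N)\<^sup>2"
      by (rule tent_lipschitz)
    also have "\<dots> = 2 / (real N)\<^sup>2 * \<bar>real_of_int l\<bar>" by (simp add: abs_if)
    finally show "\<bar>(tent N (n - l) - tent N (n + l)) / real_of_int l\<bar> \<le> 2 / (real N)\<^sup>2"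
      using l by (simp add: abs_divide divide_le_eq)
  qed
  also have "\<dots> = 12 / N"
  proof -
    have "card (?L - {0}) = 6 * N" by (subst card_Diff_subset) auto
    then show ?thesis using N by (simp add: power2_eq_square)
  qed
  finally have "\<bar>smooth_kernel N n\<bar> \<le> 6 / N" by (simp add: abs_mult)
  moreover have "\<bar>if \<bar>n\<bar> < int N then 0 else 1 / real_of_int n\<bar> \<le> 1 / N"
  proof (cases "\<bar>n\<bar> < int N")
    case False
    then have "real N \<le> \<bar>real_of_int n\<bar>" by linarith
    then show ?thesis using False N by (simp add: abs_divide frac_le)
  qed simp
  ultimately have "\<bar>kernel_error N n\<bar> \<le> 1 / N + 6 / N"
    unfolding kernel_error_def by linarith
  then show ?thesis by simp
qed

text \<open>The least admissible \<open>i\<close> carries the whole bound, the other summands being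
  nonnegative. At \<open>i = 1\<close> the near bound \<open>7 / N\<close> is rounded up to
  \<open>8 / N = 32 / 2 * (1 / (2 * N))\<close>, which fixes the constant 32; for larger
  \<open>i\<close> the decay \<open>N / n^2\<close> is of order
  \<open>1 / (4 ^ i * N)\<close>.\<close>

lemma kernel_error_dyadic:
  assumes N: "1 \<le> N" and I: "1 \<le> I" "\<bar>n\<bar> \<le> 2 ^ I * int N"
  shows "\<bar>kernel_error N n\<bar> \<le> (\<Sum>i\<in>{1..I}. 32 / 2 ^ i * ((if \<bar>n\<bar> \<le> 2 ^ i * int N then 1 else 0) / (2 ^ i * real N)))"
proof -
  define i where "i = (LEAST i. 1 \<le> i \<and> \<bar>n\<bar> \<le> 2 ^ i * int N)"
  have i: "1 \<le> i" "\<bar>n\<bar> \<le> 2 ^ i * int N"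
    using LeastI[of "\<lambda>i. 1 \<le> i \<and> \<bar>n\<bar> \<le> 2 ^ i * int N" I] I unfolding i_def by auto
  have iI: "i \<le> I" unfolding i_def using I by (intro Least_le) auto
  have "\<bar>kernel_error N n\<bar> \<le> 32 / 2 ^ i * (1 / (2 ^ i * real N))"
  proof (cases "i = 1")
    case True
    show ?thesis
    proof (cases "\<bar>n\<bar> < 2 * int N")
      case near: True
      have "\<bar>kernel_error N n\<bar> \<le> 7 / N" by (rule kernel_error_near[OF N near])
      also have "\<dots> \<le> 8 / N" by (intro divide_right_mono) auto
      finally show ?thesis using True by simp
    next
      case far: False
      then have eq: "\<bar>real_of_int n\<bar> = 2 * real N" proof -
        have "\<bar>n\<bar> = 2 * int N" using far i True by simp
        then show ?thesis by linarith
      qed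
      have "\<bar>kernel_error N n\<bar> \<le> 2 * real N / (real_of_int n)\<^sup>2" using far by (intro kernel_error_far[OF N]) auto
      also have "(real_of_int n)\<^sup>2 = (2 * real N)\<^sup>2" using eq by (metis power2_abs)
      also have "2 * real N / (2 * real N)\<^sup>2 \<le> 8 / N" using N by (simp add: power2_eq_square field_simps)
      finally show ?thesis using True by simp
    qed
  next
    case False
    then obtain k where k: "i = Suc k" "1 \<le> k" using i(1) by (cases i) auto
    have "\<not> \<bar>n\<bar> \<le> 2 ^ k * int N"
      using not_less_Least[of k "\<lambda>i. 1 \<le> i \<and> \<bar>n\<bar> \<le> 2 ^ i * int N"] k unfolding i_def[symmetric] by auto
    then have "real_of_int (2 ^ k * int N) \<le> real_of_int \<bar>n\<bar>" by linarith
    then have nk: "2 ^ k * real N \<le> \<bar>real_of_int n\<bar>" by simp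
    have "2 * int N \<le> 2 ^ k * int N"
      using k by (intro mult_right_mono) (auto simp: self_le_power)
    then have far: "2 * int N \<le> \<bar>n\<bar>" using \<open>\<not> \<bar>n\<bar> \<le> 2 ^ k * int N\<close> by linarith
    have "\<bar>kernel_error N n\<bar> \<le> 2 * real N / (real_of_int n)\<^sup>2" by (rule kernel_error_far[OF N far])
    also have "\<dots> \<le> 2 * real N / (2 ^ k * real N)\<^sup>2"
    proof (intro divide_left_mono)
      have "(2 ^ k * real N)\<^sup>2 \<le> \<bar>real_of_int n\<bar>\<^sup>2" using nk by (intro power_mono) auto
      then show "(2 ^ k * real N)\<^sup>2 \<le> (real_of_int n)\<^sup>2" by simp
      then show "0 < (real_of_int n)\<^sup>2 * (2 ^ k * real N)\<^sup>2" using N by (intro mult_pos_pos) (auto intro: less_le_trans[rotated])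
    qed (use N in auto)
    also have "\<dots> \<le> 32 / 2 ^ i * (1 / (2 ^ i * real N))"
      using N by (simp add: k power2_eq_square field_simps)
    finally show ?thesis .
  qed
  also have "\<dots> = 32 / 2 ^ i * ((if \<bar>n\<bar> \<le> 2 ^ i * int N then 1 else 0) / (2 ^ i * real N))" using i by simp
  also have "\<dots> \<le> (\<Sum>i\<in>{1..I}. 32 / 2 ^ i * ((if \<bar>n\<bar> \<le> 2 ^ i * int N then 1 else 0) / (2 ^ i * real N)))"
    using i iI by (intro member_le_sum) auto
  finally show ?thesis .
qed

text \<open>A superposition of averages over intervals of radius \<open>2 ^ i * N\<close>, with
  weights \<open>32 / 2 ^ i\<close> of total at most 32.\<close>

lemma kernel_error_bound:
  assumes N: "1 \<le> N" and fin: "finite S" and S: "\<And>y. y \<notin> S \<Longrightarrow> f y = 0"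
  shows "(\<Sum>y\<in>S. norm (f y) * \<bar>kernel_error N (x - y)\<bar>) \<le> 32 * mx f x"
proof -
  obtain I where I: "1 \<le> I" "\<And>y. y \<in> S \<Longrightarrow> \<bar>x - y\<bar> \<le> 2 ^ I * int N"
  proof (rule that)
    let ?m = "nat (Max (insert 1 ((\<lambda>y. \<bar>x - y\<bar>) ` S)))"
    have m1: "1 \<le> Max (insert 1 ((\<lambda>y. \<bar>x - y\<bar>) ` S))" using fin by (intro Max_ge) auto
    then show "1 \<le> ?m" by linarith
    fix y assume "y \<in> S"
    then have "\<bar>x - y\<bar> \<le> Max (insert 1 ((\<lambda>y. \<bar>x - y\<bar>) ` S))" using fin by (intro Max_ge) auto
    also have "\<dots> = int ?m" using m1 by simp
    also have "\<dots> \<le> 2 ^ ?m" using of_nat_less_two_power[of ?m, where 'a = int] by simp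
    also have "\<dots> \<le> 2 ^ ?m * int N" using N by simp
    finally show "\<bar>x - y\<bar> \<le> 2 ^ ?m * int N" .
  qed
  have "(\<Sum>y\<in>S. norm (f y) * \<bar>kernel_error N (x - y)\<bar>)
      \<le> (\<Sum>y\<in>S. norm (f y) * (\<Sum>i\<in>{1..I}. 32 / 2 ^ i * ((if \<bar>x - y\<bar> \<le> 2 ^ i * int N then 1 else 0) / (2 ^ i * real N))))"
    by (intro sum_mono mult_left_mono kernel_error_dyadic[OF N I(1)] I(2)) auto
  also have "\<dots> = (\<Sum>i\<in>{1..I}. 32 / 2 ^ i * ((\<Sum>y\<in>S. if \<bar>x - y\<bar> \<le> 2 ^ i * int N then norm (f y) else 0) / (2 ^ i * real N)))"
    unfolding sum_distrib_left sum_divide_distrib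
    by (subst sum.swap) (intro sum.cong refl, auto)
  also have "\<dots> \<le> (\<Sum>i\<in>{1..I}. 32 / 2 ^ i * mx f x)"
  proof (intro sum_mono mult_left_mono)
    fix i assume "i \<in> {1..I}"
    have "(\<Sum>y\<in>S. if \<bar>x - y\<bar> \<le> 2 ^ i * int N then norm (f y) else 0)
        \<le> (\<Sum>y\<in>{x - int (2 ^ i * N)..x + int (2 ^ i * N)}. norm (f y))"
      using fin by (simp add: sum.inter_filter[symmetric]) (intro sum_mono2, auto simp: abs_le_iff)
    then have "(\<Sum>y\<in>S. if \<bar>x - y\<bar> \<le> 2 ^ i * int N then norm (f y) else 0) / (2 ^ i * real N)
        \<le> avg (2 ^ i * N) f x"
      unfolding avg_def of_nat_mult of_nat_power of_nat_numeral by (intro divide_right_mono) auto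
    also have "\<dots> \<le> mx f x" using N by (intro avg_le_mx[of S f, OF fin S]) auto
    finally show "(\<Sum>y\<in>S. if \<bar>x - y\<bar> \<le> 2 ^ i * int N then norm (f y) else 0) / (2 ^ i * real N) \<le> mx f x" .
  qed auto
  also have "\<dots> = 32 * mx f x * (\<Sum>i\<in>{1..I}. (1/2) ^ i)"
    by (simp add: sum_distrib_left power_divide)
  also have "\<dots> \<le> 32 * mx f x * 1"
  proof (rule mult_left_mono)
    have "(\<Sum>i\<in>{1..I}. (1/2) ^ i) = 1 - (1/2 :: real) ^ I" by (induction I) auto
    then show "(\<Sum>i\<in>{1..I}. (1/2) ^ i) \<le> (1::real)" by simp
  qed (use mx_nonneg[of S f, OF fin S] in auto)
  finally show ?thesis by simp
qed

text \<open>Pairing \<open>n\<close> with \<open>- n\<close> keeps the cancellation; the strict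
  upper bound fits the dyadic ranges \<open>{1..<2 ^ J}\<close> below.\<close>

definition trunc_hilb :: "nat \<Rightarrow> (int \<Rightarrow> 'a::real_normed_field) \<Rightarrow> int \<Rightarrow> 'a" where
  "trunc_hilb N f x = (\<Sum>n\<in>{1..<int N}. (f (x - n) - f (x + n)) / of_int n)"

text \<open>Cotlar's inequality, in the smooth form \<open>\<phi>\<^sub>N * H f = (\<phi>\<^sub>N * h) * f\<close>, where the tent \<open>\<phi>\<^sub>N\<close> averages
  over scale \<open>N\<close> and \<open>\<phi>\<^sub>N * h\<close> is the truncated kernel up to an error dominated by the maximal function.\<close>
lemma cotlar:
  fixes f :: "int \<Rightarrow> real"
  assumes N: "1 \<le> N" and fin: "finite S" and S: "\<And>y. y \<notin> S \<Longrightarrow> f y = 0"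
  shows "\<bar>trunc_hilb N f x\<bar> \<le> \<bar>hilb S f x\<bar> + avg N (hilb S f) x + 32 * mx f x"
proof -
  let ?e = "\<lambda>n. if \<bar>n\<bar> < int N then 1 / real_of_int n else 0"
  define L where "L = (\<Sum>m\<in>{- int N..int N}. tent N m * hilb S f (x - m))"
  have "L = (\<Sum>y\<in>S. f y * smooth_kernel N (x - y))"
    unfolding L_def hilb_def smooth_kernel_def sum_distrib_left
    by (subst sum.swap) (simp add: algebra_simps)
  moreover have "\<bar>L\<bar> \<le> avg N (hilb S f) x"
  proof -
    have "\<bar>L\<bar> \<le> (\<Sum>m\<in>{- int N..int N}. 1 / N * \<bar>hilb S f (x - m)\<bar>)"
      unfolding L_def by (intro order_trans[OF sum_abs] sum_mono)
        (simp only: abs_mult abs_of_nonneg[OF tent_nonneg], intro mult_right_mono tent_le abs_ge_zero)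
    also have "\<dots> = (\<Sum>y\<in>{x - int N..x + int N}. 1 / N * \<bar>hilb S f y\<bar>)"
      by (rule sum.reindex_bij_witness[where i = "\<lambda>y. x - y" and j = "\<lambda>m. x - m"]) auto
    finally show ?thesis by (simp add: avg_def sum_divide_distrib)
  qed
  moreover have "trunc_hilb N f x = (\<Sum>y\<in>S. f y * ?e (x - y))"
  proof -
    have "trunc_hilb N f x = (\<Sum>n\<in>{1..<int N}. f (x - n) / of_int n) + (\<Sum>n\<in>{1..<int N}. f (x + n) / of_int (- n))"
      by (simp add: trunc_hilb_def diff_divide_distrib sum_subtractf sum_negf)
    also have "(\<Sum>n\<in>{1..<int N}. f (x + n) / of_int (- n)) = (\<Sum>n\<in>{- int N<..<0}. f (x - n) / of_int n)"
      by (rule sum.reindex_bij_witness[where i = uminus and j = uminus]) auto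
    also have "(\<Sum>n\<in>{1..<int N}. f (x - n) / of_int n) + \<dots> = (\<Sum>n\<in>{1..<int N} \<union> {- int N<..<0}. f (x - n) / of_int n)"
      by (intro sum.union_disjoint[symmetric]) auto
    also have "\<dots> = (\<Sum>n\<in>{- int N<..<int N}. f (x - n) / of_int n)"
      by (intro sum.mono_neutral_left) auto
    also have "\<dots> = (\<Sum>y\<in>{x - int N<..<x + int N}. f y * ?e (x - y))"
      by (rule sum.reindex_bij_witness[where i = "\<lambda>y. x - y" and j = "\<lambda>m. x - m"]) auto
    also have "\<dots> = (\<Sum>y\<in>{x - int N<..<x + int N} \<inter> S. f y * ?e (x - y))"
      using S by (intro sum.mono_neutral_right) auto
    also have "\<dots> = (\<Sum>y\<in>S. f y * ?e (x - y))"
      using fin by (intro sum.mono_neutral_left) auto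
    finally show ?thesis .
  qed
  moreover have "hilb S f x = (\<Sum>y\<in>S. f y * ?e (x - y)) + (\<Sum>y\<in>S. f y * smooth_kernel N (x - y))
      + (\<Sum>y\<in>S. f y * kernel_error N (x - y))"
    unfolding hilb_def sum.distrib[symmetric]
    by (intro sum.cong refl) (auto simp: kernel_error_def algebra_simps)
  moreover have "\<bar>\<Sum>y\<in>S. f y * kernel_error N (x - y)\<bar> \<le> 32 * mx f x"
    using kernel_error_bound[of N S f x, OF N fin S]
    by (intro order_trans[OF sum_abs]) (simp add: abs_mult)
  ultimately show ?thesis by linarith
qed

lemma trunc_hilb_strong_real:
  assumes p: "1 < p"
  shows "\<exists>C>0. \<forall>X S N (f :: int \<Rightarrow> real). finite X \<longrightarrow> finite S \<longrightarrow> (\<forall>y. y \<notin> S \<longrightarrow> f y = 0) \<longrightarrow> (\<forall>x. 1 \<le> N x) \<longrightarrow>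
    (\<Sum>x\<in>X. \<bar>trunc_hilb (N x) f x\<bar> powr p) \<le> C * (\<Sum>y\<in>S. \<bar>f y\<bar> powr p)"
proof -
  obtain A where A: "0 < A" "\<forall>X S f. finite X \<longrightarrow> finite S \<longrightarrow>
    (\<Sum>x\<in>X. \<bar>hilb S f x\<bar> powr p) \<le> A * (\<Sum>y\<in>S. \<bar>f y\<bar> powr p)"
    using hilb_bounded_gt_1[OF p] unfolding hilb_bounded_def by blast
  from avg_strong_type[OF p, where 'a = real] obtain B where B: "0 < B"
    "\<forall>X Y N (g :: int \<Rightarrow> real). finite X \<longrightarrow> finite Y \<longrightarrow>
      (\<forall>x\<in>X. 1 \<le> N x \<and> {x - int (N x)..x + int (N x)} \<subseteq> Y) \<longrightarrow>
      (\<Sum>x\<in>X. avg (N x) g x powr p) \<le> B * (\<Sum>y\<in>Y. norm (g y) powr p)"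
    by (elim exE conjE) (rule that)
  from mx_strong[OF p, where 'a = real] obtain D where D: "0 < D"
    "\<forall>X S (f :: int \<Rightarrow> real). finite X \<longrightarrow> finite S \<longrightarrow>
    (\<forall>y. y \<notin> S \<longrightarrow> f y = 0) \<longrightarrow> (\<Sum>x\<in>X. mx f x powr p) \<le> D * (\<Sum>y\<in>S. norm (f y) powr p)"
    by (elim exE conjE) (rule that)
  define C where "C = 2 powr p * (2 powr p * (A + B * A) + 32 powr p * D)"
  have "(\<Sum>x\<in>X. \<bar>trunc_hilb (N x) f x\<bar> powr p) \<le> C * (\<Sum>y\<in>S. \<bar>f y\<bar> powr p)"
    if fin: "finite X" "finite S" and S: "\<And>y. y \<notin> S \<Longrightarrow> f y = 0" and N: "\<And>x. 1 \<le> N x"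
    for X S N and f :: "int \<Rightarrow> real"
  proof -
    let ?F = "\<Sum>y\<in>S. \<bar>f y\<bar> powr p" and ?H = "hilb S f"
    \<comment> \<open>Only the values of \<open>hilb S f\<close> on these finitely many points enter
      the averages, and the Hilbert transform is bounded over any finite set with the same
      constant.\<close>
    let ?Y = "\<Union>x\<in>X. {x - int (N x)..x + int (N x)}"
    have finY: "finite ?Y" using fin by auto
    have pw: "\<bar>trunc_hilb (N x) f x\<bar> powr p
        \<le> 2 powr p * (2 powr p * (\<bar>?H x\<bar> powr p + avg (N x) ?H x powr p) + 32 powr p * mx f x powr p)" for x
    proof -
      note m0 = mx_nonneg[of S f x, OF fin(2) S]
      have "\<bar>trunc_hilb (N x) f x\<bar> powr p \<le> ((\<bar>?H x\<bar> + avg (N x) ?H x) + 32 * mx f x) powr p"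
        using cotlar[of "N x" S f x, OF N fin(2) S] p by (intro powr_mono2) auto
      also have "\<dots> \<le> 2 powr p * ((\<bar>?H x\<bar> + avg (N x) ?H x) powr p + (32 * mx f x) powr p)"
        using p m0 by (intro powr_add_le) (auto simp: avg_nonneg)
      also have "\<dots> \<le> 2 powr p * (2 powr p * (\<bar>?H x\<bar> powr p + avg (N x) ?H x powr p) + 32 powr p * mx f x powr p)"
        using p m0 powr_add_le[of "\<bar>?H x\<bar>" "avg (N x) ?H x" p]
        by (intro mult_left_mono add_mono) (auto simp: avg_nonneg powr_mult)
      finally show ?thesis .
    qed
    have "(\<Sum>x\<in>X. \<bar>trunc_hilb (N x) f x\<bar> powr p) \<le> (\<Sum>x\<in>X.
        2 powr p * (2 powr p * (\<bar>?H x\<bar> powr p + avg (N x) ?H x powr p) + 32 powr p * mx f x powr p))"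
      by (rule sum_mono) (rule pw)
    also have "\<dots> = 2 powr p * (2 powr p * ((\<Sum>x\<in>X. \<bar>?H x\<bar> powr p) + (\<Sum>x\<in>X. avg (N x) ?H x powr p))
        + 32 powr p * (\<Sum>x\<in>X. mx f x powr p))"
      by (simp only: sum_distrib_left[symmetric] sum.distrib)
    also have "\<dots> \<le> 2 powr p * (2 powr p * (A * ?F + B * (A * ?F)) + 32 powr p * (D * ?F))"
    proof (intro mult_left_mono add_mono)
      show "(\<Sum>x\<in>X. \<bar>?H x\<bar> powr p) \<le> A * ?F" by (rule A(2)[rule_format, OF fin])
      have "(\<Sum>x\<in>X. avg (N x) ?H x powr p) \<le> B * (\<Sum>y\<in>?Y. norm (?H y) powr p)"
        using fin N by (intro B(2)[rule_format]) auto
      also have "\<dots> \<le> B * (A * ?F)"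
        using A(2)[rule_format, OF finY fin(2), of f] B(1) by (intro mult_left_mono) auto
      finally show "(\<Sum>x\<in>X. avg (N x) ?H x powr p) \<le> B * (A * ?F)" .
      show "(\<Sum>x\<in>X. mx f x powr p) \<le> D * ?F"
        using D(2)[rule_format, OF fin, of f] S by simp
    qed auto
    also have "\<dots> = C * ?F" by (simp add: C_def algebra_simps)
    finally show ?thesis .
  qed
  moreover have "0 < C" using A(1) B(1) D(1) by (auto simp: C_def intro!: mult_pos_pos add_pos_pos)
  ultimately show ?thesis by (intro exI[of _ C]) auto
qed

lemma trunc_hilb_strong:
  assumes p: "1 < p"
  shows "\<exists>C>0. \<forall>X S N (f :: int \<Rightarrow> complex). finite X \<longrightarrow> finite S \<longrightarrow> (\<forall>y. y \<notin> S \<longrightarrow> f y = 0) \<longrightarrow> (\<forall>x. 1 \<le> N x) \<longrightarrow>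
    (\<Sum>x\<in>X. norm (trunc_hilb (N x) f x) powr p) \<le> C * (\<Sum>y\<in>S. norm (f y) powr p)"
proof -
  from trunc_hilb_strong_real[OF p] obtain C where C: "0 < C"
    "\<forall>X S N (f :: int \<Rightarrow> real). finite X \<longrightarrow> finite S \<longrightarrow> (\<forall>y. y \<notin> S \<longrightarrow> f y = 0) \<longrightarrow> (\<forall>x. 1 \<le> N x) \<longrightarrow>
    (\<Sum>x\<in>X. \<bar>trunc_hilb (N x) f x\<bar> powr p) \<le> C * (\<Sum>y\<in>S. \<bar>f y\<bar> powr p)"
    by (elim exE conjE) (rule that)
  have "(\<Sum>x\<in>X. norm (trunc_hilb (N x) f x) powr p) \<le> 2 powr p * (2 * C) * (\<Sum>y\<in>S. norm (f y) powr p)"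
    if fin: "finite X" "finite S" and S: "\<And>y. y \<notin> S \<Longrightarrow> f y = 0" and N: "\<And>x. 1 \<le> N x"
    for X S N and f :: "int \<Rightarrow> complex"
  proof -
    let ?F = "\<Sum>y\<in>S. norm (f y) powr p" and ?R = "\<lambda>y. Re (f y)" and ?I = "\<lambda>y. Im (f y)"
    have Re: "Re (trunc_hilb n f x) = trunc_hilb n ?R x" and Im: "Im (trunc_hilb n f x) = trunc_hilb n ?I x" for n x
      by (simp_all add: trunc_hilb_def)
    have "(\<Sum>x\<in>X. norm (trunc_hilb (N x) f x) powr p)
        \<le> (\<Sum>x\<in>X. 2 powr p * (\<bar>trunc_hilb (N x) ?R x\<bar> powr p + \<bar>trunc_hilb (N x) ?I x\<bar> powr p))"
    proof (rule sum_mono)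
      fix x
      have "norm (trunc_hilb (N x) f x) powr p \<le> (\<bar>trunc_hilb (N x) ?R x\<bar> + \<bar>trunc_hilb (N x) ?I x\<bar>) powr p"
        using cmod_le[of "trunc_hilb (N x) f x"] p unfolding Re Im by (intro powr_mono2) auto
      also have "\<dots> \<le> 2 powr p * (\<bar>trunc_hilb (N x) ?R x\<bar> powr p + \<bar>trunc_hilb (N x) ?I x\<bar> powr p)"
        using p by (intro powr_add_le) auto
      finally show "norm (trunc_hilb (N x) f x) powr p
        \<le> 2 powr p * (\<bar>trunc_hilb (N x) ?R x\<bar> powr p + \<bar>trunc_hilb (N x) ?I x\<bar> powr p)" .
    qed
    also have "\<dots> = 2 powr p * ((\<Sum>x\<in>X. \<bar>trunc_hilb (N x) ?R x\<bar> powr p) + (\<Sum>x\<in>X. \<bar>trunc_hilb (N x) ?I x\<bar> powr p))"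
      by (simp only: sum_distrib_left[symmetric] sum.distrib)
    also have "\<dots> \<le> 2 powr p * (C * ?F + C * ?F)"
    proof (intro mult_left_mono add_mono)
      have "(\<Sum>x\<in>X. \<bar>trunc_hilb (N x) ?R x\<bar> powr p) \<le> C * (\<Sum>y\<in>S. \<bar>?R y\<bar> powr p)"
        using fin S N by (intro C(2)[rule_format]) auto
      also have "\<dots> \<le> C * ?F"
        using C(1) p abs_Re_le_cmod by (intro mult_left_mono sum_mono powr_mono2) auto
      finally show "(\<Sum>x\<in>X. \<bar>trunc_hilb (N x) ?R x\<bar> powr p) \<le> C * ?F" .
      have "(\<Sum>x\<in>X. \<bar>trunc_hilb (N x) ?I x\<bar> powr p) \<le> C * (\<Sum>y\<in>S. \<bar>?I y\<bar> powr p)"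
        using fin S N by (intro C(2)[rule_format]) auto
      also have "\<dots> \<le> C * ?F"
        using C(1) p abs_Im_le_cmod by (intro mult_left_mono sum_mono powr_mono2) auto
      finally show "(\<Sum>x\<in>X. \<bar>trunc_hilb (N x) ?I x\<bar> powr p) \<le> C * ?F" .
    qed auto
    also have "\<dots> = 2 powr p * (2 * C) * ?F" by simp
    finally show ?thesis .
  qed
  then show ?thesis using C(1) by (intro exI[of _ "2 powr p * (2 * C)"]) auto
qed

section \<open>Removing the integer part\<close>

text \<open>The Fejer kernel, of height \<open>M\<close> and mean one. Its expansion is kept as a
  double sum over \<open>a, b < M\<close> instead of being collected by the frequency
  \<open>a - b\<close>, so no triangular coefficients occur.\<close>

definition fejer :: "nat \<Rightarrow> real \<Rightarrow> real" where
  "fejer M u = (cmod (\<Sum>a<M. ee (real a * u)))\<^sup>2 / M"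

lemma fejer_nonneg: "0 \<le> fejer M u"
  by (simp add: fejer_def)

lemma fejer_expand: "complex_of_real (fejer M u) = (\<Sum>a<M. \<Sum>b<M. ee ((real a - real b) * u)) / M"
proof -
  have "complex_of_real ((cmod (\<Sum>a<M. ee (real a * u)))\<^sup>2) = (\<Sum>a<M. \<Sum>b<M. ee (real a * u) * cnj (ee (real b * u)))"
    unfolding complex_norm_square cnj_sum sum_product ..
  also have "\<dots> = (\<Sum>a<M. \<Sum>b<M. ee ((real a - real b) * u))"
    by (simp add: ee_diff left_diff_distrib)
  finally show ?thesis by (simp add: fejer_def)
qed

lemma ee_add_of_int [simp]: "ee (x + of_int k) = ee x"
  by (simp add: ee_add)

lemma fejer_shift: "fejer M (u + of_int k) = fejer M u"
proof -
  have "ee (real a * (u + of_int k)) = ee (real a * u)" for a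
    using ee_add_of_int[of "real a * u" "int a * k"] by (simp add: distrib_left)
  then show ?thesis by (simp add: fejer_def)
qed

lemma ee_geometric_sum: "(\<Sum>a<M. ee (real a * u)) * (1 - ee u) = 1 - ee (real M * u)"
proof (induction M)
  case (Suc M)
  have "ee (real (Suc M) * u) = ee (real M * u) * ee u"
    by (simp add: ee_add[symmetric] algebra_simps)
  moreover have "(\<Sum>a<Suc M. ee (real a * u)) * (1 - ee u)
      = (\<Sum>a<M. ee (real a * u)) * (1 - ee u) + ee (real M * u) * (1 - ee u)"
    by (simp add: distrib_right)
  ultimately show ?case unfolding Suc by (simp add: right_diff_distrib)
qed simp

lemma fejer_upper:
  assumes "0 < \<eta>" "\<eta> \<le> \<bar>u\<bar>" "\<bar>u\<bar> \<le> 1 - \<eta>"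
  shows "fejer M u \<le> 1 / (4 * real M * \<eta>\<^sup>2)"
proof -
  have "2 * \<eta> \<le> sin (pi * \<bar>u\<bar>)" using assms by (intro sin_pi_ge) auto
  moreover have "sin (pi * \<bar>u\<bar>) \<le> \<bar>sin (pi * u)\<bar>" by (cases "0 \<le> u") auto
  ultimately have low: "4 * \<eta> \<le> cmod (1 - ee u)" by (simp add: norm_one_minus_ee)
  have "cmod (\<Sum>a<M. ee (real a * u)) * cmod (1 - ee u) = cmod (1 - ee (real M * u))"
    by (simp add: norm_mult[symmetric] ee_geometric_sum)
  also have "\<dots> \<le> 1 + 1" by (rule order_trans[OF norm_triangle_ineq4]) simp
  finally have "cmod (\<Sum>a<M. ee (real a * u)) * cmod (1 - ee u) \<le> 2" by simp
  moreover have "cmod (\<Sum>a<M. ee (real a * u)) * (4 * \<eta>) \<le> cmod (\<Sum>a<M. ee (real a * u)) * cmod (1 - ee u)"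
    using low by (intro mult_left_mono) auto
  ultimately have "cmod (\<Sum>a<M. ee (real a * u)) \<le> 1 / (2 * \<eta>)"
    using assms by (simp add: field_simps)
  then have "(cmod (\<Sum>a<M. ee (real a * u)))\<^sup>2 \<le> (1 / (2 * \<eta>))\<^sup>2"
    by (intro power_mono) auto
  then have "fejer M u \<le> (1 / (2 * \<eta>))\<^sup>2 / M"
    unfolding fejer_def by (intro divide_right_mono) auto
  then show ?thesis by (simp add: power2_eq_square mult_ac)
qed

text \<open>That close to an integer all the terms have argument at most \<open>pi / 3\<close>,
  hence real part at least 1/2: there is no cancellation.\<close>

lemma fejer_lower:
  assumes "1 \<le> M" "\<bar>u - of_int k\<bar> \<le> 1 / (6 * real M)"
  shows "real M / 4 \<le> fejer M u"
proof -
  define v where "v = u - of_int k"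
  have "1/2 \<le> Re (ee (real a * v))" if "a < M" for a
  proof -
    have "\<bar>2 * pi * (real a * v)\<bar> = 2 * pi * (real a * \<bar>v\<bar>)" by (simp add: abs_mult)
    also have "\<dots> \<le> 2 * pi * (real M * (1 / (6 * real M)))"
      using assms that by (intro mult_left_mono mult_mono) (auto simp: v_def)
    also have "\<dots> = pi / 3" using assms by simp
    finally have "cos (pi / 3) \<le> cos \<bar>2 * pi * (real a * v)\<bar>"
      by (intro cos_monotone_0_pi_le) auto
    then show ?thesis by (simp add: ee_def cos_60)
  qed
  then have "(\<Sum>a<M. 1/2) \<le> (\<Sum>a<M. Re (ee (real a * v)))" by (intro sum_mono) auto
  also have "\<dots> \<le> cmod (\<Sum>a<M. ee (real a * v))"
    unfolding Re_sum[symmetric] by (rule complex_Re_le_cmod)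
  finally have "real M / 2 \<le> cmod (\<Sum>a<M. ee (real a * v))" by simp
  then have "(real M / 2)\<^sup>2 \<le> (cmod (\<Sum>a<M. ee (real a * v)))\<^sup>2" by (intro power_mono) auto
  then have "(real M / 2)\<^sup>2 / M \<le> fejer M v" unfolding fejer_def by (intro divide_right_mono) auto
  moreover have "fejer M v = fejer M u" using fejer_shift[of M v k] by (simp add: v_def)
  ultimately show ?thesis using assms by (simp add: power2_eq_square)
qed

lemma ee_root_sum:
  assumes "1 \<le> M" "a < M" "b < M"
  shows "(\<Sum>r<M. ee (- ((real a - real b) * (real r / real M)))) = (if a = b then of_nat M else 0)"
proof (cases "a = b")
  case False
  define u where "u = - ((real a - real b) / real M)"
  have "u \<noteq> 0" "\<bar>u\<bar> < 1" using False assms by (auto simp: u_def field_simps abs_if)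
  then have "0 < sin (pi * \<bar>u\<bar>)" by (intro sin_gt_zero) (auto simp: mult_less_cancel_left1)
  then have "sin (pi * u) \<noteq> 0" by (cases "0 \<le> u") auto
  then have "1 - ee u \<noteq> 0" using norm_one_minus_ee[of u] by auto
  moreover have "ee (real M * u) = 1"
    using assms ee_of_int[of "int b - int a"] by (simp add: u_def)
  then have "(\<Sum>r<M. ee (real r * u)) * (1 - ee u) = 0" by (simp add: ee_geometric_sum)
  ultimately have "(\<Sum>r<M. ee (real r * u)) = 0" by simp
  moreover have "- ((real a - real b) * (real r / real M)) = real r * u" for r
    by (simp add: u_def)
  ultimately show ?thesis using False by simp
qed simp

text \<open>The \<open>M\<close> equally spaced nodes integrate every frequency
  \<open>\<bar>a - b\<bar> < M\<close> exactly, so a mean over the nodes can replace the convolution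
  integral and all expansions remain finite sums.\<close>

lemma fejer_mean:
  assumes "1 \<le> M"
  shows "(\<Sum>r<M. fejer M (t - real r / real M)) = M"
proof -
  have "complex_of_real (\<Sum>r<M. fejer M (t - real r / real M))
      = (\<Sum>r<M. \<Sum>a<M. \<Sum>b<M. ee ((real a - real b) * t) * ee (- ((real a - real b) * (real r / real M)))) / M"
    by (simp add: fejer_expand sum_divide_distrib[symmetric] ee_add[symmetric] algebra_simps)
  also have "(\<Sum>r<M. \<Sum>a<M. \<Sum>b<M. ee ((real a - real b) * t) * ee (- ((real a - real b) * (real r / real M))))
      = (\<Sum>a<M. \<Sum>b<M. \<Sum>r<M. ee ((real a - real b) * t) * ee (- ((real a - real b) * (real r / real M))))"
    by (subst sum.swap) (intro sum.cong refl sum.swap)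
  also have "\<dots> = (\<Sum>a<M. \<Sum>b<M. if b = a then of_nat M else 0)"
    unfolding sum_distrib_left[symmetric] using assms
    by (intro sum.cong refl) (auto simp only: ee_root_sum lessThan_iff split: if_splits, auto)
  also have "\<dots> = of_nat M * of_nat M" by simp
  finally have "complex_of_real (\<Sum>r<M. fejer M (t - real r / real M)) = complex_of_real (real M)"
    using assms by simp
  then show ?thesis by (simp only: of_real_eq_iff)
qed

text \<open>The bounded periodic function \<open>e(-\<theta>{t})\<close> has a jump at the integers; away from the jump its Fejer
  mean approximates it, and near the jump the second error term is of size at least 2.\<close>
lemma fejer_approximation:
  fixes \<theta> :: real and L :: nat
  assumes \<theta>: "\<bar>\<theta>\<bar> \<le> 1/2" and L: "1 \<le> L"
  shows "\<exists>coef. (\<forall>a b. cmod (coef a b) \<le> 1 / real (L ^ 3)) \<and>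
    (\<forall>t. cmod (ee (- \<theta> * frac t) - (\<Sum>a<L ^ 3. \<Sum>b<L ^ 3. coef a b * ee ((real a - real b) * t)))
      \<le> 19 / L + 8 / L * fejer L t)"
proof -
  \<comment> \<open>The kernel beyond distance \<open>\<eta> = 1 / (6 * L)\<close> costs
    \<open>1 / (2 * M * \<eta>^2)\<close>, which is \<open>18 / L\<close> exactly because
    \<open>M = L ^ 3\<close>; the oscillation within \<open>\<eta>\<close> costs
    \<open>4 * \<eta> \<le> 1 / L\<close>. This \<open>\<eta>\<close> is also the radius on which
    \<open>fejer L\<close> is at least \<open>L / 4\<close>.\<close>
  define M where "M = L ^ 3"
  have M: "1 \<le> M" using L by (simp add: M_def)
  define \<eta> where "\<eta> = 1 / (6 * real L)"
  have \<eta>: "0 < \<eta>" using L by (simp add: \<eta>_def)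
  define coef where "coef a b = (\<Sum>r<M. ee (- ((real a - real b) * (real r / real M))) * ee (- \<theta> * (real r / real M))) / (of_nat M * of_nat M)" for a b :: nat
  define G where "G t = (\<Sum>r<M. of_real (fejer M (t - real r / real M)) * ee (- \<theta> * (real r / real M))) / M" for t
  have coef: "cmod (coef a b) \<le> 1 / real M" for a b
  proof -
    have "cmod (\<Sum>r<M. ee (- ((real a - real b) * (real r / real M))) * ee (- \<theta> * (real r / real M))) \<le> (\<Sum>r<M. 1)"
      by (rule sum_norm_le) (simp add: norm_mult)
    moreover have "cmod (of_nat M * of_nat M) = real M * real M" by (simp add: norm_mult)
    ultimately have "cmod (coef a b) \<le> real M / (real M * real M)"
      unfolding coef_def norm_divide by (simp only: sum_constant card_lessThan mult_1_right divide_right_mono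
          mult_nonneg_nonneg of_nat_0_le_iff)
    then show ?thesis using M by simp
  qed
  have G_eq: "(\<Sum>a<M. \<Sum>b<M. coef a b * ee ((real a - real b) * t)) = G t" for t
  proof -
    have "G t = (\<Sum>r<M. \<Sum>a<M. \<Sum>b<M. ee ((real a - real b) * t) * ee (- ((real a - real b) * (real r / real M)))
        * ee (- \<theta> * (real r / real M))) / (of_nat M * of_nat M)"
    proof -
      have "ee ((real a - real b) * (t - real r / real M))
          = ee ((real a - real b) * t) * ee (- ((real a - real b) * (real r / real M)))" for a b r :: nat
        by (simp add: ee_add[symmetric] right_diff_distrib)
      then show ?thesis unfolding G_def fejer_expand
        by (simp only: sum_distrib_right sum_divide_distrib times_divide_eq_left divide_divide_eq_left)
    qed
    also have "(\<Sum>r<M. \<Sum>a<M. \<Sum>b<M. ee ((real a - real b) * t) * ee (- ((real a - real b) * (real r / real M)))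
        * ee (- \<theta> * (real r / real M)))
      = (\<Sum>a<M. \<Sum>b<M. \<Sum>r<M. ee ((real a - real b) * t) * ee (- ((real a - real b) * (real r / real M)))
        * ee (- \<theta> * (real r / real M)))"
      by (subst sum.swap) (intro sum.cong refl sum.swap)
    finally show ?thesis
      by (simp only: coef_def sum_divide_distrib sum_distrib_right sum_distrib_left) (simp add: mult_ac)
  qed
  have bound: "cmod (ee (- \<theta> * frac t) - G t) \<le> 19 / L + 8 / L * fejer L t" for t
  proof -
    define u where "u = frac t"
    have u: "0 \<le> u" "u < 1" by (auto simp: u_def frac_lt_1)
    have tu: "t = u + of_int \<lfloor>t\<rfloor>" by (simp add: u_def frac_def)
    have fej: "fejer M (t - s) = fejer M (u - s)" for s
      using fejer_shift[of M "u - s" "\<lfloor>t\<rfloor>"] by (subst tu) (simp add: algebra_simps)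
    show ?thesis
    proof (cases "\<eta> \<le> u \<and> u \<le> 1 - \<eta>")
      case True
      have tm: "fejer M (u - real r / real M) * cmod (ee (- \<theta> * u) - ee (- \<theta> * (real r / real M)))
          \<le> 4 * \<eta> * fejer M (u - real r / real M) + 1 / (2 * real M * \<eta>\<^sup>2)" if r: "r < M" for r
      proof -
        let ?s = "real r / real M"
        have s: "0 \<le> ?s" "?s < 1" using r by auto
        show ?thesis
        proof (cases "\<bar>u - ?s\<bar> < \<eta>")
          case close: True
          have "cmod (ee (- \<theta> * u) - ee (- \<theta> * ?s)) \<le> 2 * pi * \<bar>- \<theta> * u - - \<theta> * ?s\<bar>"
            by (rule norm_ee_diff_le)
          also have "\<bar>- \<theta> * u - - \<theta> * ?s\<bar> = \<bar>\<theta>\<bar> * \<bar>u - ?s\<bar>"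
            by (simp add: abs_mult[symmetric] algebra_simps abs_minus_commute)
          also have "2 * pi * (\<bar>\<theta>\<bar> * \<bar>u - ?s\<bar>) \<le> 2 * 4 * (1/2 * \<eta>)"
            using \<theta> close pi_less_4 by (intro mult_mono) auto
          finally have "cmod (ee (- \<theta> * u) - ee (- \<theta> * ?s)) \<le> 4 * \<eta>" by simp
          then have "fejer M (u - ?s) * cmod (ee (- \<theta> * u) - ee (- \<theta> * ?s)) \<le> fejer M (u - ?s) * (4 * \<eta>)"
            by (intro mult_left_mono fejer_nonneg)
          also have "\<dots> = 4 * \<eta> * fejer M (u - ?s)" by (rule mult.commute)
          finally have "fejer M (u - ?s) * cmod (ee (- \<theta> * u) - ee (- \<theta> * ?s)) \<le> 4 * \<eta> * fejer M (u - ?s)" .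
          moreover have "0 \<le> 1 / (2 * real M * \<eta>\<^sup>2)" by simp
          ultimately show ?thesis by linarith
        next
          case far: False
          \<comment> \<open>Since \<open>u\<close> keeps distance \<open>\<eta>\<close> from 0 and
            1, a node at distance at least \<open>\<eta>\<close> is that far from \<open>u\<close>
            modulo 1 as well.\<close>
          have "fejer M (u - ?s) \<le> 1 / (4 * real M * \<eta>\<^sup>2)"
          proof (rule fejer_upper[OF \<eta>])
            show "\<eta> \<le> \<bar>u - ?s\<bar>" using far by simp
            show "\<bar>u - ?s\<bar> \<le> 1 - \<eta>"
              using conjunct1[OF True] conjunct2[OF True] s by linarith
          qed
          moreover have "cmod (ee (- \<theta> * u) - ee (- \<theta> * ?s)) \<le> 2"
            by (rule order_trans[OF norm_triangle_ineq4]) simp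
          ultimately have "fejer M (u - ?s) * cmod (ee (- \<theta> * u) - ee (- \<theta> * ?s)) \<le> 1 / (4 * real M * \<eta>\<^sup>2) * 2"
            by (intro mult_mono fejer_nonneg) auto
          moreover have "0 \<le> 4 * \<eta> * fejer M (u - ?s)" using \<eta> fejer_nonneg by simp
          ultimately show ?thesis by simp
        qed
      qed
      have "ee (- \<theta> * u) = (\<Sum>r<M. of_real (fejer M (t - real r / real M)) * ee (- \<theta> * u)) / M"
        using fejer_mean[OF M, of t] M
        by (simp add: sum_distrib_right[symmetric] of_real_sum[symmetric] del: of_real_sum)
      then have "ee (- \<theta> * u) - G t = (\<Sum>r<M. of_real (fejer M (t - real r / real M)) * ee (- \<theta> * u)) / M - G t"
        by (rule arg_cong[where f = "\<lambda>z. z - G t"])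
      also have "\<dots>
          = (\<Sum>r<M. of_real (fejer M (u - real r / real M)) * (ee (- \<theta> * u) - ee (- \<theta> * (real r / real M)))) / M"
        unfolding G_def fej by (simp only: diff_divide_distrib[symmetric] sum_subtractf[symmetric] right_diff_distrib)
      finally have "ee (- \<theta> * u) - G t
          = (\<Sum>r<M. of_real (fejer M (u - real r / real M)) * (ee (- \<theta> * u) - ee (- \<theta> * (real r / real M)))) / M" .
      then have "cmod (ee (- \<theta> * u) - G t)
          = cmod (\<Sum>r<M. of_real (fejer M (u - real r / real M)) * (ee (- \<theta> * u) - ee (- \<theta> * (real r / real M)))) / M"
        by (simp only: norm_divide norm_of_nat)
      also have "\<dots> \<le> (\<Sum>r<M. 4 * \<eta> * fejer M (u - real r / real M) + 1 / (2 * real M * \<eta>\<^sup>2)) / M"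
      proof (intro divide_right_mono sum_norm_le)
        fix r assume "r \<in> {..<M}"
        then show "cmod (of_real (fejer M (u - real r / real M)) * (ee (- \<theta> * u) - ee (- \<theta> * (real r / real M))))
          \<le> 4 * \<eta> * fejer M (u - real r / real M) + 1 / (2 * real M * \<eta>\<^sup>2)"
          using tm[of r] by (simp only: norm_mult norm_of_real abs_of_nonneg[OF fejer_nonneg]) simp
      qed simp
      also have "\<dots> = 4 * \<eta> + 1 / (2 * real M * \<eta>\<^sup>2)"
        using fejer_mean[OF M, of u] M by (simp add: sum.distrib sum_distrib_left[symmetric] add_divide_distrib)
      also have "\<dots> \<le> 19 / L"
        using L by (simp add: \<eta>_def M_def power2_eq_square power3_eq_cube field_simps)
      also have "\<dots> \<le> 19 / L + 8 / L * fejer L t" using fejer_nonneg by simp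
      finally show ?thesis by (simp add: u_def)
    next
      case False
      have "\<exists>k. \<bar>t - of_int k\<bar> \<le> 1 / (6 * real L)"
      proof (cases "u < \<eta>")
        case True
        then show ?thesis using u tu by (intro exI[of _ "\<lfloor>t\<rfloor>"]) (simp add: \<eta>_def)
      next
        case False2: False
        then show ?thesis using u tu False by (intro exI[of _ "\<lfloor>t\<rfloor> + 1"]) (simp add: \<eta>_def)
      qed
      then have "real L / 4 \<le> fejer L t" using fejer_lower[OF L] by blast
      then have "8 / L * (real L / 4) \<le> 8 / L * fejer L t" by (intro mult_left_mono) auto
      then have "2 \<le> 8 / L * fejer L t" using L by simp
      moreover have "cmod (G t) \<le> 1"
      proof -
        have "cmod (\<Sum>r<M. of_real (fejer M (t - real r / real M)) * ee (- \<theta> * (real r / real M)))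
            \<le> (\<Sum>r<M. fejer M (t - real r / real M))"
          by (rule sum_norm_le) (simp add: norm_mult fejer_nonneg)
        then show ?thesis using M fejer_mean[OF M, of t] by (simp add: G_def norm_divide)
      qed
      then have "cmod (ee (- \<theta> * frac t) - G t) \<le> 1 + 1"
        by (intro order_trans[OF norm_triangle_ineq4] add_mono) auto
      moreover have "0 \<le> 19 / real L" by simp
      ultimately show ?thesis by linarith
    qed
  qed
  show ?thesis
    using coef bound unfolding G_eq[symmetric] M_def by blast
qed

section \<open>Suprema over all scales and frequencies of one level\<close>

definition osc_range :: "real \<Rightarrow> real \<Rightarrow> nat \<Rightarrow> (nat \<times> real) set" where
  "osc_range c e k = {(j, \<mu>). 2 ^ k \<le> \<bar>\<mu>\<bar> * (2 ^ j) powr c \<and> \<bar>\<mu>\<bar> * (2 ^ j) powr c < 2 ^ Suc k \<and> 2 ^ k \<le> (2 ^ j) powr e}"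

definition osc_sup :: "real \<Rightarrow> real \<Rightarrow> nat \<Rightarrow> (int \<Rightarrow> complex) \<Rightarrow> int \<Rightarrow> real" where
  "osc_sup c e k f x = (SUP (j, \<mu>)\<in>osc_range c e k. cmod (osc c j \<mu> f x))"

text \<open>A real supremum over the empty set carries no information; nonnegativity and the choice
  of near-maximisers rest on this.\<close>

lemma osc_range_nonempty:
  assumes "1 \<le> e"
  shows "osc_range c e k \<noteq> {}"
proof -
  have "(2::real) ^ k = (2 ^ k) powr 1" by simp
  also have "\<dots> \<le> (2 ^ k) powr e" using assms by (intro powr_mono) auto
  finally have "(k, 2 ^ k / (2 ^ k) powr c) \<in> osc_range c e k"
    by (simp add: osc_range_def)
  then show ?thesis by blast
qed

lemma norm_osc_le_mx:
  assumes "finite S" "\<And>y. y \<notin> S \<Longrightarrow> f y = 0"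
  shows "cmod (osc c j \<mu> f x) \<le> 2 * mx f x"
  using norm_osc_le_avg[of c j \<mu> f x] avg_le_mx[of S f "2 ^ Suc j" x, OF assms] by simp

lemma bdd_above_osc:
  assumes "finite S" "\<And>y. y \<notin> S \<Longrightarrow> f y = 0"
  shows "bdd_above ((\<lambda>(j, \<mu>). cmod (osc c j \<mu> f x)) ` I)"
  using norm_osc_le_mx[of S f, OF assms] by (intro bdd_aboveI2[where M = "2 * mx f x"]) auto

lemma osc_le_osc_sup:
  assumes "finite S" "\<And>y. y \<notin> S \<Longrightarrow> f y = 0" "(j, \<mu>) \<in> osc_range c e k"
  shows "cmod (osc c j \<mu> f x) \<le> osc_sup c e k f x"
  unfolding osc_sup_def
  using cSUP_upper[OF assms(3) bdd_above_osc[of S f, OF assms(1,2)]] by simp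

lemma osc_sup_nonneg:
  assumes "finite S" "\<And>y. y \<notin> S \<Longrightarrow> f y = 0" "1 \<le> e"
  shows "0 \<le> osc_sup c e k f x"
proof -
  obtain j \<mu> where "(j, \<mu>) \<in> osc_range c e k" using osc_range_nonempty[OF assms(3)] by fast
  from osc_le_osc_sup[of S f, OF assms(1,2) this] show ?thesis by (rule order_trans[OF norm_ge_zero])
qed

text \<open>A near-maximising pair \<open>(j x, \<mu> x)\<close> at each \<open>x\<close> is adapted
  with \<open>K = 2 ^ k\<close>, so the linearised bound applies; its uniformity in these functions
  is what controls the supremum.\<close>

lemma osc_sup_strong:
  assumes c: "1 < c" "c < 2" and e: "1 \<le> e" "e < 2" and p: "1 < p"
  shows "\<exists>C>0. \<exists>\<epsilon>>0. \<forall>X S k f. finite X \<longrightarrow> finite S \<longrightarrow> (\<forall>y. y \<notin> S \<longrightarrow> f y = 0) \<longrightarrow>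
    (\<Sum>x\<in>X. osc_sup c e k f x powr p) \<le> C * 2 powr (- \<epsilon> * real k) * (\<Sum>y\<in>S. cmod (f y) powr p)"
proof -
  from osc_lp[OF c e p] obtain C \<epsilon> where C: "0 < C" "0 < \<epsilon>"
    "\<And>X Y j \<mu> K f. adapted c e K j \<mu> X Y \<Longrightarrow>
    (\<Sum>x\<in>X. norm (osc c (j x) (\<mu> x) f x) powr p) \<le> C * K powr (- \<epsilon>) * (\<Sum>y\<in>Y. norm (f y) powr p)"
    by blast
  have "(\<Sum>x\<in>X. osc_sup c e k f x powr p) \<le> 2 powr p * C * 2 powr (- \<epsilon> * real k) * (\<Sum>y\<in>S. cmod (f y) powr p)"
    if fin: "finite X" "finite S" and S: "\<And>y. y \<notin> S \<Longrightarrow> f y = 0" for X S k and f :: "int \<Rightarrow> complex"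
  proof -
    have "\<exists>i\<in>osc_range c e k. osc_sup c e k f x \<le> 2 * (\<lambda>(j, \<mu>). cmod (osc c j \<mu> f x)) i" for x
      unfolding osc_sup_def
      by (rule sup_half[OF osc_range_nonempty[OF e(1)] bdd_above_osc[of S f, OF fin(2) S]]) auto
    then obtain i where i: "\<And>x. i x \<in> osc_range c e k"
      "\<And>x. osc_sup c e k f x \<le> 2 * (\<lambda>(j, \<mu>). cmod (osc c j \<mu> f x)) (i x)" by metis
    define j where "j x = fst (i x)" for x
    define \<mu> where "\<mu> x = snd (i x)" for x
    have i': "(j x, \<mu> x) \<in> osc_range c e k" "osc_sup c e k f x \<le> 2 * cmod (osc c (j x) (\<mu> x) f x)" for x
      using i[of x] by (simp_all add: j_def \<mu>_def case_prod_beta)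
    let ?Y = "\<Union>x\<in>X. window (j x) x"
    have ad: "adapted c e (2 ^ k) j \<mu> X ?Y"
      using i'(1) fin by (auto simp: adapted_def osc_range_def)
    have "(\<Sum>x\<in>X. osc_sup c e k f x powr p) \<le> (\<Sum>x\<in>X. 2 powr p * cmod (osc c (j x) (\<mu> x) f x) powr p)"
    proof (rule sum_mono)
      fix x
      have "osc_sup c e k f x powr p \<le> (2 * cmod (osc c (j x) (\<mu> x) f x)) powr p"
        using p i'(2) osc_sup_nonneg[of S f, OF fin(2) S e(1)] by (intro powr_mono2) auto
      then show "osc_sup c e k f x powr p \<le> 2 powr p * cmod (osc c (j x) (\<mu> x) f x) powr p"
        by (simp add: powr_mult)
    qed
    also have "\<dots> = 2 powr p * (\<Sum>x\<in>X. cmod (osc c (j x) (\<mu> x) f x) powr p)" by (simp add: sum_distrib_left)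
    also have "\<dots> \<le> 2 powr p * (C * (2 ^ k) powr (- \<epsilon>) * (\<Sum>y\<in>?Y. cmod (f y) powr p))"
      using C(3)[OF ad] by (intro mult_left_mono) auto
    also have "(2 ^ k) powr (- \<epsilon>) = 2 powr (- \<epsilon> * real k)"
      by (simp add: powr_realpow[symmetric] powr_powr mult.commute)
    also have "(\<Sum>y\<in>?Y. cmod (f y) powr p) = (\<Sum>y\<in>?Y \<inter> S. cmod (f y) powr p)"
      using fin S by (intro sum.mono_neutral_right) auto
    also have "\<dots> \<le> (\<Sum>y\<in>S. cmod (f y) powr p)"
      using fin by (intro sum_mono2) auto
    finally show ?thesis using C by (simp add: mult.assoc)
  qed
  then show ?thesis using C(1,2) by (intro exI[of _ "2 powr p * C"] conjI exI[of _ \<epsilon>]) auto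
qed

lemma osc_in_some_range:
  assumes c: "0 \<le> c" and "1 \<le> \<bar>\<mu>\<bar> * (2 ^ j) powr c" "\<bar>\<mu>\<bar> \<le> (2 ^ j) powr (e - c)"
  defines "k \<equiv> nat \<lfloor>log 2 (\<bar>\<mu>\<bar> * (2 ^ j) powr c)\<rfloor>"
  shows "(j, \<mu>) \<in> osc_range c e k"
proof -
  let ?v = "\<bar>\<mu>\<bar> * (2 ^ j) powr c"
  have v: "0 < ?v" "0 \<le> log 2 ?v" using assms(2) by auto
  have k: "real k \<le> log 2 ?v" "log 2 ?v < real k + 1" unfolding k_def using v(2) by linarith+
  have "2 powr real k \<le> ?v" using k(1) v by (simp add: le_log_iff)
  moreover have "?v < 2 powr (real k + 1)" using k(2) v by (simp add: log_less_iff)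
  moreover have "?v \<le> (2 ^ j) powr (e - c) * (2 ^ j) powr c"
    using assms(3) by (intro mult_right_mono) auto
  then have "?v \<le> (2 ^ j) powr e" by (simp add: powr_add[symmetric])
  ultimately show ?thesis
    by (auto simp: osc_range_def powr_realpow powr_add)
qed

section \<open>The floor phase at a single scale\<close>

definition floor_osc :: "real \<Rightarrow> nat \<Rightarrow> real \<Rightarrow> (int \<Rightarrow> complex) \<Rightarrow> int \<Rightarrow> complex" where
  "floor_osc c j \<theta> f x =
    (\<Sum>n\<in>{2 ^ j..<2 ^ Suc j}. f (x - n) * ee (\<theta> * real_of_int \<lfloor>real_of_int n powr c\<rfloor>) / of_int n)"

text \<open>This is \<open>osc\<close> at frequency zero acting on the modulus of \<open>f\<close>,
  so the bound by an average carries over.\<close>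

lemma osc_weighted_sum:
  "(\<Sum>n\<in>{2 ^ j..<2 ^ Suc j}. cmod (f (x - n)) / real_of_int n) \<le> 2 * avg (2 ^ Suc j) f x"
proof -
  have *: "osc c j 0 (\<lambda>y. of_real (cmod (f y))) x
      = of_real (\<Sum>n\<in>{2 ^ j..<2 ^ Suc j}. cmod (f (x - n)) / real_of_int n)" for c
    by (simp add: osc_def)
  have "(\<Sum>n\<in>{2 ^ j..<2 ^ Suc j}. cmod (f (x - n)) / real_of_int n)
      = cmod (osc 0 j 0 (\<lambda>y. of_real (cmod (f y))) x)"
  proof -
    have "0 \<le> (\<Sum>n\<in>{2 ^ j..<2 ^ Suc j}. cmod (f (x - n)) / real_of_int n)"
    proof (intro sum_nonneg divide_nonneg_nonneg)
      fix n :: int assume "n \<in> {2 ^ j..<2 ^ Suc j}"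
      then show "0 \<le> real_of_int n" using zero_less_power[of "2::int" j] by simp
    qed simp
    then show ?thesis using arg_cong[OF *[of 0], of cmod] by (simp only: norm_of_real abs_of_nonneg)
  qed
  also have "\<dots> \<le> 2 * avg (2 ^ Suc j) (\<lambda>y. complex_of_real (cmod (f y))) x" by (rule norm_osc_le_avg)
  also have "avg (2 ^ Suc j) (\<lambda>y. complex_of_real (cmod (f y))) x = avg (2 ^ Suc j) f x"
    by (simp add: avg_def)
  finally show ?thesis .
qed

lemma osc_weighted_sum_mx:
  assumes "finite S" "\<And>y. y \<notin> S \<Longrightarrow> f y = 0"
  shows "(\<Sum>n\<in>{2 ^ j..<2 ^ Suc j}. cmod (f (x - n)) / real_of_int n) \<le> 2 * mx f x"
  using osc_weighted_sum[where f = f and x = x and j = j] avg_le_mx[of S f "2 ^ Suc j" x, OF assms] by simp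

text \<open>Dropping the fractional part moves the phase by at most
  \<open>\<bar>\<theta>\<bar>\<close>, hence each exponential by at most
  \<open>8 * \<bar>\<theta>\<bar>\<close>; the weighted sum of \<open>\<bar>f\<bar>\<close> supplies
  the remaining factor 2.\<close>

lemma floor_osc_small_frequency:
  assumes "finite S" "\<And>y. y \<notin> S \<Longrightarrow> f y = 0"
  shows "cmod (floor_osc c j \<theta> f x) \<le> cmod (osc c j \<theta> f x) + 16 * \<bar>\<theta>\<bar> * mx f x"
proof -
  have "floor_osc c j \<theta> f x - osc c j \<theta> f x = (\<Sum>n\<in>{2 ^ j..<2 ^ Suc j}. f (x - n) *
      (ee (\<theta> * real_of_int \<lfloor>real_of_int n powr c\<rfloor>) - ee (\<theta> * real_of_int n powr c)) / of_int n)"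
    unfolding floor_osc_def osc_def sum_subtractf[symmetric] by (simp add: algebra_simps diff_divide_distrib)
  also have "cmod \<dots> \<le> (\<Sum>n\<in>{2 ^ j..<2 ^ Suc j}. 8 * \<bar>\<theta>\<bar> * (cmod (f (x - n)) / real_of_int n))"
  proof (rule sum_norm_le)
    fix n :: int assume "n \<in> {2 ^ j..<2 ^ Suc j}"
    then have n: "0 < n" using zero_less_power[of "2::int" j] by simp
    have "cmod (ee (\<theta> * real_of_int \<lfloor>real_of_int n powr c\<rfloor>) - ee (\<theta> * real_of_int n powr c))
        \<le> 2 * pi * \<bar>\<theta> * real_of_int \<lfloor>real_of_int n powr c\<rfloor> - \<theta> * real_of_int n powr c\<bar>"
      by (rule norm_ee_diff_le)
    also have "\<bar>\<theta> * real_of_int \<lfloor>real_of_int n powr c\<rfloor> - \<theta> * real_of_int n powr c\<bar>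
        = \<bar>\<theta>\<bar> * \<bar>real_of_int \<lfloor>real_of_int n powr c\<rfloor> - real_of_int n powr c\<bar>"
      by (simp only: abs_mult[symmetric] right_diff_distrib)
    also have "2 * pi * (\<bar>\<theta>\<bar> * \<bar>real_of_int \<lfloor>real_of_int n powr c\<rfloor> - real_of_int n powr c\<bar>) \<le> 2 * 4 * (\<bar>\<theta>\<bar> * 1)"
      using pi_less_4 by (intro mult_mono) (auto, linarith)
    finally have "cmod (ee (\<theta> * real_of_int \<lfloor>real_of_int n powr c\<rfloor>) - ee (\<theta> * real_of_int n powr c)) \<le> 8 * \<bar>\<theta>\<bar>"
      by simp
    then have "cmod (f (x - n)) * cmod (ee (\<theta> * real_of_int \<lfloor>real_of_int n powr c\<rfloor>) - ee (\<theta> * real_of_int n powr c)) / real_of_int n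
      \<le> cmod (f (x - n)) * (8 * \<bar>\<theta>\<bar>) / real_of_int n"
      using n by (intro divide_right_mono mult_left_mono) auto
    then show "cmod (f (x - n) * (ee (\<theta> * real_of_int \<lfloor>real_of_int n powr c\<rfloor>) - ee (\<theta> * real_of_int n powr c)) / of_int n)
      \<le> 8 * \<bar>\<theta>\<bar> * (cmod (f (x - n)) / real_of_int n)"
      using n by (simp add: norm_mult norm_divide mult_ac)
  qed
  also have "\<dots> = 8 * \<bar>\<theta>\<bar> * (\<Sum>n\<in>{2 ^ j..<2 ^ Suc j}. cmod (f (x - n)) / real_of_int n)"
    by (simp only: sum_distrib_left)
  also have "\<dots> \<le> 8 * \<bar>\<theta>\<bar> * (2 * mx f x)"
    using osc_weighted_sum_mx[of S f, OF assms] by (intro mult_left_mono) auto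
  finally have "cmod (floor_osc c j \<theta> f x - osc c j \<theta> f x) \<le> 16 * \<bar>\<theta>\<bar> * mx f x" by simp
  then show ?thesis
    using norm_triangle_ineq[of "floor_osc c j \<theta> f x - osc c j \<theta> f x" "osc c j \<theta> f x"] by simp
qed

text \<open>The level of \<open>\<mu>\<close> is at least \<open>j\<close> by \<open>low\<close> and
  at most \<open>2 * j\<close> because \<open>e < 2\<close>. Adding all these levels gives one bound
  that serves every frequency of the expansion, without locating its level.\<close>

lemma osc_le_sum_osc_sup:
  assumes c: "1 < c" and e: "1 \<le> e" "e < 2" and fin: "finite S" and S: "\<And>y. y \<notin> S \<Longrightarrow> f y = 0"
    and low: "2 ^ j \<le> \<bar>\<mu>\<bar> * (2 ^ j) powr c" and high: "\<bar>\<mu>\<bar> \<le> (2 ^ j) powr (e - c)"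
  shows "cmod (osc c j \<mu> f x) \<le> (\<Sum>k\<in>{j..2 * j}. osc_sup c e k f x)"
proof -
  let ?v = "\<bar>\<mu>\<bar> * (2 ^ j) powr c"
  define k where "k = nat \<lfloor>log 2 ?v\<rfloor>"
  have "1 \<le> ?v" using low by (rule order_trans[rotated]) simp
  then have mem: "(j, \<mu>) \<in> osc_range c e k"
    unfolding k_def using c high by (intro osc_in_some_range) auto
  then have k: "2 ^ k \<le> ?v" "?v < 2 ^ Suc k" "2 ^ k \<le> ((2::real) ^ j) powr e" by (auto simp: osc_range_def)
  have "(2::real) ^ j < 2 ^ Suc k" using low k by linarith
  then have "j \<le> k" by (subst (asm) power_strict_increasing_iff) auto
  moreover have "(2::real) ^ k \<le> 2 ^ (2 * j)"
  proof -
    have "((2::real) ^ j) powr e \<le> (2 ^ j) powr 2" using e by (intro powr_mono) auto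
    also have "((2::real) ^ j) powr 2 = (2 ^ j)\<^sup>2" by (rule powr_numeral) simp
    also have "((2::real) ^ j)\<^sup>2 = 2 ^ (2 * j)" by (simp add: power_mult[symmetric] mult.commute)
    finally show ?thesis using k(3) by linarith
  qed
  then have "k \<le> 2 * j" by (subst (asm) power_increasing_iff) auto
  ultimately have "osc_sup c e k f x \<le> (\<Sum>k\<in>{j..2 * j}. osc_sup c e k f x)"
    using osc_sup_nonneg[of S f, OF fin S e(1)] by (intro member_le_sum) auto
  then show ?thesis using osc_le_osc_sup[of S f, OF fin S mem, of x] by linarith
qed

lemma sum_floor_split:
  fixes g :: "int \<Rightarrow> complex"
  shows "g n * ee (\<theta> * real_of_int \<lfloor>t\<rfloor>) / of_int n
    = g n * ee (\<theta> * t) * (ee (- \<theta> * frac t) - G) / of_int n + g n * ee (\<theta> * t) * G / of_int n"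
proof -
  have "ee (\<theta> * real_of_int \<lfloor>t\<rfloor>) = ee (\<theta> * t) * ee (- \<theta> * frac t)"
    by (simp add: ee_add[symmetric] frac_def algebra_simps)
  then show ?thesis by (simp add: algebra_simps add_divide_distrib[symmetric] diff_divide_distrib)
qed

text \<open>The expansion produces the frequencies \<open>\<theta> + (a - b)\<close>; as
  \<open>\<bar>\<theta>\<bar> \<le> 1/2\<close>, none is smaller than \<open>\<theta>\<close> in
  modulus, so \<open>low\<close> survives, while \<open>high\<close> admits the largest. With
  \<open>M = L ^ 3\<close>, the \<open>M * M\<close> coefficients of size \<open>1 / M\<close>
  account for the factor \<open>L ^ 3\<close>. The pointwise error is nonnegative and expands in
  turn, with frequencies \<open>a - b\<close> acting on \<open>\<bar>f\<bar>\<close>; its diagonal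
  \<open>a = b\<close> does not oscillate and is left to the maximal function.\<close>

lemma floor_osc_large_frequency:
  fixes c e \<theta> :: real
  assumes c: "1 < c" and e: "1 \<le> e" "e < 2" and fin: "finite S" and S: "\<And>y. y \<notin> S \<Longrightarrow> f y = 0"
    and \<theta>: "\<bar>\<theta>\<bar> \<le> 1/2" and L: "1 \<le> L"
    and low: "2 ^ j \<le> \<bar>\<theta>\<bar> * (2 ^ j) powr c" and high: "1/2 + real (L ^ 3) \<le> (2 ^ j) powr (e - c)"
  shows "cmod (floor_osc c j \<theta> f x) \<le> real (L ^ 3) * (\<Sum>k\<in>{j..2 * j}. osc_sup c e k f x)
    + 8 * (\<Sum>k\<in>{j..2 * j}. osc_sup c e k (\<lambda>y. of_real (cmod (f y))) x) + 54 / L * mx f x"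
proof -
  define F where "F = (\<lambda>y. complex_of_real (cmod (f y)))"
  have F: "F y = 0" if "y \<notin> S" for y using S[OF that] by (simp add: F_def)
  define M where "M = L ^ 3"
  let ?J = "{2 ^ j..<2 ^ Suc j} :: int set"
  let ?Q = "\<Sum>k\<in>{j..2 * j}. osc_sup c e k f x" and ?QF = "\<Sum>k\<in>{j..2 * j}. osc_sup c e k F x"
  have LM: "L \<le> M" unfolding M_def using L by (intro self_le_power) auto
  have half: "2 ^ j \<le> \<bar>\<mu>\<bar> * (2 ^ j) powr c" if "\<bar>\<theta>\<bar> \<le> \<bar>\<mu>\<bar>" for \<mu>
    using low that by (rule order_trans[OF _ mult_right_mono]) simp
  have twist: "\<bar>\<theta>\<bar> \<le> \<bar>\<theta> + of_int m\<bar>" if "m \<noteq> 0" for m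
  proof -
    have "1 \<le> \<bar>real_of_int m\<bar>" using that by linarith
    then show ?thesis using \<theta> by linarith
  qed
  have diff: "\<bar>real a - real b\<bar> \<le> real M" if "a < M" "b < M" for a b using that by auto
  have oscf: "cmod (osc c j (\<theta> + (real a - real b)) f x) \<le> ?Q" if ab: "a < M" "b < M" for a b
  proof (rule osc_le_sum_osc_sup[OF c e fin S])
    show "2 ^ j \<le> \<bar>\<theta> + (real a - real b)\<bar> * (2 ^ j) powr c"
      using twist[of "int a - int b"] by (intro half) (cases "a = b", auto)
    have "\<bar>\<theta> + (real a - real b)\<bar> \<le> 1/2 + real (L ^ 3)"
      using \<theta> diff[OF ab] unfolding M_def by linarith
    then show "\<bar>\<theta> + (real a - real b)\<bar> \<le> (2 ^ j) powr (e - c)" using high by linarith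
  qed
  have oscF: "cmod (osc c j (real a - real b) F x) \<le> (if a = b then 2 * mx f x else 0) + ?QF"
    if ab: "a < L" "b < L" for a b
  proof (cases "a = b")
    case True
    have "cmod (osc c j (real a - real b) F x) \<le> 2 * mx F x"
      by (rule norm_osc_le_mx[of S F, OF fin F])
    moreover have "mx F x = mx f x" by (simp add: F_def mx_def avg_def)
    moreover have "0 \<le> ?QF"
      using osc_sup_nonneg[of S F, OF fin F e(1)] by (intro sum_nonneg) auto
    ultimately show ?thesis using True by simp
  next
    case False
    have "1 \<le> \<bar>real_of_int (int a - int b)\<bar>" using False by linarith
    then have big: "\<bar>\<theta>\<bar> \<le> \<bar>real a - real b\<bar>" using \<theta> by simp
    have "cmod (osc c j (real a - real b) F x) \<le> ?QF"
    proof (rule osc_le_sum_osc_sup[OF c e fin F])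
      show "2 ^ j \<le> \<bar>real a - real b\<bar> * (2 ^ j) powr c" by (rule half[OF big])
      have "\<bar>real a - real b\<bar> \<le> real M" using ab LM by (intro diff) auto
      then show "\<bar>real a - real b\<bar> \<le> (2 ^ j) powr (e - c)" using high unfolding M_def by linarith
    qed
    then show ?thesis using False by simp
  qed
  obtain coef where coef: "\<And>a b. cmod (coef a b) \<le> 1 / real M"
    "\<And>t. cmod (ee (- \<theta> * frac t) - (\<Sum>a<M. \<Sum>b<M. coef a b * ee ((real a - real b) * t)))
      \<le> 19 / L + 8 / L * fejer L t"
    using fejer_approximation[OF \<theta> L] unfolding M_def by blast
  define G where "G t = (\<Sum>a<M. \<Sum>b<M. coef a b * ee ((real a - real b) * t))" for t
  define T1 where "T1 = (\<Sum>n\<in>?J. f (x - n) * ee (\<theta> * real_of_int n powr c) * (ee (- \<theta> * frac (real_of_int n powr c)) - G (real_of_int n powr c)) / of_int n)"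
  define T2 where "T2 = (\<Sum>n\<in>?J. f (x - n) * ee (\<theta> * real_of_int n powr c) * G (real_of_int n powr c) / of_int n)"
  have split: "floor_osc c j \<theta> f x = T1 + T2"
    unfolding floor_osc_def T1_def T2_def sum.distrib[symmetric]
    by (intro sum.cong refl) (rule sum_floor_split[where g = "\<lambda>n. f (x - n)"])
  have T2: "cmod T2 \<le> real M * ?Q"
  proof -
    have "T2 = (\<Sum>n\<in>?J. \<Sum>a<M. \<Sum>b<M. coef a b * (f (x - n) * ee ((\<theta> + (real a - real b)) * real_of_int n powr c) / of_int n))"
    proof -
      have "z * ee (\<theta> * t) * (u * ee (d * t)) / w = u * (z * ee ((\<theta> + d) * t) / w)" for z u w :: complex and d t
      proof -
        have "ee ((\<theta> + d) * t) = ee (\<theta> * t) * ee (d * t)" by (simp only: distrib_right ee_add)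
        then show ?thesis unfolding \<open>ee ((\<theta> + d) * t) = ee (\<theta> * t) * ee (d * t)\<close>
          by (simp only: times_divide_eq_right mult_ac)
      qed
      then show ?thesis unfolding T2_def G_def by (simp only: sum_distrib_left sum_divide_distrib)
    qed
    also have "\<dots> = (\<Sum>a<M. \<Sum>b<M. coef a b * osc c j (\<theta> + (real a - real b)) f x)"
      unfolding osc_def sum_distrib_left by (subst sum.swap) (intro sum.cong refl sum.swap)
    also have "cmod \<dots> \<le> (\<Sum>a<M. \<Sum>b<M. 1 / real M * ?Q)"
    proof (intro sum_norm_le)
      fix a b assume "a \<in> {..<M}" "b \<in> {..<M}"
      then show "cmod (coef a b * osc c j (\<theta> + (real a - real b)) f x) \<le> 1 / real M * ?Q"
        unfolding norm_mult by (intro mult_mono coef(1) oscf) auto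
    qed
    also have "\<dots> = real M * ?Q" by simp
    finally show ?thesis .
  qed
  have T1: "cmod T1 \<le> 54 / L * mx f x + 8 * ?QF"
  proof -
    let ?w = "\<lambda>n. cmod (f (x - n)) / real_of_int n"
    have w0: "0 \<le> ?w n" if "n \<in> ?J" for n
      using that zero_less_power[of "2::int" j] by (intro divide_nonneg_nonneg) auto
    have "cmod T1 \<le> (\<Sum>n\<in>?J. ?w n * (19 / L + 8 / L * fejer L (real_of_int n powr c)))"
      unfolding T1_def
    proof (rule sum_norm_le)
      fix n assume n: "n \<in> ?J"
      then have "0 < n" using zero_less_power[of "2::int" j] by simp
      then have "cmod (f (x - n) * ee (\<theta> * real_of_int n powr c) * (ee (- \<theta> * frac (real_of_int n powr c)) - G (real_of_int n powr c)) / of_int n)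
          = ?w n * cmod (ee (- \<theta> * frac (real_of_int n powr c)) - G (real_of_int n powr c))"
        by (simp add: norm_mult norm_divide)
      also have "\<dots> \<le> ?w n * (19 / L + 8 / L * fejer L (real_of_int n powr c))"
        using w0[OF n] coef(2) unfolding G_def by (intro mult_left_mono) auto
      finally show "cmod (f (x - n) * ee (\<theta> * real_of_int n powr c) * (ee (- \<theta> * frac (real_of_int n powr c)) - G (real_of_int n powr c)) / of_int n)
        \<le> ?w n * (19 / L + 8 / L * fejer L (real_of_int n powr c))" .
    qed
    also have "\<dots> = 19 / L * (\<Sum>n\<in>?J. ?w n) + 8 / L * (\<Sum>n\<in>?J. ?w n * fejer L (real_of_int n powr c))"
      by (simp add: sum_distrib_left distrib_left sum.distrib mult_ac)
    also have "\<dots> \<le> 19 / L * (2 * mx f x) + 8 / L * (2 * mx f x + L * ?QF)"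
    proof (intro add_mono mult_left_mono)
      show "(\<Sum>n\<in>?J. ?w n) \<le> 2 * mx f x" by (rule osc_weighted_sum_mx[of S f, OF fin S])
      have "complex_of_real (\<Sum>n\<in>?J. ?w n * fejer L (real_of_int n powr c))
          = (\<Sum>n\<in>?J. \<Sum>a<L. \<Sum>b<L. F (x - n) * ee ((real a - real b) * real_of_int n powr c) / of_int n) / L"
        by (simp add: fejer_expand F_def sum_distrib_left sum_divide_distrib mult_ac)
      also have "(\<Sum>n\<in>?J. \<Sum>a<L. \<Sum>b<L. F (x - n) * ee ((real a - real b) * real_of_int n powr c) / of_int n)
          = (\<Sum>a<L. \<Sum>b<L. osc c j (real a - real b) F x)"
        unfolding osc_def by (subst sum.swap) (intro sum.cong refl sum.swap)
      finally have "cmod (complex_of_real (\<Sum>n\<in>?J. ?w n * fejer L (real_of_int n powr c)))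
          = cmod (\<Sum>a<L. \<Sum>b<L. osc c j (real a - real b) F x) / L"
        by (simp add: norm_divide)
      moreover have "cmod (\<Sum>a<L. \<Sum>b<L. osc c j (real a - real b) F x)
          \<le> (\<Sum>a<L. \<Sum>b<L. (if a = b then 2 * mx f x else 0) + ?QF)"
        using oscF by (intro sum_norm_le) (auto intro!: sum_norm_le)
      moreover have "(\<Sum>a<L. \<Sum>b<L. (if a = b then 2 * mx f x else 0) + ?QF) = real L * (2 * mx f x + L * ?QF)"
        by (simp add: sum.distrib distrib_left)
      ultimately have "cmod (complex_of_real (\<Sum>n\<in>?J. ?w n * fejer L (real_of_int n powr c))) \<le> 2 * mx f x + L * ?QF"
        using L by (simp add: divide_le_eq mult.commute)
      then show "(\<Sum>n\<in>?J. ?w n * fejer L (real_of_int n powr c)) \<le> 2 * mx f x + L * ?QF"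
        unfolding norm_of_real by linarith
    qed auto
    \<comment> \<open>Here \<open>54 = 2 * 19 + 2 * 8\<close>: the constant part of the error and
      the diagonal of the kernel.\<close>
    also have "\<dots> = 54 / L * mx f x + 8 * ?QF" using L by (simp add: field_simps)
    finally show ?thesis .
  qed
  have "cmod (floor_osc c j \<theta> f x) \<le> real M * ?Q + 8 * ?QF + 54 / L * mx f x"
    using norm_triangle_ineq[of T1 T2] T1 T2 unfolding split by linarith
  then show ?thesis by (simp only: M_def F_def)
qed


text \<open>The frequencies \<open>\<theta>\<close> above \<open>2 powr (- \<epsilon> j)\<close> at scale \<open>2 ^ j\<close> need the Fejer expansion of the
  floor; below that threshold the floor is removed at the cost of a summable error.\<close>
lemma floor_osc_bound:
  fixes c \<epsilon> \<theta> :: real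
  assumes c: "1 < c" "c < 2" and \<epsilon>: "0 < \<epsilon>" "\<epsilon> \<le> c - 1" "7 * \<epsilon> \<le> 1 - c / 2"
    and fin: "finite S" and S: "\<And>y. y \<notin> S \<Longrightarrow> f y = 0"
    and \<theta>: "\<bar>\<theta>\<bar> \<le> 1/2" and one: "1 \<le> \<bar>\<theta>\<bar> * (2 ^ j) powr c"
  defines "e \<equiv> 1 + c / 2" and "k0 \<equiv> nat \<lfloor>log 2 (\<bar>\<theta>\<bar> * (2 ^ j) powr c)\<rfloor>"
  shows "cmod (floor_osc c j \<theta> f x) \<le> osc_sup c e k0 f x
    + 2 powr (6 * \<epsilon> * j) * (\<Sum>k\<in>{j..2 * j}. osc_sup c e k f x + osc_sup c e k (\<lambda>y. of_real (cmod (f y))) x)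
    + 54 * 2 powr (- \<epsilon> * j) * mx f x"
proof -
  define F where "F = (\<lambda>y. complex_of_real (cmod (f y)))"
  have F: "F y = 0" if "y \<notin> S" for y using S[OF that] by (simp add: F_def)
  \<comment> \<open>\<open>e\<close> is the midpoint of \<open>c\<close> and 2, so it leaves the
    margin \<open>1 - c / 2\<close> on both sides: for extra frequencies above \<open>c\<close>, and
    for decay below 2.\<close>
  have e: "1 \<le> e" "e < 2" "e - c = 1 - c / 2" using c by (auto simp: e_def)
  have sup0: "0 \<le> osc_sup c e k f x" "0 \<le> osc_sup c e k F x" for k
    using osc_sup_nonneg[of S f, OF fin S e(1)] osc_sup_nonneg[of S F, OF fin F e(1)] by auto
  have mx0: "0 \<le> mx f x" by (rule mx_nonneg[of S f, OF fin S])
  let ?Q = "\<Sum>k\<in>{j..2 * j}. osc_sup c e k f x" and ?QF = "\<Sum>k\<in>{j..2 * j}. osc_sup c e k F x"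
  have Q0: "0 \<le> ?Q" "0 \<le> ?QF" using sup0 by (auto intro!: sum_nonneg)
  have pj: "((2::real) ^ j) powr a = 2 powr (a * j)" for a
    by (simp add: powr_realpow[symmetric] powr_powr mult.commute)
  have "cmod (floor_osc c j \<theta> f x) \<le> osc_sup c e k0 f x + 2 powr (6 * \<epsilon> * j) * (?Q + ?QF)
      + 54 * 2 powr (- \<epsilon> * j) * mx f x"
  proof (cases "\<bar>\<theta>\<bar> \<le> 2 powr (- \<epsilon> * j)")
    case True
    have "\<bar>\<theta>\<bar> \<le> 1" using \<theta> by simp
    also have "1 \<le> ((2::real) ^ j) powr (e - c)" using e c by (intro ge_one_powr_ge_zero) auto
    finally have "(j, \<theta>) \<in> osc_range c e k0"
      unfolding k0_def using c one by (intro osc_in_some_range) auto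
    from osc_le_osc_sup[of S f, OF fin S this]
    have "cmod (osc c j \<theta> f x) \<le> osc_sup c e k0 f x" .
    moreover have "16 * \<bar>\<theta>\<bar> * mx f x \<le> 54 * 2 powr (- \<epsilon> * j) * mx f x"
      using True mx0 by (intro mult_right_mono) auto
    moreover have "0 \<le> 2 powr (6 * \<epsilon> * j) * (?Q + ?QF)" using Q0 by simp
    ultimately show ?thesis
      using floor_osc_small_frequency[of S f c j \<theta> x, OF fin S] by linarith
  next
    case False
    \<comment> \<open>The case assumption and \<open>\<bar>\<theta>\<bar> \<le> 1/2\<close> force
      \<open>t > 2\<close>, so rounding up still gives \<open>L \<le> t^2\<close>, and the
      \<open>L ^ 3\<close> frequencies cost at most
      \<open>t ^ 6 = 2 powr (6 * \<epsilon> * j)\<close>.\<close>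
    define t where "t = 2 powr (\<epsilon> * j)"
    define L where "L = nat \<lceil>t\<rceil>"
    have inv: "2 powr (- \<epsilon> * j) = 1 / t" by (simp add: t_def powr_minus divide_inverse)
    have t0: "0 < t" by (simp add: t_def)
    have t2: "2 < t"
    proof -
      have "1 < t * \<bar>\<theta>\<bar>" using False t0 unfolding inv by (simp add: field_simps not_le)
      moreover have "t * \<bar>\<theta>\<bar> \<le> t * (1/2)" using \<theta> t0 by (intro mult_left_mono) auto
      ultimately show ?thesis by linarith
    qed
    have Lt: "t \<le> real L" "real L \<le> t + 1" unfolding L_def using t0 by linarith+
    have L1: "1 \<le> L" using Lt t2 by linarith
    have "real L \<le> t\<^sup>2" 
    proof -
      have "2 * t \<le> t * t" using t2 by (intro mult_right_mono) auto
      then show ?thesis unfolding power2_eq_square using Lt t2 by linarith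
    qed
    then have "real L ^ 3 \<le> (t\<^sup>2) ^ 3" by (intro power_mono) auto
    then have L3: "real (L ^ 3) \<le> t ^ 6" by (simp add: power_mult[symmetric])
    have t6: "t ^ 6 = 2 powr (6 * \<epsilon> * j)" "t ^ 7 = 2 powr (7 * \<epsilon> * j)"
      using t0 unfolding t_def by (simp_all add: powr_realpow[symmetric] powr_powr mult_ac)
    have one6: "1 \<le> t ^ 6" using t2 by (intro one_le_power) auto
    have eight: "8 \<le> t ^ 6"
    proof -
      have "(2::real) ^ 6 \<le> t ^ 6" using t2 by (intro power_mono) auto
      then show ?thesis by simp
    qed
    \<comment> \<open>A seventh factor \<open>t\<close> absorbs the constants; this is the origin of
      the condition \<open>7 * \<epsilon> \<le> 1 - c / 2\<close>.\<close>
    have high: "1/2 + real (L ^ 3) \<le> (2 ^ j) powr (e - c)"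
    proof -
      have "1/2 + real (L ^ 3) \<le> t ^ 6 + t ^ 6" using L3 one6 by linarith
      also have "\<dots> \<le> t * t ^ 6" using t2 mult_right_mono[of 2 t "t ^ 6"] by simp
      also have "\<dots> = t ^ 7" by (simp add: eval_nat_numeral)
      also have "\<dots> \<le> (2 ^ j) powr (e - c)"
        unfolding t6 pj e(3) using \<epsilon> by (intro powr_mono mult_right_mono) auto
      finally show ?thesis .
    qed
    \<comment> \<open>Since \<open>\<epsilon> \<le> c - 1\<close>, a frequency above
      \<open>2 powr (- \<epsilon> * j)\<close> still has level at least \<open>j\<close>.\<close>
    have low: "2 ^ j \<le> \<bar>\<theta>\<bar> * (2 ^ j) powr c"
    proof -
      have "(2::real) ^ j = (2 ^ j) powr 1" by simp
      also have "\<dots> \<le> (2 ^ j) powr (c - \<epsilon>)" using \<epsilon> by (intro powr_mono) auto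
      also have "\<dots> = 2 powr (- \<epsilon> * j) * (2 ^ j) powr c"
        unfolding pj by (simp add: powr_add[symmetric] algebra_simps)
      also have "\<dots> \<le> \<bar>\<theta>\<bar> * (2 ^ j) powr c" using False by (intro mult_right_mono) auto
      finally show ?thesis .
    qed
    have "cmod (floor_osc c j \<theta> f x) \<le> real (L ^ 3) * ?Q + 8 * ?QF + 54 / L * mx f x"
      unfolding F_def by (rule floor_osc_large_frequency[of c e S f \<theta> L j x, OF c(1) e(1,2) fin S \<theta> L1 low high])
    also have "\<dots> \<le> t ^ 6 * ?Q + t ^ 6 * ?QF + 54 * (1 / t) * mx f x"
      using L3 eight Q0 mx0 Lt t0 by (intro add_mono mult_right_mono) (auto simp: frac_le)
    finally show ?thesis using sup0(1)[of k0] unfolding inv t6 by (simp add: distrib_left)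
  qed
  then show ?thesis by (simp add: sum.distrib F_def)
qed

section \<open>Summing over the scales\<close>

lemma sum_dyadic_blocks:
  fixes g :: "int \<Rightarrow> 'a::comm_monoid_add"
  assumes "J \<le> L"
  shows "(\<Sum>n\<in>{1..<2 ^ L}. g n) = (\<Sum>n\<in>{1..<2 ^ J}. g n) + (\<Sum>j\<in>{J..<L}. \<Sum>n\<in>{2 ^ j..<2 ^ Suc j}. g n)"
  using assms
proof (induction L rule: dec_induct)
  case (step L)
  have "{1..<2 ^ Suc L} = {1..<2 ^ L} \<union> {2 ^ L..<(2::int) ^ Suc L}"
    using one_le_power[of "2::int" L] by auto
  moreover have "{1..<2 ^ L} \<inter> {2 ^ L..<(2::int) ^ Suc L} = {}" by auto
  ultimately have "(\<Sum>n\<in>{1..<2 ^ Suc L}. g n) = (\<Sum>n\<in>{1..<2 ^ L}. g n) + (\<Sum>n\<in>{2 ^ L..<2 ^ Suc L}. g n)"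
    by (metis finite_atLeastLessThan_int sum.union_disjoint)
  then show ?case using step by (simp add: add.assoc)
qed simp

lemma sum_powr_upto_le:
  assumes "0 < a"
  shows "(\<Sum>j\<le>k. 2 powr (a * real j)) \<le> 2 powr (a * real k) / (1 - 2 powr (- a))"
proof -
  have r: "0 < 2 powr (- a)" "2 powr (- a) < 1" using assms powr_less_one[of 2 "- a"] by auto
  show ?thesis
  proof (induction k)
    case 0
    then show ?case using r by simp
  next
    case (Suc k)
    have "2 powr (a * real k) = 2 powr (a * real (Suc k)) * 2 powr (- a)"
      by (simp add: powr_add[symmetric] algebra_simps)
    moreover have "t + t * r / (1 - r) = t / (1 - r)" if "r < 1" for t r :: real
      using that by (simp add: field_simps)
    ultimately have "2 powr (a * real (Suc k)) + 2 powr (a * real k) / (1 - 2 powr (- a))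
        = 2 powr (a * real (Suc k)) / (1 - 2 powr (- a))"
      using r(2) by simp
    then show ?case using Suc by simp
  qed
qed

lemma sum_powr_neg_le:
  assumes "0 < a" "finite I"
  shows "(\<Sum>j\<in>I. 2 powr (- a * real j)) \<le> 1 / (1 - 2 powr (- a))"
proof -
  have "2 powr (- a * real j) = (2 powr (- a)) ^ j" for j
    by (simp add: powr_realpow[symmetric] powr_powr)
  then show ?thesis
    using sum_power_le_geometric[OF assms(2), of "2 powr (- a)"] assms(1) powr_less_one[of 2 "- a"] by simp
qed

text \<open>The weight is the loss \<open>2 powr (6 * \<epsilon> * j)\<close> of the Fejer
  expansion, summed over the scales \<open>j \<le> k\<close> that can reach level
  \<open>k\<close>.\<close>

definition scale_sum :: "real \<Rightarrow> real \<Rightarrow> nat \<Rightarrow> (int \<Rightarrow> complex) \<Rightarrow> int \<Rightarrow> real" where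
  "scale_sum c \<epsilon> K f x = (\<Sum>k\<le>K. 2 powr (6 * \<epsilon> * real k) *
    (osc_sup c (1 + c / 2) k f x + osc_sup c (1 + c / 2) k (\<lambda>y. of_real (cmod (f y))) x))"

text \<open>The alternative \<open>L \<le> j\<close> guarantees a least element even for
  \<open>\<theta> = 0\<close>. Only the modulus of \<open>\<theta>\<close> enters, so both
  half-lines get the same cutoff.\<close>

definition cutoff :: "real \<Rightarrow> nat \<Rightarrow> real \<Rightarrow> nat" where
  "cutoff c L \<theta> = (LEAST j. L \<le> j \<or> 1 \<le> \<bar>\<theta>\<bar> * (2 ^ j) powr c)"

lemma cutoff:
  assumes c: "0 < c"
  shows "cutoff c L \<theta> \<le> L"
    and "\<And>j. j < cutoff c L \<theta> \<Longrightarrow> \<bar>\<theta>\<bar> * (2 ^ j) powr c < 1"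
    and "\<And>j. \<lbrakk>cutoff c L \<theta> \<le> j; j < L\<rbrakk> \<Longrightarrow> 1 \<le> \<bar>\<theta>\<bar> * (2 ^ j) powr c"
proof -
  let ?P = "\<lambda>j. L \<le> j \<or> 1 \<le> \<bar>\<theta>\<bar> * (2 ^ j) powr c"
  show "cutoff c L \<theta> \<le> L" unfolding cutoff_def by (rule Least_le) simp
  show "\<bar>\<theta>\<bar> * (2 ^ j) powr c < 1" if "j < cutoff c L \<theta>" for j
    using not_less_Least[of j ?P] that unfolding cutoff_def by auto
  show "1 \<le> \<bar>\<theta>\<bar> * (2 ^ j) powr c" if j: "cutoff c L \<theta> \<le> j" "j < L" for j
  proof -
    have "?P (cutoff c L \<theta>)" unfolding cutoff_def by (rule LeastI[of ?P L]) simp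
    then have "1 \<le> \<bar>\<theta>\<bar> * (2 ^ cutoff c L \<theta>) powr c" using j by auto
    also have "\<dots> \<le> \<bar>\<theta>\<bar> * (2 ^ j) powr c"
      using c j by (intro mult_left_mono powr_mono2) (auto intro: power_increasing)
    finally show ?thesis .
  qed
qed

text \<open>One scale below the cutoff \<open>J\<close> the phase is less than 1, so
  \<open>\<bar>\<theta>\<bar> * (2 ^ J) powr c \<le> 2 powr c \<le> 4\<close>. Replacing the
  exponential by 1 costs at most \<open>8 * \<bar>\<theta>\<bar> * n powr c\<close>; after division
  by \<open>n\<close> this is uniformly of order \<open>2 ^ (-J)\<close>, and the sum becomes an
  average. Here \<open>32 = 8 * 4\<close>.\<close>

lemma low_scales_bound:
  fixes c \<theta> :: real
  assumes c: "1 < c" "c < 2" and fin: "finite S" and S: "\<And>y. y \<notin> S \<Longrightarrow> f y = 0"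
  shows "cmod ((\<Sum>n\<in>{1..<2 ^ cutoff c L \<theta>}. f (x - n) * ee (\<theta> * real_of_int \<lfloor>real_of_int n powr c\<rfloor>) / of_int n)
    - (\<Sum>n\<in>{1..<2 ^ cutoff c L \<theta>}. f (x - n) / of_int n)) \<le> 32 * mx f x"
proof (cases "cutoff c L \<theta>")
  case 0
  then show ?thesis using mx_nonneg[of S f x, OF fin S] by simp
next
  case (Suc i)
  define J where "J = cutoff c L \<theta>"
  have "\<bar>\<theta>\<bar> * (2 ^ i) powr c < 1" using Suc c by (intro cutoff(2)[where L = L]) auto
  moreover have "(2::real) powr c \<le> 2 powr 2" using c by (intro powr_mono) auto
  moreover have "(2 ^ J) powr c = (2::real) powr c * (2 ^ i) powr c"
    by (simp add: J_def Suc powr_mult)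
  ultimately have size: "\<bar>\<theta>\<bar> * (2 ^ J) powr c \<le> 4"
    using mult_mono[of "2 powr c" 4 "\<bar>\<theta>\<bar> * (2 ^ i) powr c" 1] by (simp add: mult_ac)
  have "(\<Sum>n\<in>{1..<2 ^ J}. f (x - n) * ee (\<theta> * real_of_int \<lfloor>real_of_int n powr c\<rfloor>) / of_int n) - (\<Sum>n\<in>{1..<2 ^ J}. f (x - n) / of_int n)
      = (\<Sum>n\<in>{1..<2 ^ J}. f (x - n) * (ee (\<theta> * real_of_int \<lfloor>real_of_int n powr c\<rfloor>) - ee 0) / of_int n)"
    unfolding sum_subtractf[symmetric] by (simp add: algebra_simps diff_divide_distrib)
  also have "cmod \<dots> \<le> (\<Sum>n\<in>{1..<2 ^ J}. 8 * \<bar>\<theta>\<bar> * (2 ^ J) powr (c - 1) * cmod (f (x - n)))"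
  proof (rule sum_norm_le)
    fix n :: int assume n: "n \<in> {1..<2 ^ J}"
    have n1: "1 \<le> real_of_int n" "real_of_int n \<le> 2 ^ J"
    proof -
      show "1 \<le> real_of_int n" using n by simp
      have "n \<le> 2 ^ J" using n by simp
      then have "real_of_int n \<le> real_of_int (2 ^ J)" by (simp only: of_int_le_iff)
      then show "real_of_int n \<le> 2 ^ J" by simp
    qed
    let ?m = "real_of_int \<lfloor>real_of_int n powr c\<rfloor>"
    have "cmod (ee (\<theta> * ?m) - ee 0) \<le> 2 * pi * \<bar>\<theta> * ?m - 0\<bar>" by (rule norm_ee_diff_le)
    also have "\<dots> = 2 * pi * (\<bar>\<theta>\<bar> * ?m)" using n1 by (simp add: abs_mult)
    also have "\<dots> \<le> 2 * 4 * (\<bar>\<theta>\<bar> * real_of_int n powr c)"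
      using pi_less_4 by (intro mult_mono mult_left_mono) auto
    also have "2 * 4 * (\<bar>\<theta>\<bar> * real_of_int n powr c) \<le> 8 * (\<bar>\<theta>\<bar> * ((2 ^ J) powr (c - 1) * real_of_int n))"
    proof -
      have "real_of_int n powr c = real_of_int n powr (c - 1) * real_of_int n"
        using n1 by (simp add: powr_diff)
      also have "\<dots> \<le> (2 ^ J) powr (c - 1) * real_of_int n"
        using n1 c by (intro mult_right_mono powr_mono2) auto
      finally show ?thesis by (simp add: mult_left_mono)
    qed
    finally have "cmod (f (x - n)) * cmod (ee (\<theta> * ?m) - ee 0) \<le> cmod (f (x - n)) * (8 * (\<bar>\<theta>\<bar> * ((2 ^ J) powr (c - 1) * real_of_int n)))"
      by (intro mult_left_mono) auto
    then have "cmod (f (x - n)) * cmod (ee (\<theta> * ?m) - ee 0) / real_of_int n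
        \<le> cmod (f (x - n)) * (8 * (\<bar>\<theta>\<bar> * ((2 ^ J) powr (c - 1) * real_of_int n))) / real_of_int n"
      using n1 by (intro divide_right_mono) auto
    also have "\<dots> = 8 * \<bar>\<theta>\<bar> * (2 ^ J) powr (c - 1) * cmod (f (x - n))" using n1 by simp
    finally show "cmod (f (x - n) * (ee (\<theta> * ?m) - ee 0) / of_int n) \<le> 8 * \<bar>\<theta>\<bar> * (2 ^ J) powr (c - 1) * cmod (f (x - n))"
      using n1 by (simp add: norm_mult norm_divide)
  qed
  also have "\<dots> = 8 * \<bar>\<theta>\<bar> * (2 ^ J) powr (c - 1) * (\<Sum>n\<in>{1..<2 ^ J}. cmod (f (x - n)))"
    by (simp only: sum_distrib_left)
  also have "(\<Sum>n\<in>{1..<2 ^ J}. cmod (f (x - n))) \<le> 2 ^ J * mx f x"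
  proof -
    have "(\<Sum>n\<in>{1..<2 ^ J}. cmod (f (x - n))) = (\<Sum>y\<in>{x - 2 ^ J<..<x}. cmod (f y))"
      by (rule sum.reindex_bij_witness[where i = "\<lambda>y. x - y" and j = "\<lambda>n. x - n"]) auto
    also have "\<dots> \<le> (\<Sum>y\<in>{x - int (2 ^ J)..x + int (2 ^ J)}. cmod (f y))"
      by (intro sum_mono2) (auto intro: order_trans[OF less_imp_le])
    also have "\<dots> = 2 ^ J * avg (2 ^ J) f x" by (simp add: avg_def)
    also have "\<dots> \<le> 2 ^ J * mx f x" by (intro mult_left_mono avg_le_mx[of S f, OF fin S]) auto
    finally show ?thesis .
  qed
  also have "8 * \<bar>\<theta>\<bar> * (2 ^ J) powr (c - 1) * (2 ^ J * mx f x) = 8 * (\<bar>\<theta>\<bar> * (2 ^ J) powr c) * mx f x"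
    by (simp add: powr_diff)
  also have "\<dots> \<le> 8 * 4 * mx f x"
    using size mx_nonneg[of S f x, OF fin S] by (intro mult_right_mono mult_left_mono) auto
  finally show ?thesis by (simp add: J_def mult_left_mono)
qed

lemma half_line_bound:
  fixes c \<epsilon> \<theta> :: real
  assumes c: "1 < c" "c < 2" and \<epsilon>: "0 < \<epsilon>" "\<epsilon> \<le> c - 1" "7 * \<epsilon> \<le> 1 - c / 2"
    and fin: "finite S" and S: "\<And>y. y \<notin> S \<Longrightarrow> f y = 0" and \<theta>: "\<bar>\<theta>\<bar> \<le> 1/2"
  shows "cmod ((\<Sum>n\<in>{1..<2 ^ L}. f (x - n) * ee (\<theta> * real_of_int \<lfloor>real_of_int n powr c\<rfloor>) / of_int n)
      - (\<Sum>n\<in>{1..<2 ^ cutoff c L \<theta>}. f (x - n) / of_int n))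
    \<le> (32 + 54 / (1 - 2 powr (- \<epsilon>))) * mx f x + (1 + 1 / (1 - 2 powr (- (6 * \<epsilon>)))) * scale_sum c \<epsilon> (2 * L) f x"
proof -
  define J where "J = cutoff c L \<theta>"
  define e where "e = 1 + c / 2"
  have e: "1 \<le> e" using c by (simp add: e_def)
  note J = cutoff[where c = c and L = L and \<theta> = \<theta>, folded J_def]
  have JL: "J \<le> L" using c by (intro J(1)) auto
  define F where "F = (\<lambda>y. complex_of_real (cmod (f y)))"
  have F: "F y = 0" if "y \<notin> S" for y using S[OF that] by (simp add: F_def)
  define s where "s k = osc_sup c e k f x + osc_sup c e k F x" for k
  have sup0: "0 \<le> osc_sup c e k f x" "0 \<le> osc_sup c e k F x" for k
    using osc_sup_nonneg[of S f, OF fin S e] osc_sup_nonneg[of S F, OF fin F e] by auto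
  have s0: "0 \<le> s k" "osc_sup c e k f x \<le> s k" for k using sup0[of k] by (auto simp: s_def)
  have mx0: "0 \<le> mx f x" by (rule mx_nonneg[of S f, OF fin S])
  have sc: "scale_sum c \<epsilon> (2 * L) f x = (\<Sum>k\<le>2 * L. 2 powr (6 * \<epsilon> * real k) * s k)"
    by (simp add: scale_sum_def s_def F_def e_def)
  define k0 where "k0 j = nat \<lfloor>log 2 (\<bar>\<theta>\<bar> * (2 ^ j) powr c)\<rfloor>" for j
  have high: "(\<Sum>j\<in>{J..<L}. cmod (floor_osc c j \<theta> f x))
      \<le> 54 / (1 - 2 powr (- \<epsilon>)) * mx f x + (1 + 1 / (1 - 2 powr (- (6 * \<epsilon>)))) * scale_sum c \<epsilon> (2 * L) f x"
  proof -
    have "(\<Sum>j\<in>{J..<L}. cmod (floor_osc c j \<theta> f x))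
        \<le> (\<Sum>j\<in>{J..<L}. osc_sup c e (k0 j) f x + 2 powr (6 * \<epsilon> * j) * (\<Sum>k\<in>{j..2 * j}. s k)
            + 54 * 2 powr (- \<epsilon> * j) * mx f x)"
    proof (rule sum_mono)
      fix j assume "j \<in> {J..<L}"
      then have one: "1 \<le> \<bar>\<theta>\<bar> * (2 ^ j) powr c" using c by (intro J(3)) auto
      show "cmod (floor_osc c j \<theta> f x) \<le> osc_sup c e (k0 j) f x + 2 powr (6 * \<epsilon> * j) * (\<Sum>k\<in>{j..2 * j}. s k)
            + 54 * 2 powr (- \<epsilon> * j) * mx f x"
        unfolding s_def e_def F_def k0_def
        by (rule floor_osc_bound[of c \<epsilon> S f, OF c \<epsilon> fin _ \<theta> one]) (rule S)
    qed
    also have "\<dots> = (\<Sum>j\<in>{J..<L}. osc_sup c e (k0 j) f x) + (\<Sum>j\<in>{J..<L}. 2 powr (6 * \<epsilon> * j) * (\<Sum>k\<in>{j..2 * j}. s k))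
        + 54 * mx f x * (\<Sum>j\<in>{J..<L}. 2 powr (- \<epsilon> * j))"
      by (simp add: sum.distrib sum_distrib_left mult_ac)
    finally have split: "(\<Sum>j\<in>{J..<L}. cmod (floor_osc c j \<theta> f x))
      \<le> (\<Sum>j\<in>{J..<L}. osc_sup c e (k0 j) f x) + (\<Sum>j\<in>{J..<L}. 2 powr (6 * \<epsilon> * j) * (\<Sum>k\<in>{j..2 * j}. s k))
        + 54 * mx f x * (\<Sum>j\<in>{J..<L}. 2 powr (- \<epsilon> * j))" .
    \<comment> \<open>For fixed \<open>\<theta>\<close> the quantity
      \<open>\<bar>\<theta>\<bar> * (2 ^ j) powr c\<close> more than doubles with each scale, so
      distinct scales have distinct levels and every \<open>osc_sup\<close> is used at most
      once.\<close>
    have A: "(\<Sum>j\<in>{J..<L}. osc_sup c e (k0 j) f x) \<le> scale_sum c \<epsilon> (2 * L) f x"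
    proof -
      have lg: "log 2 (\<bar>\<theta>\<bar> * (2 ^ j) powr c) = log 2 \<bar>\<theta>\<bar> + real j * c" "0 \<le> log 2 \<bar>\<theta>\<bar> + real j * c"
          "log 2 \<bar>\<theta>\<bar> \<le> 0" if "j \<in> {J..<L}" for j
      proof -
        have one: "1 \<le> \<bar>\<theta>\<bar> * (2 ^ j) powr c" using c that by (intro J(3)) auto
        then have "\<theta> \<noteq> 0" by auto
        then show eq: "log 2 (\<bar>\<theta>\<bar> * (2 ^ j) powr c) = log 2 \<bar>\<theta>\<bar> + real j * c"
          by (simp add: log_mult log_powr log_nat_power mult.commute)
        have "0 \<le> log 2 (\<bar>\<theta>\<bar> * (2 ^ j) powr c)" using one by simp
        then show "0 \<le> log 2 \<bar>\<theta>\<bar> + real j * c" unfolding eq .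
        show "log 2 \<bar>\<theta>\<bar> \<le> 0" using \<theta> \<open>\<theta> \<noteq> 0\<close> by simp
      qed
      have mono: "k0 i < k0 j" if "i \<in> {J..<L}" "j \<in> {J..<L}" "i < j" for i j
      proof -
        have "real i + 1 \<le> real j" using that by linarith
        then have "(real i + 1) * c \<le> real j * c" using c by (intro mult_right_mono) auto
        then have "log 2 \<bar>\<theta>\<bar> + real i * c + 1 \<le> log 2 \<bar>\<theta>\<bar> + real j * c" using c by (simp add: distrib_right)
        then have "\<lfloor>log 2 \<bar>\<theta>\<bar> + real i * c\<rfloor> + 1 \<le> \<lfloor>log 2 \<bar>\<theta>\<bar> + real j * c\<rfloor>" by linarith
        moreover have "0 \<le> \<lfloor>log 2 \<bar>\<theta>\<bar> + real i * c\<rfloor>" using lg(2)[OF that(1)] by simp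
        ultimately show ?thesis unfolding k0_def lg(1)[OF that(1)] lg(1)[OF that(2)] by linarith
      qed
      have inj: "inj_on k0 {J..<L}"
      proof (rule inj_onI)
        fix i j assume "i \<in> {J..<L}" "j \<in> {J..<L}" "k0 i = k0 j"
        then show "i = j" using mono[of i j] mono[of j i] by (cases i j rule: linorder_cases) auto
      qed
      have sub: "k0 ` {J..<L} \<subseteq> {..2 * L}"
      proof safe
        fix j assume j: "j \<in> {J..<L}"
        have "real j * c \<le> real L * 2" using j c by (intro mult_mono) auto
        then have "log 2 \<bar>\<theta>\<bar> + real j * c \<le> 2 * real L" using lg(3)[OF j] by linarith
        then have "real (k0 j) \<le> 2 * real L" unfolding k0_def lg(1)[OF j] using lg(2)[OF j] by linarith
        then show "k0 j \<le> 2 * L" by linarith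
      qed
      have "(\<Sum>j\<in>{J..<L}. osc_sup c e (k0 j) f x) = (\<Sum>k\<in>k0 ` {J..<L}. osc_sup c e k f x)"
        by (simp add: sum.reindex[OF inj])
      also have "\<dots> \<le> (\<Sum>k\<le>2 * L. osc_sup c e k f x)"
        using sub sup0 by (intro sum_mono2) auto
      also have "\<dots> \<le> (\<Sum>k\<le>2 * L. 2 powr (6 * \<epsilon> * real k) * s k)"
      proof (rule sum_mono)
        fix k
        have "1 \<le> 2 powr (6 * \<epsilon> * real k)" using \<epsilon> by (intro ge_one_powr_ge_zero) auto
        then have "1 * s k \<le> 2 powr (6 * \<epsilon> * real k) * s k" using s0 by (intro mult_right_mono) auto
        then show "osc_sup c e k f x \<le> 2 powr (6 * \<epsilon> * real k) * s k" using s0(2)[of k] by linarith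
      qed
      finally show ?thesis unfolding sc .
    qed
    \<comment> \<open>After exchanging the sums, level \<open>k\<close> collects the geometric sum
      of \<open>2 powr (6 * \<epsilon> * j)\<close> over \<open>j \<le> k\<close>, dominated by its
      last term.\<close>
    have B: "(\<Sum>j\<in>{J..<L}. 2 powr (6 * \<epsilon> * j) * (\<Sum>k\<in>{j..2 * j}. s k)) \<le> 1 / (1 - 2 powr (- (6 * \<epsilon>))) * scale_sum c \<epsilon> (2 * L) f x"
    proof -
      have "(\<Sum>j\<in>{J..<L}. 2 powr (6 * \<epsilon> * j) * (\<Sum>k\<in>{j..2 * j}. s k))
          \<le> (\<Sum>j\<in>{J..<L}. \<Sum>k\<le>2 * L. if j \<le> k then 2 powr (6 * \<epsilon> * j) * s k else 0)"
      proof (rule sum_mono)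
        fix j assume j: "j \<in> {J..<L}"
        have "(\<Sum>k\<in>{j..2 * j}. s k) \<le> (\<Sum>k\<in>{k\<in>{..2 * L}. j \<le> k}. s k)"
          using j s0 by (intro sum_mono2) auto
        then have "2 powr (6 * \<epsilon> * j) * (\<Sum>k\<in>{j..2 * j}. s k) \<le> 2 powr (6 * \<epsilon> * j) * (\<Sum>k\<in>{k\<in>{..2 * L}. j \<le> k}. s k)"
          by (intro mult_left_mono) auto
        also have "\<dots> = (\<Sum>k\<le>2 * L. if j \<le> k then 2 powr (6 * \<epsilon> * j) * s k else 0)"
          unfolding sum_distrib_left by (rule sum.inter_filter) simp
        finally show "2 powr (6 * \<epsilon> * j) * (\<Sum>k\<in>{j..2 * j}. s k) \<le> (\<Sum>k\<le>2 * L. if j \<le> k then 2 powr (6 * \<epsilon> * j) * s k else 0)" .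
      qed
      also have "\<dots> = (\<Sum>k\<le>2 * L. \<Sum>j\<in>{J..<L}. if j \<le> k then 2 powr (6 * \<epsilon> * j) * s k else 0)"
        by (rule sum.swap)
      also have "\<dots> \<le> (\<Sum>k\<le>2 * L. 1 / (1 - 2 powr (- (6 * \<epsilon>))) * (2 powr (6 * \<epsilon> * real k) * s k))"
      proof (rule sum_mono)
        fix k
        have "(\<Sum>j\<in>{J..<L}. if j \<le> k then 2 powr (6 * \<epsilon> * j) * s k else 0)
            = (\<Sum>j\<in>{j\<in>{J..<L}. j \<le> k}. 2 powr (6 * \<epsilon> * j)) * s k"
          unfolding sum_distrib_right by (rule sum.inter_filter[symmetric]) simp
        also have "\<dots> \<le> (\<Sum>j\<le>k. 2 powr (6 * \<epsilon> * j)) * s k"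
          using s0 by (intro mult_right_mono sum_mono2) auto
        also have "\<dots> \<le> (2 powr (6 * \<epsilon> * real k) / (1 - 2 powr (- (6 * \<epsilon>)))) * s k"
          using s0 \<epsilon> by (intro mult_right_mono sum_powr_upto_le) auto
        finally show "(\<Sum>j\<in>{J..<L}. if j \<le> k then 2 powr (6 * \<epsilon> * j) * s k else 0)
            \<le> 1 / (1 - 2 powr (- (6 * \<epsilon>))) * (2 powr (6 * \<epsilon> * real k) * s k)" by simp
      qed
      finally show ?thesis unfolding sc sum_distrib_left .
    qed
    have C: "54 * mx f x * (\<Sum>j\<in>{J..<L}. 2 powr (- \<epsilon> * j)) \<le> 54 * mx f x * (1 / (1 - 2 powr (- \<epsilon>)))"
      using mx0 \<epsilon> by (intro mult_left_mono sum_powr_neg_le) auto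
    have "54 * mx f x * (1 / (1 - 2 powr (- \<epsilon>))) = 54 / (1 - 2 powr (- \<epsilon>)) * mx f x" by simp
    then show ?thesis using split A B C by (simp only: distrib_right mult_1)
  qed
  let ?U = "\<Sum>n\<in>{1..<2 ^ J}. f (x - n) * ee (\<theta> * real_of_int \<lfloor>real_of_int n powr c\<rfloor>) / of_int n"
  have "(\<Sum>n\<in>{1..<2 ^ L}. f (x - n) * ee (\<theta> * real_of_int \<lfloor>real_of_int n powr c\<rfloor>) / of_int n)
      - (\<Sum>n\<in>{1..<2 ^ J}. f (x - n) / of_int n)
      = (?U - (\<Sum>n\<in>{1..<2 ^ J}. f (x - n) / of_int n)) + (\<Sum>j\<in>{J..<L}. floor_osc c j \<theta> f x)"
    unfolding sum_dyadic_blocks[OF JL] floor_osc_def by simp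
  also have "cmod \<dots> \<le> cmod (?U - (\<Sum>n\<in>{1..<2 ^ J}. f (x - n) / of_int n)) + (\<Sum>j\<in>{J..<L}. cmod (floor_osc c j \<theta> f x))"
    by (intro order_trans[OF norm_triangle_ineq] add_left_mono norm_sum)
  also have "\<dots> \<le> 32 * mx f x + (54 / (1 - 2 powr (- \<epsilon>)) * mx f x + (1 + 1 / (1 - 2 powr (- (6 * \<epsilon>)))) * scale_sum c \<epsilon> (2 * L) f x)"
    using low_scales_bound[of c S f, OF c fin S, where x = x and L = L and \<theta> = \<theta>] high
    unfolding J_def by (rule add_mono)
  finally show ?thesis by (simp only: J_def distrib_right add.assoc)
qed

text \<open>Writing \<open>2 powr (6 * \<epsilon> * k)\<close> as
  \<open>2 powr (- 6 * \<epsilon> * k) * 2 powr (12 * \<epsilon> * k)\<close> lets Jensen's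
  inequality use the summable first factor as weight. The p-th power of the second is absorbed by
  the decay \<open>2 powr (- \<delta> * k)\<close> as soon as
  \<open>\<epsilon> \<le> \<delta> / (12 * p)\<close>. The constant is independent of
  \<open>K\<close>, hence of any truncation of the kernel.\<close>

lemma scale_sum_strong:
  fixes c p :: real
  assumes c: "1 < c" "c < 2" and p: "1 < p"
  shows "\<exists>\<epsilon>0>0. \<forall>\<epsilon>. 0 < \<epsilon> \<longrightarrow> \<epsilon> \<le> \<epsilon>0 \<longrightarrow> (\<exists>C>0. \<forall>X S K f. finite X \<longrightarrow> finite S \<longrightarrow> (\<forall>y. y \<notin> S \<longrightarrow> f y = 0) \<longrightarrow>
    (\<Sum>x\<in>X. scale_sum c \<epsilon> K f x powr p) \<le> C * (\<Sum>y\<in>S. cmod (f y) powr p))"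
proof -
  define e where "e = 1 + c / 2"
  have e: "1 \<le> e" "e < 2" using c by (auto simp: e_def)
  from osc_sup_strong[OF c e p] obtain A \<delta> where A: "0 < A" "0 < \<delta>"
    "\<forall>X S k f. finite X \<longrightarrow> finite S \<longrightarrow> (\<forall>y. y \<notin> S \<longrightarrow> f y = 0) \<longrightarrow>
    (\<Sum>x\<in>X. osc_sup c e k f x powr p) \<le> A * 2 powr (- \<delta> * real k) * (\<Sum>y\<in>S. cmod (f y) powr p)"
    by (elim exE conjE) (rule that)
  have "\<exists>C>0. \<forall>X S K f. finite X \<longrightarrow> finite S \<longrightarrow> (\<forall>y. y \<notin> S \<longrightarrow> f y = 0) \<longrightarrow>
    (\<Sum>x\<in>X. scale_sum c \<epsilon> K f x powr p) \<le> C * (\<Sum>y\<in>S. cmod (f y) powr p)"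
    if \<epsilon>: "0 < \<epsilon>" "\<epsilon> \<le> \<delta> / (12 * p)" for \<epsilon>
  proof -
    define W where "W = 1 / (1 - 2 powr (- (6 * \<epsilon>)))"
    have W: "0 < W" using \<epsilon> powr_less_one[of 2 "- (6 * \<epsilon>)"] by (simp add: W_def)
    define B where "B = 2 powr p * (A + A)"
    have B: "0 < B" using A by (simp add: B_def)
    have "(\<Sum>x\<in>X. scale_sum c \<epsilon> K f x powr p) \<le> W powr (p - 1) * (W * B) * (\<Sum>y\<in>S. cmod (f y) powr p)"
      if fin: "finite X" "finite S" and S: "\<And>y. y \<notin> S \<Longrightarrow> f y = 0" for X S K f
    proof -
      define F where "F = (\<lambda>y. complex_of_real (cmod (f y)))"
      have F: "F y = 0" if "y \<notin> S" for y using S[OF that] by (simp add: F_def)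
      define s where "s k x = osc_sup c e k f x + osc_sup c e k F x" for k x
      let ?N = "\<Sum>y\<in>S. cmod (f y) powr p"
      have sup0: "0 \<le> osc_sup c e k f x" "0 \<le> osc_sup c e k F x" for k x
        using osc_sup_nonneg[of S f, OF fin(2) S e(1)] osc_sup_nonneg[of S F, OF fin(2) F e(1)] by auto
      have N0: "0 \<le> ?N" by (simp add: sum_nonneg)
      have sB: "(\<Sum>x\<in>X. s k x powr p) \<le> B * 2 powr (- \<delta> * real k) * ?N" for k
      proof -
        have "(\<Sum>x\<in>X. s k x powr p) \<le> (\<Sum>x\<in>X. 2 powr p * (osc_sup c e k f x powr p + osc_sup c e k F x powr p))"
          unfolding s_def using sup0 p by (intro sum_mono powr_add_le) auto
        also have "\<dots> = 2 powr p * ((\<Sum>x\<in>X. osc_sup c e k f x powr p) + (\<Sum>x\<in>X. osc_sup c e k F x powr p))"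
          by (simp only: sum_distrib_left[symmetric] sum.distrib)
        also have "\<dots> \<le> 2 powr p * (A * 2 powr (- \<delta> * real k) * ?N + A * 2 powr (- \<delta> * real k) * (\<Sum>y\<in>S. cmod (F y) powr p))"
          using A(3)[rule_format, OF fin, of f k] A(3)[rule_format, OF fin, of F k] S F
          by (intro mult_left_mono add_mono) auto
        also have "(\<Sum>y\<in>S. cmod (F y) powr p) = ?N" by (simp add: F_def)
        finally show ?thesis by (simp add: B_def algebra_simps)
      qed
      have pw: "scale_sum c \<epsilon> K f x powr p
          \<le> W powr (p - 1) * (\<Sum>k\<le>K. 2 powr (- (6 * \<epsilon>) * real k) * (2 powr (12 * \<epsilon> * p * real k) * s k x powr p))" for x
      proof -
        have "2 powr (- (6 * \<epsilon>) * real k) * 2 powr (12 * \<epsilon> * real k) = 2 powr (6 * \<epsilon> * real k)" for k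
          unfolding powr_add[symmetric] by (rule arg_cong[where f = "\<lambda>t. 2 powr t"]) (simp add: algebra_simps)
        then have eq: "scale_sum c \<epsilon> K f x = (\<Sum>k\<le>K. 2 powr (- (6 * \<epsilon>) * real k) * (2 powr (12 * \<epsilon> * real k) * s k x))"
          unfolding scale_sum_def s_def e_def F_def by (simp only: mult.assoc[symmetric])
        have "scale_sum c \<epsilon> K f x powr p
            \<le> W powr (p - 1) * (\<Sum>k\<le>K. 2 powr (- (6 * \<epsilon>) * real k) * (2 powr (12 * \<epsilon> * real k) * s k x) powr p)"
          unfolding eq
        proof (rule powr_sum_weighted_le[OF p])
          show "(\<Sum>k\<le>K. 2 powr (- (6 * \<epsilon>) * real k)) \<le> W"
            unfolding W_def by (rule sum_powr_neg_le) (use \<epsilon> in simp_all)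
          show "0 \<le> 2 powr (12 * \<epsilon> * real k) * s k x" for k
            using sup0[of k x] unfolding s_def by (intro mult_nonneg_nonneg add_nonneg_nonneg) auto
        qed simp_all
        also have "\<dots> = W powr (p - 1) * (\<Sum>k\<le>K. 2 powr (- (6 * \<epsilon>) * real k) * (2 powr (12 * \<epsilon> * p * real k) * s k x powr p))"
        proof -
          have "(2 powr (12 * \<epsilon> * real k) * s k x) powr p = 2 powr (12 * \<epsilon> * p * real k) * s k x powr p" for k
          proof -
            have "(2 powr (12 * \<epsilon> * real k)) powr p = 2 powr (12 * \<epsilon> * p * real k)"
              unfolding powr_powr by (rule arg_cong[where f = "\<lambda>t. 2 powr t"]) (simp only: mult_ac)
            then show ?thesis by (simp only: powr_mult)
          qed
          then show ?thesis by (simp only:)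
        qed
        finally show ?thesis .
      qed
      have "(\<Sum>x\<in>X. scale_sum c \<epsilon> K f x powr p)
          \<le> (\<Sum>x\<in>X. W powr (p - 1) * (\<Sum>k\<le>K. 2 powr (- (6 * \<epsilon>) * real k) * (2 powr (12 * \<epsilon> * p * real k) * s k x powr p)))"
        by (rule sum_mono) (rule pw)
      also have "\<dots> = W powr (p - 1) * (\<Sum>k\<le>K. 2 powr (- (6 * \<epsilon>) * real k) * (2 powr (12 * \<epsilon> * p * real k) * (\<Sum>x\<in>X. s k x powr p)))"
        unfolding sum_distrib_left by (rule sum.swap)
      also have "\<dots> \<le> W powr (p - 1) * (\<Sum>k\<le>K. 2 powr (- (6 * \<epsilon>) * real k) * (B * ?N))"
      proof (intro mult_left_mono sum_mono)
        fix k
        have "12 * \<epsilon> * p \<le> \<delta>" using \<epsilon> p by (simp add: field_simps)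
        then have "12 * \<epsilon> * p * real k \<le> \<delta> * real k" by (rule mult_right_mono) simp
        then have "2 powr (12 * \<epsilon> * p * real k) \<le> 2 powr (\<delta> * real k)" by (intro powr_mono) auto
        then have "2 powr (12 * \<epsilon> * p * real k) * (\<Sum>x\<in>X. s k x powr p)
            \<le> 2 powr (\<delta> * real k) * (B * 2 powr (- \<delta> * real k) * ?N)"
          using sB[of k] by (intro mult_mono) (auto intro: sum_nonneg)
        also have "\<dots> = B * ?N" by (simp add: powr_minus)
        finally show "2 powr (12 * \<epsilon> * p * real k) * (\<Sum>x\<in>X. s k x powr p) \<le> B * ?N" .
      qed auto
      also have "\<dots> = W powr (p - 1) * ((\<Sum>k\<le>K. 2 powr (- (6 * \<epsilon>) * real k)) * (B * ?N))"
        by (simp only: sum_distrib_right)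
      also have "\<dots> \<le> W powr (p - 1) * (W * (B * ?N))"
        unfolding W_def using \<epsilon> B N0 by (intro mult_left_mono mult_right_mono sum_powr_neg_le) auto
      finally show ?thesis by (simp add: mult.assoc)
    qed
    then show ?thesis using W B by (intro exI[of _ "W powr (p - 1) * (W * B)"]) auto
  qed
  then show ?thesis using A(2) p by (intro exI[of _ "\<delta> / (12 * p)"]) auto
qed

section \<open>From finite sums to the norm inequality\<close>

lemma lp_norm_le:
  fixes g :: "int \<Rightarrow> real" and f :: "int \<Rightarrow> complex"
  assumes p: "1 < p" and fin: "finite {x. f x \<noteq> 0}" and C: "0 \<le> C"
    and bound: "\<And>X. finite X \<Longrightarrow> (\<Sum>x\<in>X. \<bar>g x\<bar> powr p) \<le> C * (\<Sum>y | f y \<noteq> 0. cmod (f y) powr p)"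
  shows "lp_norm p g \<le> ennreal (C powr (1 / p)) * lp_norm p f"
proof -
  let ?F = "\<Sum>y | f y \<noteq> 0. cmod (f y) powr p"
  have F0: "0 \<le> ?F" by (simp add: sum_nonneg)
  have "(\<lambda>x. cmod (f x) powr p) summable_on UNIV \<longleftrightarrow> (\<lambda>x. cmod (f x) powr p) summable_on {x. f x \<noteq> 0}"
    by (rule summable_on_cong_neutral) auto
  then have sf: "(\<lambda>x. cmod (f x) powr p) summable_on UNIV" using fin by simp
  have "(\<Sum>\<^sub>\<infinity>x. cmod (f x) powr p) = (\<Sum>\<^sub>\<infinity>x | f x \<noteq> 0. cmod (f x) powr p)"
    by (rule infsum_cong_neutral) auto
  then have nf: "lp_norm p f = ennreal (?F powr (1 / p))"
    using sf fin by (simp add: lp_norm_def)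
  \<comment> \<open>Bounded finite partial sums give summability, so the infinite branch of
    \<open>lp_norm\<close> is excluded for \<open>g\<close>.\<close>
  have sg: "(\<lambda>x. \<bar>g x\<bar> powr p) summable_on UNIV"
    using bound by (intro nonneg_bdd_above_summable_on) (auto intro!: bdd_aboveI2[where M = "C * ?F"])
  have "(\<Sum>\<^sub>\<infinity>x. \<bar>g x\<bar> powr p) \<le> C * ?F"
    using bound by (intro infsum_le_finite_sums sg) auto
  then have "(\<Sum>\<^sub>\<infinity>x. \<bar>g x\<bar> powr p) powr (1 / p) \<le> (C * ?F) powr (1 / p)"
    using p by (intro powr_mono2 infsum_nonneg) auto
  also have "\<dots> = C powr (1 / p) * ?F powr (1 / p)" using C F0 by (simp add: powr_mult)
  finally have "ennreal ((\<Sum>\<^sub>\<infinity>x. \<bar>g x\<bar> powr p) powr (1 / p)) \<le> ennreal (C powr (1 / p) * ?F powr (1 / p))"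
    by (rule ennreal_leI)
  then show ?thesis
    unfolding nf using sg by (simp add: lp_norm_def ennreal_mult)
qed

text \<open>\<open>f (x + n)\<close> is written \<open>f (- (- x - n))\<close> so that the second
  sum is literally the first one for the reflected function, at the point \<open>- x\<close> and
  with frequency \<open>\<sigma> * \<theta>\<close>.\<close>

lemma modulated_hilbert_split:
  fixes f :: "int \<Rightarrow> complex" and \<sigma> :: int
  assumes fin: "finite {x. f x \<noteq> 0}" and L: "\<And>n. f (x - n) \<noteq> 0 \<Longrightarrow> \<bar>n\<bar> < 2 ^ L"
    and pos: "\<And>n. 0 < n \<Longrightarrow> \<phi> n = \<lfloor>real_of_int n powr c\<rfloor>"
    and neg: "\<And>n. 0 < n \<Longrightarrow> \<phi> (- n) = \<sigma> * \<lfloor>real_of_int n powr c\<rfloor>"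
  shows "modulated_hilbert \<phi> \<theta> f x
    = (\<Sum>n\<in>{1..<2 ^ L}. f (x - n) * ee (\<theta> * real_of_int \<lfloor>real_of_int n powr c\<rfloor>) / of_int n)
    - (\<Sum>n\<in>{1..<2 ^ L}. f (- (- x - n)) * ee (of_int \<sigma> * \<theta> * real_of_int \<lfloor>real_of_int n powr c\<rfloor>) / of_int n)"
proof -
  let ?g = "\<lambda>n. f (x - n) * exp (2 * of_real pi * \<i> * of_real \<theta> * of_int (\<phi> n)) / of_int n"
  let ?P = "{1..<2 ^ L} :: int set"
  have ee: "exp (2 * of_real pi * \<i> * of_real \<theta> * of_int m) = ee (\<theta> * real_of_int m)" for m
    by (simp add: ee_def cis_conv_exp mult_ac)
  have "modulated_hilbert \<phi> \<theta> f x = (\<Sum>n | n \<noteq> 0 \<and> f (x - n) \<noteq> 0. ?g n)"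
    by (rule modulated_hilbert_finite_support(2)[OF fin])
  also have "\<dots> = (\<Sum>n\<in>?P \<union> uminus ` ?P. ?g n)"
  proof (rule sum.mono_neutral_left)
    show "{n. n \<noteq> 0 \<and> f (x - n) \<noteq> 0} \<subseteq> ?P \<union> uminus ` ?P"
    proof
      fix n assume n: "n \<in> {n. n \<noteq> 0 \<and> f (x - n) \<noteq> 0}"
      then have "\<bar>n\<bar> < 2 ^ L" "n \<noteq> 0" using L by auto
      then show "n \<in> ?P \<union> uminus ` ?P"
        by (cases "0 < n") (auto intro!: image_eqI[of n uminus "- n"])
    qed
  qed auto
  also have "\<dots> = (\<Sum>n\<in>?P. ?g n) + (\<Sum>n\<in>uminus ` ?P. ?g n)"
    by (rule sum.union_disjoint) auto
  also have "(\<Sum>n\<in>uminus ` ?P. ?g n) = (\<Sum>n\<in>?P. ?g (- n))"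
    by (subst sum.reindex) (auto simp: inj_on_def)
  also have "(\<Sum>n\<in>?P. ?g n) = (\<Sum>n\<in>?P. f (x - n) * ee (\<theta> * real_of_int \<lfloor>real_of_int n powr c\<rfloor>) / of_int n)"
    by (intro sum.cong refl) (simp add: pos ee)
  also have "(\<Sum>n\<in>?P. ?g (- n))
      = - (\<Sum>n\<in>?P. f (- (- x - n)) * ee (of_int \<sigma> * \<theta> * real_of_int \<lfloor>real_of_int n powr c\<rfloor>) / of_int n)"
    unfolding sum_negf[symmetric]
  proof (rule sum.cong)
    fix n :: int assume "n \<in> ?P"
    then have "\<phi> (- n) = \<sigma> * \<lfloor>real_of_int n powr c\<rfloor>" by (intro neg) auto
    then have "exp (2 * of_real pi * \<i> * of_real \<theta> * of_int (\<phi> (- n)))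
        = ee (of_int \<sigma> * \<theta> * real_of_int \<lfloor>real_of_int n powr c\<rfloor>)"
      unfolding ee by (simp add: mult_ac)
    then show "?g (- n) = - (f (- (- x - n)) * ee (of_int \<sigma> * \<theta> * real_of_int \<lfloor>real_of_int n powr c\<rfloor>) / of_int n)"
      by (simp add: add.commute)
  qed simp
  finally show ?thesis by simp
qed

text \<open>\<open>\<sigma> = 1\<close> is the even phase and \<open>\<sigma> = -1\<close> the odd
  one; they differ only in the frequency on the negative half-line. The remainders \<open>P0\<close>
  and \<open>Q0\<close> of the two half-lines are subtracted before any norm is taken, since only
  their difference is a truncated Hilbert transform.\<close>

lemma modulated_carleson_sums:
  fixes c p :: real and \<sigma> :: int
  assumes c: "1 < c" "c < 2" and p: "1 < p" and \<sigma>: "\<bar>\<sigma>\<bar> = 1"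
    and pos: "\<And>n. 0 < n \<Longrightarrow> \<phi> n = \<lfloor>real_of_int n powr c\<rfloor>"
    and neg: "\<And>n. 0 < n \<Longrightarrow> \<phi> (- n) = \<sigma> * \<lfloor>real_of_int n powr c\<rfloor>"
  shows "\<exists>C>0. \<forall>X f. finite X \<longrightarrow> finite {x. f x \<noteq> 0} \<longrightarrow>
    (\<Sum>x\<in>X. \<bar>modulated_carleson \<phi> f x\<bar> powr p) \<le> C * (\<Sum>y | f y \<noteq> 0. cmod (f y) powr p)"
proof -
  obtain \<epsilon>0 where \<epsilon>0: "0 < \<epsilon>0" "\<forall>\<epsilon>. 0 < \<epsilon> \<longrightarrow> \<epsilon> \<le> \<epsilon>0 \<longrightarrow> (\<exists>C>0. \<forall>X S K f. finite X \<longrightarrow> finite S \<longrightarrow> (\<forall>y. y \<notin> S \<longrightarrow> f y = 0) \<longrightarrow>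
    (\<Sum>x\<in>X. scale_sum c \<epsilon> K f x powr p) \<le> C * (\<Sum>y\<in>S. cmod (f y) powr p))"
    using scale_sum_strong[OF c p] by (elim exE conjE) (rule that)
  define \<epsilon> where "\<epsilon> = min \<epsilon>0 (min (c - 1) ((1 - c / 2) / 7))"
  have "\<epsilon> \<le> (1 - c / 2) / 7" unfolding \<epsilon>_def by linarith
  then have "7 * \<epsilon> \<le> 1 - c / 2" by (simp only: le_divide_eq) simp
  moreover have "0 < \<epsilon>" "\<epsilon> \<le> \<epsilon>0" "\<epsilon> \<le> c - 1"
    using \<epsilon>0(1) c by (auto simp: \<epsilon>_def)
  ultimately have \<epsilon>: "0 < \<epsilon>" "\<epsilon> \<le> \<epsilon>0" "\<epsilon> \<le> c - 1" "7 * \<epsilon> \<le> 1 - c / 2"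
    by blast+
  from \<epsilon>0(2)[rule_format, OF \<epsilon>(1,2)] obtain E where E: "0 < E"
    "\<forall>X S K f. finite X \<longrightarrow> finite S \<longrightarrow> (\<forall>y. y \<notin> S \<longrightarrow> f y = 0) \<longrightarrow>
    (\<Sum>x\<in>X. scale_sum c \<epsilon> K f x powr p) \<le> E * (\<Sum>y\<in>S. cmod (f y) powr p)"
    by (elim exE conjE) (rule that)
  from trunc_hilb_strong[OF p] obtain H where H: "0 < H"
    "\<forall>X S N (f :: int \<Rightarrow> complex). finite X \<longrightarrow> finite S \<longrightarrow> (\<forall>y. y \<notin> S \<longrightarrow> f y = 0) \<longrightarrow> (\<forall>x. 1 \<le> N x) \<longrightarrow>
    (\<Sum>x\<in>X. norm (trunc_hilb (N x) f x) powr p) \<le> H * (\<Sum>y\<in>S. norm (f y) powr p)"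
    by (elim exE conjE) (rule that)
  from mx_strong[OF p, where 'a = complex] obtain D where D: "0 < D"
    "\<forall>X S (f :: int \<Rightarrow> complex). finite X \<longrightarrow> finite S \<longrightarrow>
    (\<forall>y. y \<notin> S \<longrightarrow> f y = 0) \<longrightarrow> (\<Sum>x\<in>X. mx f x powr p) \<le> D * (\<Sum>y\<in>S. norm (f y) powr p)"
    by (elim exE conjE) (rule that)
  define A where "A = 32 + 54 / (1 - 2 powr (- \<epsilon>))"
  define B where "B = 1 + 1 / (1 - 2 powr (- (6 * \<epsilon>)))"
  have AB: "0 < A" "0 < B"
    using \<epsilon>(1) powr_less_one[of 2 "- \<epsilon>"] powr_less_one[of 2 "- (6 * \<epsilon>)"]
    by (auto simp: A_def B_def intro!: add_pos_pos)
  define V where "V L f x = A * mx f x + B * scale_sum c \<epsilon> (2 * L) f x" for L f x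
  define G where "G = 2 powr p * (A powr p * D + B powr p * E)"
  have G: "0 < G" using AB D E by (simp add: G_def add_pos_pos)
  have V0: "0 \<le> V L f x" if "finite S" "\<And>y. y \<notin> S \<Longrightarrow> f y = 0" for L S f x
  proof -
    have e: "1 \<le> 1 + c / 2" using c by simp
    have "0 \<le> mx f x" by (rule mx_nonneg[of S f, OF that])
    moreover have "0 \<le> scale_sum c \<epsilon> (2 * L) f x"
      unfolding scale_sum_def using osc_sup_nonneg[of S f "1 + c / 2", OF that e]
        osc_sup_nonneg[of S "\<lambda>y. of_real (cmod (f y))" "1 + c / 2", OF that(1) _ e] that(2)
      by (intro sum_nonneg mult_nonneg_nonneg add_nonneg_nonneg) auto
    ultimately show ?thesis unfolding V_def using AB by (intro add_nonneg_nonneg mult_nonneg_nonneg) auto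
  qed
  have V_strong: "(\<Sum>x\<in>X. V L f x powr p) \<le> G * (\<Sum>y\<in>S. cmod (f y) powr p)"
    if fin: "finite X" "finite S" and S: "\<And>y. y \<notin> S \<Longrightarrow> f y = 0" for X S L f
  proof -
    have e: "1 \<le> 1 + c / 2" using c by simp
    let ?F = "\<Sum>y\<in>S. cmod (f y) powr p" and ?s = "\<lambda>x. scale_sum c \<epsilon> (2 * L) f x"
    have m0: "0 \<le> mx f x" for x by (rule mx_nonneg[of S f, OF fin(2) S])
    have s0: "0 \<le> ?s x" for x
      unfolding scale_sum_def using osc_sup_nonneg[of S f "1 + c / 2", OF fin(2) S e]
        osc_sup_nonneg[of S "\<lambda>y. of_real (cmod (f y))" "1 + c / 2", OF fin(2) _ e] S
      by (intro sum_nonneg mult_nonneg_nonneg add_nonneg_nonneg) auto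
    have "(\<Sum>x\<in>X. V L f x powr p) \<le> (\<Sum>x\<in>X. 2 powr p * (A powr p * mx f x powr p + B powr p * ?s x powr p))"
    proof (rule sum_mono)
      fix x
      have "V L f x powr p \<le> 2 powr p * ((A * mx f x) powr p + (B * ?s x) powr p)"
        unfolding V_def using AB p m0 s0 by (intro powr_add_le mult_nonneg_nonneg) auto
      then show "V L f x powr p \<le> 2 powr p * (A powr p * mx f x powr p + B powr p * ?s x powr p)"
        by (simp only: powr_mult)
    qed
    also have "\<dots> = 2 powr p * (A powr p * (\<Sum>x\<in>X. mx f x powr p) + B powr p * (\<Sum>x\<in>X. ?s x powr p))"
      by (simp only: sum_distrib_left[symmetric] sum.distrib)
    also have "\<dots> \<le> 2 powr p * (A powr p * (D * ?F) + B powr p * (E * ?F))"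
      using D(2)[rule_format, OF fin, of f] E(2)[rule_format, OF fin, of f] S
      by (intro mult_left_mono add_mono) auto
    also have "\<dots> = G * ?F" by (simp add: G_def algebra_simps)
    finally show ?thesis .
  qed
  define C where "C = 2 powr p * (2 powr p * (H + 2 powr p * (G + G)))"
  have "(\<Sum>x\<in>X. \<bar>modulated_carleson \<phi> f x\<bar> powr p) \<le> C * (\<Sum>y | f y \<noteq> 0. cmod (f y) powr p)"
    if X: "finite X" and fin: "finite {x. f x \<noteq> 0}" for X and f :: "int \<Rightarrow> complex"
  proof -
    define S where "S = {x. f x \<noteq> 0}"
    have finS: "finite S" using fin by (simp add: S_def)
    have fS: "f y = 0" if "y \<notin> S" for y using that by (simp add: S_def)
    define r where "r y = f (- y)" for y
    define S' where "S' = uminus ` S"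
    have finS': "finite S'" using finS by (simp add: S'_def)
    have rS: "r y = 0" if "y \<notin> S'" for y
      using that fS[of "- y"] unfolding r_def S'_def by (metis imageI minus_minus)
    have rF: "(\<Sum>y\<in>S'. cmod (r y) powr p) = (\<Sum>y\<in>S. cmod (f y) powr p)"
      unfolding S'_def by (subst sum.reindex) (auto simp: r_def inj_on_def)
    \<comment> \<open>One dyadic length covers the finite set \<open>X\<close> together with the
      support of \<open>f\<close>; no constant depends on it.\<close>
    obtain L where L: "\<And>x n. \<lbrakk>x \<in> X; f (x - n) \<noteq> 0\<rbrakk> \<Longrightarrow> \<bar>n\<bar> < 2 ^ L"
    proof (rule that)
      let ?T = "(\<lambda>(x, y). \<bar>x - y\<bar>) ` (X \<times> S)"
      let ?m = "nat (Max (insert 0 ?T))"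
      fix x n assume "x \<in> X" "f (x - n) \<noteq> 0"
      then have "(x, x - n) \<in> X \<times> S" by (auto simp: S_def)
      then have "\<bar>x - (x - n)\<bar> \<in> ?T" by (rule image_eqI[rotated]) simp
      then have "\<bar>n\<bar> \<le> Max (insert 0 ?T)" using X finS by (intro Max_ge) auto
      then have "\<bar>n\<bar> \<le> int ?m" by linarith
      also have "\<dots> < 2 ^ ?m" using of_nat_less_two_power[of ?m, where 'a = int] by simp
      finally show "\<bar>n\<bar> < 2 ^ ?m" .
    qed
    let ?I = "{-1/2..<1/2} :: real set"
    have bdd: "bdd_above ((\<lambda>\<theta>. cmod (modulated_hilbert \<phi> \<theta> f x)) ` ?I)" for x
      by (rule bdd_above_modulated_hilbert[OF fin])
    have "\<exists>\<theta>\<in>?I. modulated_carleson \<phi> f x \<le> 2 * cmod (modulated_hilbert \<phi> \<theta> f x)" for x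
      unfolding modulated_carleson_def by (rule sup_half[OF _ bdd]) auto
    then obtain \<theta> where \<theta>: "\<And>x. \<theta> x \<in> ?I" "\<And>x. modulated_carleson \<phi> f x \<le> 2 * cmod (modulated_hilbert \<phi> (\<theta> x) f x)"
      by metis
    have mc0: "0 \<le> modulated_carleson \<phi> f x" for x
      unfolding modulated_carleson_def by (rule cSUP_upper2[OF bdd, of 0]) auto
    define N where "N x = (2::nat) ^ cutoff c L (\<theta> x)" for x
    have N1: "1 \<le> N x" for x by (simp add: N_def)
    have pw: "cmod (modulated_hilbert \<phi> (\<theta> x) f x) \<le> cmod (trunc_hilb (N x) f x) + (V L f x + V L r (- x))"
      if x: "x \<in> X" for x
    proof -
      let ?u = "\<lambda>n. real_of_int \<lfloor>real_of_int n powr c\<rfloor>" and ?J = "cutoff c L (\<theta> x)"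
      have half: "\<bar>\<theta> x\<bar> \<le> 1/2" "\<bar>of_int \<sigma> * \<theta> x\<bar> \<le> 1/2"
      proof -
        show "\<bar>\<theta> x\<bar> \<le> 1/2" using \<theta>(1)[of x] by auto
        moreover have "\<bar>real_of_int \<sigma>\<bar> = 1" using \<sigma> by (metis of_int_1 of_int_abs)
        ultimately show "\<bar>of_int \<sigma> * \<theta> x\<bar> \<le> 1/2" by (simp add: abs_mult)
      qed
      \<comment> \<open>The sign \<open>\<sigma>\<close> does not move the cutoff, so
        \<open>P0 - Q0\<close> is a symmetric truncation.\<close>
      have cut: "cutoff c L (of_int \<sigma> * \<theta> x) = ?J"
      proof -
        have "\<bar>real_of_int \<sigma>\<bar> = 1" using \<sigma> by (metis of_int_1 of_int_abs)
        then show ?thesis by (simp add: cutoff_def abs_mult)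
      qed
      define P where "P = (\<Sum>n\<in>{1..<2 ^ L}. f (x - n) * ee (\<theta> x * ?u n) / of_int n)"
      define P0 where "P0 = (\<Sum>n\<in>{1..<2 ^ ?J}. f (x - n) / of_int n)"
      define Q where "Q = (\<Sum>n\<in>{1..<2 ^ L}. r (- x - n) * ee (of_int \<sigma> * \<theta> x * ?u n) / of_int n)"
      define Q0 where "Q0 = (\<Sum>n\<in>{1..<2 ^ ?J}. r (- x - n) / of_int n)"
      have mh: "modulated_hilbert \<phi> (\<theta> x) f x = P - Q"
        unfolding P_def Q_def r_def
        by (rule modulated_hilbert_split) (use fin L[OF x] pos neg in auto)
      have "cmod (P - P0) \<le> V L f x"
        unfolding P_def P0_def V_def A_def B_def
        by (rule half_line_bound[OF c \<epsilon>(1,3,4) finS _ half(1)]) (rule fS)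
      moreover have "cmod (Q - Q0) \<le> V L r (- x)"
        unfolding Q_def Q0_def V_def A_def B_def cut[symmetric]
        by (rule half_line_bound[OF c \<epsilon>(1,3,4) finS' _ half(2)]) (rule rS)
      moreover have "trunc_hilb (N x) f x = P0 - Q0"
        unfolding trunc_hilb_def P0_def Q0_def N_def r_def sum_subtractf[symmetric]
        by (intro sum.cong) (auto simp: diff_divide_distrib add.commute)
      moreover have "P - Q = (P0 - Q0) + ((P - P0) - (Q - Q0))" by simp
      ultimately show ?thesis
        unfolding mh using norm_triangle_ineq[of "P0 - Q0" "(P - P0) - (Q - Q0)"] norm_triangle_ineq4[of "P - P0" "Q - Q0"]
        by simp
    qed
    let ?F = "\<Sum>y\<in>S. cmod (f y) powr p"
    have "(\<Sum>x\<in>X. \<bar>modulated_carleson \<phi> f x\<bar> powr p)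
        \<le> (\<Sum>x\<in>X. 2 powr p * (2 powr p * (cmod (trunc_hilb (N x) f x) powr p + 2 powr p * (V L f x powr p + V L r (- x) powr p))))"
    proof (rule sum_mono)
      fix x assume x: "x \<in> X"
      have v: "0 \<le> V L f x" "0 \<le> V L r (- x)" using V0[of S f, OF finS fS] V0[of S' r, OF finS' rS] by auto
      let ?t = "cmod (trunc_hilb (N x) f x)"
      have "\<bar>modulated_carleson \<phi> f x\<bar> powr p \<le> (2 * (?t + (V L f x + V L r (- x)))) powr p"
        using p mc0[of x] \<theta>(2)[of x] pw[OF x] by (intro powr_mono2) auto
      also have "\<dots> = 2 powr p * (?t + (V L f x + V L r (- x))) powr p" by (simp only: powr_mult)
      also have "\<dots> \<le> 2 powr p * (2 powr p * (?t powr p + (V L f x + V L r (- x)) powr p))"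
        using p v by (intro mult_left_mono powr_add_le) auto
      also have "\<dots> \<le> 2 powr p * (2 powr p * (?t powr p + 2 powr p * (V L f x powr p + V L r (- x) powr p)))"
        using p v by (intro mult_left_mono add_left_mono powr_add_le) auto
      finally show "\<bar>modulated_carleson \<phi> f x\<bar> powr p
        \<le> 2 powr p * (2 powr p * (?t powr p + 2 powr p * (V L f x powr p + V L r (- x) powr p)))" .
    qed
    also have "\<dots> = 2 powr p * (2 powr p * ((\<Sum>x\<in>X. cmod (trunc_hilb (N x) f x) powr p)
        + 2 powr p * ((\<Sum>x\<in>X. V L f x powr p) + (\<Sum>x\<in>X. V L r (- x) powr p))))"
      by (simp only: sum_distrib_left[symmetric] sum.distrib)
    also have "\<dots> \<le> 2 powr p * (2 powr p * (H * ?F + 2 powr p * (G * ?F + G * ?F)))"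
    proof (intro mult_left_mono add_mono)
      show "(\<Sum>x\<in>X. cmod (trunc_hilb (N x) f x) powr p) \<le> H * ?F"
        using X finS fS N1 by (intro H(2)[rule_format]) auto
      show "(\<Sum>x\<in>X. V L f x powr p) \<le> G * ?F" by (rule V_strong[OF X finS]) (rule fS)
      \<comment> \<open>The reflected half-line is summed over the reflected set; \<open>rF\<close>
        returns from \<open>r\<close> to \<open>f\<close>.\<close>
      have "(\<Sum>x\<in>X. V L r (- x) powr p) = (\<Sum>x\<in>uminus ` X. V L r x powr p)"
        by (subst sum.reindex) (auto simp: inj_on_def)
      also have "\<dots> \<le> G * (\<Sum>y\<in>S'. cmod (r y) powr p)"
        by (rule V_strong[OF _ finS']) (use X rS in auto)
      finally show "(\<Sum>x\<in>X. V L r (- x) powr p) \<le> G * ?F" unfolding rF .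
    qed auto
    also have "\<dots> = C * ?F" by (simp add: C_def algebra_simps)
    finally show ?thesis by (simp only: S_def)
  qed
  moreover have "0 < C" using H G by (simp add: C_def add_pos_pos)
  ultimately show ?thesis by (intro exI[of _ C]) auto
qed

theorem theorem1:
  fixes c p :: real
  assumes "1 < c" "c < 2" "1 < p"
  shows "\<exists>C>0. \<forall>f :: int \<Rightarrow> complex. finite {x. f x \<noteq> 0} \<longrightarrow>
           lp_norm p (carleson c f) \<le> ennreal C * lp_norm p f \<and>
           lp_norm p (carleson_sgn c f) \<le> ennreal C * lp_norm p f"
proof -
  have "\<exists>C>0. \<forall>X f. finite X \<longrightarrow> finite {x. f x \<noteq> 0} \<longrightarrow>
      (\<Sum>x\<in>X. \<bar>carleson c f x\<bar> powr p) \<le> C * (\<Sum>y | f y \<noteq> 0. cmod (f y) powr p)"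
    unfolding carleson_def by (rule modulated_carleson_sums[OF assms, where \<sigma> = 1]) auto
  then obtain C1 where C1: "0 < C1" "\<And>X f. \<lbrakk>finite X; finite {x. f x \<noteq> 0}\<rbrakk> \<Longrightarrow>
      (\<Sum>x\<in>X. \<bar>carleson c f x\<bar> powr p) \<le> C1 * (\<Sum>y | f y \<noteq> 0. cmod (f y) powr p)"
    by blast
  have "\<exists>C>0. \<forall>X f. finite X \<longrightarrow> finite {x. f x \<noteq> 0} \<longrightarrow>
      (\<Sum>x\<in>X. \<bar>carleson_sgn c f x\<bar> powr p) \<le> C * (\<Sum>y | f y \<noteq> 0. cmod (f y) powr p)"
    unfolding carleson_sgn_def by (rule modulated_carleson_sums[OF assms, where \<sigma> = "-1"]) auto
  then obtain C2 where C2: "0 < C2" "\<And>X f. \<lbrakk>finite X; finite {x. f x \<noteq> 0}\<rbrakk> \<Longrightarrow>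
      (\<Sum>x\<in>X. \<bar>carleson_sgn c f x\<bar> powr p) \<le> C2 * (\<Sum>y | f y \<noteq> 0. cmod (f y) powr p)"
    by blast
  define C where "C = max (C1 powr (1 / p)) (C2 powr (1 / p))"
  have "0 < C" using C1(1) by (simp add: C_def less_max_iff_disj)
  moreover have "lp_norm p (carleson c f) \<le> ennreal C * lp_norm p f \<and>
      lp_norm p (carleson_sgn c f) \<le> ennreal C * lp_norm p f"
    if fin: "finite {x. f x \<noteq> 0}" for f :: "int \<Rightarrow> complex"
  proof
    have "lp_norm p (carleson c f) \<le> ennreal (C1 powr (1 / p)) * lp_norm p f"
      using C1 fin by (intro lp_norm_le[OF assms(3)]) auto
    also have "\<dots> \<le> ennreal C * lp_norm p f"
      by (intro mult_right_mono ennreal_leI) (auto simp: C_def)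
    finally show "lp_norm p (carleson c f) \<le> ennreal C * lp_norm p f" .
    have "lp_norm p (carleson_sgn c f) \<le> ennreal (C2 powr (1 / p)) * lp_norm p f"
      using C2 fin by (intro lp_norm_le[OF assms(3)]) auto
    also have "\<dots> \<le> ennreal C * lp_norm p f"
      by (intro mult_right_mono ennreal_leI) (auto simp: C_def)
    finally show "lp_norm p (carleson_sgn c f) \<le> ennreal C * lp_norm p f" .
  qed
  ultimately show ?thesis by blast
qed

end
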